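(* Let $d\in\{2,3\}$. There exists $\epsilon=\epsilon(d)\in(0,1)$ such that for every $\vec s=(s_1,\dots,s_d)\in[1-\epsilon,1]^d$ (in particular for $\vec s=(1,\dots,1)$) there is a constant $A\ge1$, depending only on $d$ and $\vec s$, with the following property. Let $0<r<1$ and let $\nu$ be a finite positive Borel measure on $\mathbb D^d$ with $\operatorname{supp}\nu\subset r\mathbb D^d$. Let $C_\nu$ be the smallest constant such that $$\int_{\mathbb D^d}|f(z)|^2\,d\nu(z)\le C_\nu\,\|f\|^2_{\mathcal H_{\vec s}(\mathbb D^d)}\qquad\text{for all } f\in\mathcal H_{\vec s}(\mathbb D^d),$$ and let $B_\nu$ be the smallest constant such that $$\sum_{R\subseteq Q}w_{\vec s}(R)\,\nu(T(R))^2\le B_\nu\,\nu(T(Q))\qquad\text{for all dyadic rectangles } Q\subseteq\mathbb T^d,$$ where the sum is over dyadic rectangles $R$ contained in $Q$. Then $A^{-1}B_\nu\le C_\nu\le A\,B_\nu$. In particular, $A$ does not depend on $\nu$ or $r$.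
   Context: $\mathbb D$ is the open unit disc in $\mathbb C$ and $\mathbb T=\partial\mathbb D$. For $\vec s\in\mathbb R^d$, $\mathcal H_{\vec s}(\mathbb D^d)$ is the Hilbert space of analytic functions $f(z)=\sum_{n_1,\dots,n_d\ge0}\widehat f(n_1,\dots,n_d)z_1^{n_1}\cdots z_d^{n_d}$ on $\mathbb D^d$ with finite norm $$\|f\|^2_{\mathcal H_{\vec s}(\mathbb D^d)}=\sum_{n_1,\dots,n_d\ge0}|\widehat f(n_1,\dots,n_d)|^2(n_1+1)^{s_1}\cdots(n_d+1)^{s_d}.$$ Fix a dyadic lattice on $\mathbb T$ in each coordinate: for each $m\ge0$, the generation-$m$ dyadic arcs are $2^m$ half-open arcs of length $2\pi\cdot2^{-m}$ partitioning $\mathbb T$, each being the union of two dyadic arcs of generation $m+1$; the only arc of generation $0$ is $\mathbb T$. A dyadic rectangle is a product $R=I_1\times\dots\times I_d$ of dyadic arcs $I_j$ from the $j$-th lattice. For a dyadic arc $I$ of generation $m$, the tent above $I$ is $T(I)=\{z\in\mathbb D:1-2^{-m}\le|z|<1,\ z/|z|\in I\}$ (with $T(\mathbb T)=\mathbb D$), and $T(R)=T(I_1)\times\dots\times T(I_d)$. The weight is $w_{\vec s}(R)=\prod_{j=1}^d 2^{m_j(1-s_j)}$, where $m_j$ is the generation of $I_j$ (so $w_{\vec s}\equiv1$ if $\vec s=(1,\dots,1)$). *)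

theory Defs
  imports "HOL-Analysis.Analysis" "HOL-Library.Disjoint_Sets"
begin

section \<open>The spaces of analytic functions on the polydisc\<close>

definition polydisc :: "(complex ^ 'd::finite) set"
  where "polydisc = {z. \<forall>j. norm (z $ j) < 1}"

definition monomial :: "('d::finite \<Rightarrow> nat) \<Rightarrow> complex ^ 'd \<Rightarrow> complex"
  where "monomial n z = (\<Prod>j\<in>UNIV. (z $ j) ^ n j)"

text \<open>The summation over multi-indices is unconditional (equivalently, absolutely convergent),
  so no ordering of the multi-indices is involved. A function is analytic on the polydisc iff it has
  such an expansion. Values outside the polydisc are irrelevant.\<close>

definition has_power_series ::
    "(complex ^ 'd::finite \<Rightarrow> complex) \<Rightarrow> (('d \<Rightarrow> nat) \<Rightarrow> complex) \<Rightarrow> bool"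
  where "has_power_series f a \<longleftrightarrow>
    (\<forall>z\<in>polydisc. ((\<lambda>n. a n * monomial n z) has_sum f z) UNIV)"

definition analytic_on_polydisc :: "(complex ^ 'd::finite \<Rightarrow> complex) \<Rightarrow> bool"
  where "analytic_on_polydisc f \<longleftrightarrow> (\<exists>a. has_power_series f a)"

definition taylor_coeff :: "(complex ^ 'd::finite \<Rightarrow> complex) \<Rightarrow> ('d \<Rightarrow> nat) \<Rightarrow> complex"
  where "taylor_coeff f = (THE a. has_power_series f a)"

definition H_term :: "real ^ 'd::finite \<Rightarrow> (complex ^ 'd \<Rightarrow> complex) \<Rightarrow> ('d \<Rightarrow> nat) \<Rightarrow> real"
  where "H_term s f n =
    (norm (taylor_coeff f n))\<^sup>2 * (\<Prod>j\<in>UNIV. (real (n j) + 1) powr (s $ j))"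

definition H_space :: "real ^ 'd::finite \<Rightarrow> (complex ^ 'd \<Rightarrow> complex) set"
  where "H_space s = {f. analytic_on_polydisc f \<and> H_term s f summable_on UNIV}"

definition H_norm_sq :: "real ^ 'd::finite \<Rightarrow> (complex ^ 'd \<Rightarrow> complex) \<Rightarrow> real"
  where "H_norm_sq s f = (\<Sum>\<^sub>\<infinity>n. H_term s f n)"


section \<open>Dyadic lattices, rectangles and tents\<close>

text \<open>Both orientations of half-open arcs are allowed.\<close>

definition half_open_arc :: "real \<Rightarrow> complex set \<Rightarrow> bool"
  where "half_open_arc l I \<longleftrightarrow> (\<exists>a. I = cis ` {a..<a + l} \<or> I = cis ` {a<..a + l})"

text \<open>\<open>D m\<close> is the set of arcs of generation \<open>m\<close>.\<close>

definition dyadic_lattice :: "(nat \<Rightarrow> complex set set) \<Rightarrow> bool"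
  where "dyadic_lattice D \<longleftrightarrow>
    (\<forall>m. partition_on (sphere 0 1) (D m) \<and> card (D m) = 2 ^ m \<and>
         (\<forall>I\<in>D m. half_open_arc (2 * pi / 2 ^ m) I) \<and>
         (\<forall>I\<in>D m. \<exists>J\<in>D (Suc m). \<exists>K\<in>D (Suc m). J \<noteq> K \<and> I = J \<union> K))"

text \<open>Arcs of different generations of a lattice have different lengths, so the generation of an
  arc is unique.\<close>

definition generation :: "(nat \<Rightarrow> complex set set) \<Rightarrow> complex set \<Rightarrow> nat"
  where "generation D I = (THE m. I \<in> D m)"

text \<open>The full circle is treated separately because \<open>z / norm z\<close> does not lie on the circle
  for \<open>z = 0\<close>.\<close>

definition tent :: "(nat \<Rightarrow> complex set set) \<Rightarrow> complex set \<Rightarrow> complex set"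
  where "tent D I =
    (if I = sphere 0 1 then ball 0 1
     else {z. 1 - 1 / 2 ^ generation D I \<le> norm z \<and> norm z < 1 \<and> z / of_real (norm z) \<in> I})"

definition box_prod :: "('d::finite \<Rightarrow> complex set) \<Rightarrow> (complex ^ 'd) set"
  where "box_prod I = {z. \<forall>j. z $ j \<in> I j}"

text \<open>Dyadic rectangles \<open>box_prod R\<close> are represented by the family \<open>R\<close> of their sides, which the
  rectangle determines since all arcs are nonempty.\<close>

definition dyadic_rectangles ::
    "('d::finite \<Rightarrow> nat \<Rightarrow> complex set set) \<Rightarrow> ('d \<Rightarrow> complex set) set"
  where "dyadic_rectangles D = {R. \<forall>j. R j \<in> (\<Union>m. D j m)}"

definition rect_tent ::
    "('d::finite \<Rightarrow> nat \<Rightarrow> complex set set) \<Rightarrow> ('d \<Rightarrow> complex set) \<Rightarrow> (complex ^ 'd) set"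
  where "rect_tent D R = box_prod (\<lambda>j. tent (D j) (R j))"

definition rect_weight ::
    "('d::finite \<Rightarrow> nat \<Rightarrow> complex set set) \<Rightarrow> real ^ 'd \<Rightarrow> ('d \<Rightarrow> complex set) \<Rightarrow> real"
  where "rect_weight D s R = (\<Prod>j\<in>UNIV. 2 powr (real (generation (D j) (R j)) * (1 - s $ j)))"


section \<open>Measures on the polydisc and the two constants\<close>

definition finite_borel_measure_on_polydisc :: "(complex ^ 'd::finite) measure \<Rightarrow> bool"
  where "finite_borel_measure_on_polydisc \<nu> \<longleftrightarrow>
    sets \<nu> = sets (restrict_space borel polydisc) \<and> finite_measure \<nu>"

definition measure_supp :: "'a::topological_space measure \<Rightarrow> 'a set"
  where "measure_supp \<nu> =
    {x \<in> space \<nu>. \<forall>U. open U \<longrightarrow> x \<in> U \<longrightarrow> emeasure \<nu> (U \<inter> space \<nu>) > 0}"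

text \<open>The infima are taken in \<open>ennreal\<close>, where \<open>top\<close> is the value if there is no finite constant.
  They are attained, i.e. they are the smallest constants, and they are finite if the support of
  \<open>\<nu>\<close> lies in a smaller polydisc.\<close>

definition embedding_const :: "real ^ 'd::finite \<Rightarrow> (complex ^ 'd) measure \<Rightarrow> ennreal"
  where "embedding_const s \<nu> =
    Inf {C. \<forall>f\<in>H_space s.
      (\<integral>\<^sup>+z. ennreal ((norm (f z))\<^sup>2) \<partial>\<nu>) \<le> C * ennreal (H_norm_sq s f)}"

definition testing_const ::
    "('d::finite \<Rightarrow> nat \<Rightarrow> complex set set) \<Rightarrow> real ^ 'd \<Rightarrow> (complex ^ 'd) measure \<Rightarrow> ennreal"
  where "testing_const D s \<nu> =
    Inf {B. \<forall>Q\<in>dyadic_rectangles D.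
      (\<Sum>\<^sub>\<infinity>R\<in>{R \<in> dyadic_rectangles D. box_prod R \<subseteq> box_prod Q}.
         ennreal (rect_weight D s R) * (emeasure \<nu> (rect_tent D R))\<^sup>2)
      \<le> B * emeasure \<nu> (rect_tent D Q)}"

end

(*
By duality both constants are those of quadratic forms. The embedding constant is comparable to the
best C in  int int K(z,w) g(z) conj(g(w)) <= C int |g|^2,  where K is a product of one-variable
kernels whose coefficients are comparable to (n+1)^(-s_j). The kernels  5 - Ln(1 - x)  for s_j = 1 and
(1 - x)^(s_j - 1)  for s_j close to 1 take values in a narrow sector, so Re K >= c |K|, and |K(z,w)| is
comparable to the sum of w(R) over the dyadic rectangles R such that z lies in T(R) and w lies in the
tent over a rectangle adjacent to R. This gives the lower bound on C_nu, with g the indicator function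
of T(Q), and reduces the upper bound to the embedding  sum w(R) (int_T(R) g)^2 <= C B int g^2
on a product of at most three finite trees.

For the discrete embedding let phi be an extremal function of its dual form, the Hardy inequality
int V^2 dmu <= N |phi|^2  with V the sum of w phi over the ancestors. Then phi is the dual Hardy
transform of V mu / N. In |phi|^2 the pairs omega <= alpha with V(omega) < K V(alpha) are controlled by
the box condition, which gives  sum w mu(alpha)^2 V(alpha)^2 <= B int V^2 dmu. In the remaining pairs
alpha has low potential compared to omega. If these ancestors contributed a fixed part of V(omega), then
V(omega) would be at most the Hardy transform of some psi, independent of omega, with
|psi|^2 <= C K^(-1/2) |phi|^2, so their total contribution is small if K is large. Hence N <= C B.
*)

theory Submission
  imports Defs
begin

subsection \<open>Elementary inequalities and sums over chains\<close>

text \<open>The obstacle is that the ancestors of a point in a product of trees do not form a chain,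
  and no maximum principle for potentials is at hand. \<open>low_potential_le\<close> is the
  substitute. The extremal function enters because it is the dual Hardy transform of a positive
  mass: its partial sums in one coordinate are then cumulative masses, which is the form that
  \<open>forest_sum_le\<close> requires. The argument is circular by design: the ancestors of low
  potential are estimated by the very embedding whose best constant N is sought. This closes because
  N is attained on a finite tree and the coefficient in front of it can be made small; none of the
  constants sees the depth of the tree. The number of coordinates is limited twice: a pair of
  ancestors in three coordinates cannot split two against two, and three kernel values of argument
  at most pi/8 multiply to one of argument at most 3 pi/8 < pi/2. The choice epsilon = 1/4 produces
  the angle pi/8.\<close>

lemma le_square_of_le_sqrt_mult:
  fixes x a c :: real
  assumes "x \<le> c * (sqrt a * sqrt x)" "0 \<le> x" "0 \<le> a" "0 \<le> c"
  shows "x \<le> c\<^sup>2 * a"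
proof (cases "x = 0")
  case True
  then show ?thesis using assms by simp
next
  case False
  then have "sqrt x * sqrt x \<le> (c * sqrt a) * sqrt x" "0 < sqrt x"
    using assms by (auto simp: mult_ac)
  then have "sqrt x \<le> c * sqrt a" by (rule mult_right_le_imp_le)
  then have "(sqrt x)\<^sup>2 \<le> (c * sqrt a)\<^sup>2"
    using assms by (intro power_mono) auto
  then show ?thesis using assms by (simp add: power_mult_distrib)
qed

lemma sum_mult_le_sqrt:
  fixes f g :: "'b \<Rightarrow> real"
  shows "(\<Sum>x\<in>A. f x * g x) \<le> sqrt (\<Sum>x\<in>A. (f x)\<^sup>2) * sqrt (\<Sum>x\<in>A. (g x)\<^sup>2)"
proof -
  have "(\<Sum>x\<in>A. f x * g x)\<^sup>2 \<le> (\<Sum>x\<in>A. (f x)\<^sup>2) * (\<Sum>x\<in>A. (g x)\<^sup>2)"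
    by (rule Cauchy_Schwarz_ineq_sum)
  then have "sqrt ((\<Sum>x\<in>A. f x * g x)\<^sup>2) \<le> sqrt ((\<Sum>x\<in>A. (f x)\<^sup>2) * (\<Sum>x\<in>A. (g x)\<^sup>2))"
    by (rule real_sqrt_le_mono)
  then show ?thesis by (simp add: real_sqrt_mult)
qed

text \<open>Serves to let the truncation error e of the kernel tend to zero while the factor c, a
  squared mass, stays fixed.\<close>

lemma le_of_le_add_eps:
  fixes a b c :: real
  assumes "\<And>e. 0 < e \<Longrightarrow> a \<le> b + e * c" "0 \<le> c"
  shows "a \<le> b"
proof (rule field_le_epsilon)
  fix e :: real assume e: "0 < e"
  have "a \<le> b + e / (c + 1) * c" using assms(1)[of "e / (c + 1)"] assms(2) e by auto
  also have "e / (c + 1) * c \<le> e" using e assms(2) by (simp add: field_simps)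
  finally show "a \<le> b + e" by simp
qed

text \<open>Two elements of a chain are comparable, so each product is counted by the sum over
  ordered pairs or by its transpose. The diagonal is counted twice, which is harmless for
  nonnegative terms.\<close>

lemma chain_square_le:
  fixes a :: "'a::order \<Rightarrow> real"
  assumes fin: "finite C" and nn: "\<And>x. x \<in> C \<Longrightarrow> 0 \<le> a x"
    and chain: "\<And>x y. x \<in> C \<Longrightarrow> y \<in> C \<Longrightarrow> x \<le> y \<or> y \<le> x"
  shows "(\<Sum>x\<in>C. a x)\<^sup>2 \<le> 2 * (\<Sum>x\<in>C. a x * (\<Sum>y\<in>{y\<in>C. x \<le> y}. a y))"
proof -
  define h where "h x y = (if x \<le> y then a x * a y else 0)" for x y
  have h: "(\<Sum>x\<in>C. a x * (\<Sum>y\<in>{y\<in>C. x \<le> y}. a y)) = (\<Sum>x\<in>C. \<Sum>y\<in>C. h x y)"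
    unfolding h_def using fin
    by (auto intro!: sum.cong simp: sum_distrib_left sum.inter_filter)
  have "(\<Sum>x\<in>C. a x)\<^sup>2 = (\<Sum>x\<in>C. \<Sum>y\<in>C. a x * a y)"
    by (simp add: power2_eq_square sum_product)
  also have "\<dots> \<le> (\<Sum>x\<in>C. \<Sum>y\<in>C. h x y + h y x)"
    by (intro sum_mono) (use chain nn in \<open>auto simp: h_def mult.commute\<close>)
  also have "\<dots> = (\<Sum>x\<in>C. \<Sum>y\<in>C. h x y) + (\<Sum>x\<in>C. \<Sum>y\<in>C. h y x)"
    by (simp add: sum.distrib)
  also have "(\<Sum>x\<in>C. \<Sum>y\<in>C. h y x) = (\<Sum>x\<in>C. \<Sum>y\<in>C. h x y)"
    by (rule sum.swap)
  finally show ?thesis using h by simp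
qed

text \<open>The left-hand side is the length of the interval from S to S + D times the least value
  there of the decreasing function u powr (-3/2), hence at most its integral.\<close>

lemma increment_le_sqrt_diff:
  fixes S D :: real
  assumes "0 < S" "0 \<le> D"
  shows "D / ((S + D) * sqrt (S + D)) \<le> 2 / sqrt S - 2 / sqrt (S + D)"
proof -
  define x y where "x = sqrt S" and "y = sqrt (S + D)"
  have xy: "0 < x" "x \<le> y" "D = y\<^sup>2 - x\<^sup>2" "S + D = y\<^sup>2"
    using assms by (auto simp: x_def y_def)
  have "(y\<^sup>2 - x\<^sup>2) / (y\<^sup>2 * y) \<le> 2 / x - 2 / y"
  proof -
    have y0: "0 < y" using xy by linarith
    have "2 / x - 2 / y - (y\<^sup>2 - x\<^sup>2) / (y\<^sup>2 * y) = (y - x) * (2 * y\<^sup>2 - x * (y + x)) / (x * y\<^sup>2 * y)"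
      using xy(1) y0 by (simp add: field_simps power2_eq_square)
    moreover have "x * (y + x) \<le> y * (y + y)"
      using xy y0 by (intro mult_mono) auto
    moreover from this have "0 \<le> (y - x) * (2 * y\<^sup>2 - x * (y + x)) / (x * y\<^sup>2 * y)"
      using xy y0 by (intro divide_nonneg_nonneg mult_nonneg_nonneg) (auto simp: power2_eq_square)
    ultimately show ?thesis by linarith
  qed
  then show ?thesis using assms by (simp add: x_def y_def)
qed

text \<open>A discrete form of \<open>\<integral>\<^bsub>U\<^esub>\<^bsup>\<infinity>\<^esup> v powr (- 3/2) dv = 2 / sqrt U\<close>, with \<open>v\<close> increasing down the chain.\<close>

lemma chain_sum_le:
  fixes D v :: "'a::order \<Rightarrow> real"
  assumes fin: "finite C" and nn: "\<And>x. x \<in> C \<Longrightarrow> 0 \<le> D x"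
    and chain: "\<And>x y. x \<in> C \<Longrightarrow> y \<in> C \<Longrightarrow> x \<le> y \<or> y \<le> x"
    and U: "0 < U"
    and v: "\<And>x. x \<in> C \<Longrightarrow> v x = U + (\<Sum>y\<in>{y\<in>C. x \<le> y}. D y)"
  shows "(\<Sum>x\<in>C. D x / (v x * sqrt (v x))) \<le> 2 / sqrt U - 2 / sqrt (U + (\<Sum>x\<in>C. D x))"
  using fin nn chain v
proof (induction "card C" arbitrary: C rule: less_induct)
  case less
  show ?case
  proof (cases "C = {}")
    case True
    then show ?thesis by simp
  next
    case False
    \<comment> \<open>The least element carries the complete sum, so deleting it changes no other
      \<open>v x\<close> and leaves the single increment up to \<open>v m\<close>.\<close>
    then obtain m where m: "m \<in> C" "\<And>x. x \<in> C \<Longrightarrow> x \<le> m \<Longrightarrow> x = m"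
      using finite_has_minimal[OF less.prems(1)] by blast
    have mle: "m \<le> x" if "x \<in> C" for x
      using less.prems(3)[OF m(1) that] m(2)[OF that] by auto
    let ?C = "C - {m}"
    have IH: "(\<Sum>x\<in>?C. D x / (v x * sqrt (v x))) \<le> 2 / sqrt U - 2 / sqrt (U + (\<Sum>x\<in>?C. D x))"
    proof (rule less.hyps)
      show "card ?C < card C" using m(1) less.prems(1) by (meson card_Diff1_less)
      fix x assume x: "x \<in> ?C"
      have "{y \<in> ?C. x \<le> y} = {y\<in>C. x \<le> y}"
        using x m(2)[of x] by auto
      then show "v x = U + (\<Sum>y\<in>{y\<in>?C. x \<le> y}. D y)"
        using less.prems(4)[of x] x by simp
    qed (use less.prems in auto)
    have "{y\<in>C. m \<le> y} = C" using mle by auto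
    then have vm: "v m = U + (\<Sum>x\<in>?C. D x) + D m"
      using less.prems(4)[OF m(1)] sum.remove[OF less.prems(1) m(1), of D] by simp
    have "D m / (v m * sqrt (v m)) \<le> 2 / sqrt (U + (\<Sum>x\<in>?C. D x)) - 2 / sqrt (v m)"
      unfolding vm
      by (rule increment_le_sqrt_diff)
         (use U less.prems m(1) in \<open>auto intro!: add_pos_nonneg sum_nonneg\<close>)
    moreover have "U + (\<Sum>x\<in>C. D x) = v m"
      using vm sum.remove[OF less.prems(1) m(1), of D] by simp
    ultimately show ?thesis
      using IH sum.remove[OF less.prems(1) m(1), of "\<lambda>x. D x / (v x * sqrt (v x))"] by simp
  qed
qed

text \<open>The product of w x with one factor j x is the increment of the potential v along a
  chain, which \<open>chain_sum_le\<close> can sum. The other factor j x is expanded into its point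
  masses, because for a single mass at \<open>e o'\<close> the nodes between \<open>e o'\<close> and
  a do form a chain. The masses below a then add up to j a.\<close>

lemma forest_sum_le:
  fixes w :: "'a::order \<Rightarrow> real" and m :: "'b \<Rightarrow> real" and e :: "'b \<Rightarrow> 'a"
  assumes fin: "finite T" "finite O'"
    and wnn: "\<And>x. x \<in> T \<Longrightarrow> 0 \<le> w x" and mnn: "\<And>o'. o' \<in> O' \<Longrightarrow> 0 \<le> m o'"
    and e: "\<And>o'. o' \<in> O' \<Longrightarrow> e o' \<in> T"
    and chain: "\<And>x y z. x \<in> T \<Longrightarrow> y \<in> T \<Longrightarrow> z \<in> T \<Longrightarrow> x \<le> y \<Longrightarrow> x \<le> z \<Longrightarrow> y \<le> z \<or> z \<le> y"
    and j: "\<And>x. x \<in> T \<Longrightarrow> j x = (\<Sum>o'\<in>{o'\<in>O'. e o' \<le> x}. m o')"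
    and v: "\<And>x. x \<in> T \<Longrightarrow> v x = (\<Sum>y\<in>{y\<in>T. x \<le> y}. w y * j y)"
    and a: "a \<in> T" "0 < v a"
  shows "(\<Sum>x\<in>{x\<in>T. x \<le> a}. w x * (j x)\<^sup>2 / (v x * sqrt (v x))) \<le> 3 * j a / sqrt (v a)"
proof -
  have jnn: "0 \<le> j x" if "x \<in> T" for x
    using j[OF that] mnn by (auto intro: sum_nonneg)
  define q where "q x = w x * j x / (v x * sqrt (v x))" for x
  have vnn: "0 \<le> v x" if "x \<in> T" for x
    using v[OF that] wnn jnn by (auto intro!: sum_nonneg mult_nonneg_nonneg)
  have qnn: "0 \<le> q x" if "x \<in> T" for x
    unfolding q_def using wnn[OF that] jnn[OF that] vnn[OF that] by auto
  have key: "(\<Sum>x\<in>{x\<in>T. b \<le> x \<and> x \<le> a}. q x) \<le> 3 / sqrt (v a)" if b: "b \<in> T" "b \<le> a" for b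
  proof -
    let ?C = "{x\<in>T. b \<le> x \<and> x < a}"
    \<comment> \<open>Strictly below a the chain sum starts from U = v a, which already contains all
      ancestors of a, and gives 2 / sqrt (v a). The node a itself adds at most 1 / sqrt (v a),
      whence the constant 3.\<close>
    have "(\<Sum>x\<in>?C. w x * j x / (v x * sqrt (v x)))
        \<le> 2 / sqrt (v a) - 2 / sqrt (v a + (\<Sum>x\<in>?C. w x * j x))"
    proof (rule chain_sum_le)
      fix x y assume "x \<in> ?C" "y \<in> ?C"
      then show "x \<le> y \<or> y \<le> x" using chain[of b x y] b by auto
    next
      fix x assume x: "x \<in> ?C"
      have "{y\<in>T. x \<le> y} = {y\<in>T. a \<le> y} \<union> {y \<in> ?C. x \<le> y}"
      proof -
        have "a \<le> y \<or> y < a" if "y \<in> T" "x \<le> y" for y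
          using chain[of x y a] x that a by (auto simp: order.strict_implies_order less_le)
        then show ?thesis using x by (auto intro: order_trans)
      qed
      moreover have "{y\<in>T. a \<le> y} \<inter> {y \<in> ?C. x \<le> y} = {}" by auto
      ultimately show "v x = v a + (\<Sum>y\<in>{y\<in>?C. x \<le> y}. w y * j y)"
        using v[of x] v[of a] x a fin by (simp add: sum.union_disjoint)
    qed (use fin wnn jnn a in auto)
    moreover have "0 \<le> 2 / sqrt (v a + (\<Sum>x\<in>?C. w x * j x))"
      by (intro divide_nonneg_nonneg real_sqrt_ge_zero add_nonneg_nonneg sum_nonneg)
         (use a wnn jnn in auto)
    ultimately have 1: "sum q ?C \<le> 2 / sqrt (v a)" unfolding q_def by linarith
    have "w a * j a \<le> v a"
      unfolding v[OF a(1)]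
      by (rule member_le_sum) (use a fin wnn jnn in auto)
    then have "q a \<le> v a / (v a * sqrt (v a))"
      unfolding q_def using a by (intro divide_right_mono) auto
    also have "\<dots> = 1 / sqrt (v a)" using a by simp
    finally have 2: "q a \<le> 1 / sqrt (v a)" .
    have "{x\<in>T. b \<le> x \<and> x \<le> a} = insert a ?C" using a b by auto
    then have "sum q {x\<in>T. b \<le> x \<and> x \<le> a} = q a + sum q ?C"
      using fin by simp
    with 1 2 show ?thesis by (simp add: field_simps)
  qed
  have "(\<Sum>x\<in>{x\<in>T. x \<le> a}. w x * (j x)\<^sup>2 / (v x * sqrt (v x)))
      = (\<Sum>x\<in>{x\<in>T. x \<le> a}. \<Sum>o'\<in>O'. if e o' \<le> x then m o' * q x else 0)"
  proof (rule sum.cong[OF refl])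
    fix x assume x: "x \<in> {x\<in>T. x \<le> a}"
    have "w x * (j x)\<^sup>2 / (v x * sqrt (v x)) = j x * q x"
      by (simp add: q_def power2_eq_square)
    also have "\<dots> = (\<Sum>o'\<in>{o'\<in>O'. e o' \<le> x}. m o' * q x)"
      using x by (simp only: j[of x] mem_Collect_eq) (simp add: sum_distrib_right)
    finally show "w x * (j x)\<^sup>2 / (v x * sqrt (v x)) = (\<Sum>o'\<in>O'. if e o' \<le> x then m o' * q x else 0)"
      using fin by (simp add: sum.inter_filter)
  qed
  also have "\<dots> = (\<Sum>o'\<in>O'. \<Sum>x\<in>{x\<in>T. x \<le> a}. if e o' \<le> x then m o' * q x else 0)"
    by (rule sum.swap)
  also have "\<dots> = (\<Sum>o'\<in>O'. m o' * (\<Sum>x\<in>{x\<in>T. e o' \<le> x \<and> x \<le> a}. q x))"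
  proof (rule sum.cong[OF refl])
    fix o'
    have "{x \<in> {x\<in>T. x \<le> a}. e o' \<le> x} = {x\<in>T. e o' \<le> x \<and> x \<le> a}" by auto
    then show "(\<Sum>x\<in>{x\<in>T. x \<le> a}. if e o' \<le> x then m o' * q x else 0)
        = m o' * (\<Sum>x\<in>{x\<in>T. e o' \<le> x \<and> x \<le> a}. q x)"
      using fin sum.inter_filter[of "{x\<in>T. x \<le> a}" "\<lambda>x. m o' * q x" "\<lambda>x. e o' \<le> x"]
      by (simp add: sum_distrib_left)
  qed
  also have "\<dots> \<le> (\<Sum>o'\<in>O'. if e o' \<le> a then m o' * (3 / sqrt (v a)) else 0)"
  proof (rule sum_mono)
    fix o' assume o': "o' \<in> O'"
    show "m o' * (\<Sum>x\<in>{x\<in>T. e o' \<le> x \<and> x \<le> a}. q x)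
        \<le> (if e o' \<le> a then m o' * (3 / sqrt (v a)) else 0)"
    proof (cases "e o' \<le> a")
      case True
      then show ?thesis using key[OF e[OF o'] True] mnn[OF o'] by (simp add: mult_left_mono del: times_divide_eq_right)
    next
      case False
      then have "{x\<in>T. e o' \<le> x \<and> x \<le> a} = {}" by (auto dest: order_trans)
      then show ?thesis using False by (simp only: sum.empty) simp
    qed
  qed
  also have "\<dots> = 3 * j a / sqrt (v a)"
    using fin by (simp add: j[OF a(1)] sum.inter_filter[symmetric] sum_distrib_right[symmetric] mult.commute
      flip: sum_divide_distrib sum_distrib_left)
  finally show ?thesis .
qed

subsection \<open>Hardy operators on products of forests\<close>

text \<open>The order increases towards the root, since the nodes will be arcs ordered by inclusion:
  the ancestors of x are the elements above it. Rectangles become elements of the product with the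
  pointwise order.\<close>

locale multi_tree =
  fixes T :: "'d::finite \<Rightarrow> 'a::order set" and w :: "'d \<Rightarrow> 'a \<Rightarrow> real"
  assumes finite_T: "finite (T j)"
    and w_pos: "x \<in> T j \<Longrightarrow> 0 < w j x"
    and ancestors_chain:
      "x \<in> T j \<Longrightarrow> y \<in> T j \<Longrightarrow> z \<in> T j \<Longrightarrow> x \<le> y \<Longrightarrow> x \<le> z \<Longrightarrow> y \<le> z \<or> z \<le> y"
begin

definition P :: "('d \<Rightarrow> 'a) set"
  where "P = {\<alpha>. \<forall>j. \<alpha> j \<in> T j}"

definition W :: "('d \<Rightarrow> 'a) \<Rightarrow> real"
  where "W \<alpha> = (\<Prod>j\<in>UNIV. w j (\<alpha> j))"

definition W' :: "'d \<Rightarrow> ('d \<Rightarrow> 'a) \<Rightarrow> real"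
  where "W' i \<alpha> = (\<Prod>j\<in>UNIV - {i}. w j (\<alpha> j))"

definition Hardy :: "(('d \<Rightarrow> 'a) \<Rightarrow> real) \<Rightarrow> ('d \<Rightarrow> 'a) \<Rightarrow> real"
  where "Hardy g \<alpha> = (\<Sum>\<beta>\<in>{\<beta>\<in>P. \<alpha> \<le> \<beta>}. W \<beta> * g \<beta>)"

definition dual_Hardy :: "(('d \<Rightarrow> 'a) \<Rightarrow> real) \<Rightarrow> ('d \<Rightarrow> 'a) \<Rightarrow> real"
  where "dual_Hardy \<mu> \<alpha> = (\<Sum>\<beta>\<in>{\<beta>\<in>P. \<beta> \<le> \<alpha>}. \<mu> \<beta>)"

text \<open>The Hardy operator is split into coordinate i and the remaining ones because pairs of
  ancestors that are not nested run in opposite directions in one coordinate against all others.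
  Each such configuration gives a \<open>line_Hardy\<close> factor times a \<open>slab_Hardy\<close>
  factor.\<close>

definition line_Hardy :: "'d \<Rightarrow> (('d \<Rightarrow> 'a) \<Rightarrow> real) \<Rightarrow> ('d \<Rightarrow> 'a) \<Rightarrow> real"
  where "line_Hardy i g \<alpha> = (\<Sum>x\<in>{x\<in>T i. \<alpha> i \<le> x}. w i x * g (\<alpha>(i := x)))"

definition slab_Hardy :: "'d \<Rightarrow> (('d \<Rightarrow> 'a) \<Rightarrow> real) \<Rightarrow> ('d \<Rightarrow> 'a) \<Rightarrow> real"
  where "slab_Hardy i g \<alpha> = (\<Sum>\<beta>\<in>{\<beta>\<in>P. \<alpha> \<le> \<beta> \<and> \<beta> i = \<alpha> i}. W' i \<beta> * g \<beta>)"

lemma finite_P: "finite P"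
proof -
  have "P = PiE UNIV T" by (auto simp: P_def)
  then show ?thesis by (simp add: finite_PiE finite_T)
qed

lemma finite_P_filter [simp]: "finite {\<beta>\<in>P. Q \<beta>}"
  using finite_P by simp

lemma finite_T_filter [simp]: "finite {x\<in>T i. Q x}"
  using finite_T by simp

lemma W_pos: "\<alpha> \<in> P \<Longrightarrow> 0 < W \<alpha>"
  by (auto simp: W_def P_def intro!: prod_pos w_pos)

lemma W'_pos: "\<alpha> \<in> P \<Longrightarrow> 0 < W' i \<alpha>"
  by (auto simp: W'_def P_def intro!: prod_pos w_pos)

lemma w_nonneg: "x \<in> T j \<Longrightarrow> 0 \<le> w j x"
  by (simp add: w_pos less_imp_le)

lemma W_nonneg: "\<alpha> \<in> P \<Longrightarrow> 0 \<le> W \<alpha>"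
  by (simp add: W_pos less_imp_le)

lemma W'_nonneg: "\<alpha> \<in> P \<Longrightarrow> 0 \<le> W' i \<alpha>"
  by (simp add: W'_pos less_imp_le)

lemma W_split: "W \<alpha> = w i (\<alpha> i) * W' i \<alpha>"
  unfolding W_def W'_def by (rule prod.remove) auto

lemma W'_cong: "(\<And>j. j \<noteq> i \<Longrightarrow> \<alpha> j = \<beta> j) \<Longrightarrow> W' i \<alpha> = W' i \<beta>"
  unfolding W'_def by (rule prod.cong) auto

lemma W'_upd [simp]: "W' i (\<alpha>(i := x)) = W' i \<alpha>"
  by (rule W'_cong) auto

lemma W_upd: "W (\<alpha>(i := x)) = w i x * W' i \<alpha>"
  using W_split[of "\<alpha>(i := x)" i] by simp

lemma upd_in_P: "\<alpha> \<in> P \<Longrightarrow> x \<in> T i \<Longrightarrow> \<alpha>(i := x) \<in> P"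
  by (auto simp: P_def)

lemma P_in_T: "\<alpha> \<in> P \<Longrightarrow> \<alpha> j \<in> T j"
  by (auto simp: P_def)

lemma Hardy_nonneg: "(\<And>\<beta>. \<beta> \<in> P \<Longrightarrow> 0 \<le> g \<beta>) \<Longrightarrow> 0 \<le> Hardy g \<alpha>"
  unfolding Hardy_def by (intro sum_nonneg mult_nonneg_nonneg) (auto simp: W_pos less_imp_le)

lemma dual_Hardy_nonneg: "(\<And>\<beta>. \<beta> \<in> P \<Longrightarrow> 0 \<le> \<mu> \<beta>) \<Longrightarrow> 0 \<le> dual_Hardy \<mu> \<alpha>"
  unfolding dual_Hardy_def by (intro sum_nonneg) auto

lemma line_Hardy_nonneg:
  "(\<And>\<beta>. \<beta> \<in> P \<Longrightarrow> 0 \<le> g \<beta>) \<Longrightarrow> \<alpha> \<in> P \<Longrightarrow> 0 \<le> line_Hardy i g \<alpha>"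
  unfolding line_Hardy_def by (intro sum_nonneg mult_nonneg_nonneg) (auto simp: w_pos less_imp_le upd_in_P)

lemma slab_Hardy_nonneg: "(\<And>\<beta>. \<beta> \<in> P \<Longrightarrow> 0 \<le> g \<beta>) \<Longrightarrow> 0 \<le> slab_Hardy i g \<alpha>"
  unfolding slab_Hardy_def by (intro sum_nonneg mult_nonneg_nonneg) (auto simp: W'_pos less_imp_le)

lemma Hardy_antimono:
  assumes "\<And>\<beta>. \<beta> \<in> P \<Longrightarrow> 0 \<le> g \<beta>" "\<alpha> \<le> \<beta>"
  shows "Hardy g \<beta> \<le> Hardy g \<alpha>"
  unfolding Hardy_def
  by (rule sum_mono2) (use assms in \<open>auto intro: order_trans mult_nonneg_nonneg simp: W_pos less_imp_le\<close>)

lemma Hardy_mono: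
  assumes "\<And>\<beta>. \<beta> \<in> P \<Longrightarrow> \<alpha> \<le> \<beta> \<Longrightarrow> g \<beta> \<le> h \<beta>"
  shows "Hardy g \<alpha> \<le> Hardy h \<alpha>"
  unfolding Hardy_def
  by (rule sum_mono) (use assms in \<open>auto intro!: mult_left_mono simp: W_pos less_imp_le\<close>)

lemma Hardy_cmult: "Hardy (\<lambda>\<alpha>. c * g \<alpha>) \<omega> = c * Hardy g \<omega>"
  unfolding Hardy_def by (simp add: sum_distrib_left mult.left_commute)

lemma sum_Hardy_swap: "(\<Sum>\<omega>\<in>P. h \<omega> * Hardy g \<omega>) = (\<Sum>\<alpha>\<in>P. W \<alpha> * g \<alpha> * dual_Hardy h \<alpha>)"
proof -
  have "(\<Sum>\<omega>\<in>P. h \<omega> * Hardy g \<omega>) = (\<Sum>\<omega>\<in>P. \<Sum>\<alpha>\<in>P. if \<omega> \<le> \<alpha> then W \<alpha> * g \<alpha> * h \<omega> else 0)"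
    unfolding Hardy_def
    by (rule sum.cong) (auto simp: sum_distrib_left sum.inter_filter[OF finite_P] mult_ac intro!: sum.cong)
  also have "\<dots> = (\<Sum>\<alpha>\<in>P. \<Sum>\<omega>\<in>P. if \<omega> \<le> \<alpha> then W \<alpha> * g \<alpha> * h \<omega> else 0)"
    by (rule sum.swap)
  also have "\<dots> = (\<Sum>\<alpha>\<in>P. W \<alpha> * g \<alpha> * dual_Hardy h \<alpha>)"
    unfolding dual_Hardy_def
    by (rule sum.cong) (auto simp: sum_distrib_left sum.inter_filter[OF finite_P] mult_ac intro!: sum.cong)
  finally show ?thesis .
qed

lemma Hardy_eq_line_slab:
  assumes "\<gamma> \<in> P"
  shows "Hardy g \<gamma> = line_Hardy i (slab_Hardy i g) \<gamma>"
proof -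
  let ?A = "{x\<in>T i. \<gamma> i \<le> x}"
  let ?B = "\<lambda>x. {\<beta>\<in>P. \<gamma>(i := x) \<le> \<beta> \<and> \<beta> i = x}"
  have "line_Hardy i (slab_Hardy i g) \<gamma> = (\<Sum>x\<in>?A. \<Sum>\<beta>\<in>?B x. w i x * (W' i \<beta> * g \<beta>))"
    by (simp add: line_Hardy_def slab_Hardy_def sum_distrib_left)
  also have "\<dots> = (\<Sum>(x, \<beta>)\<in>Sigma ?A ?B. w i x * (W' i \<beta> * g \<beta>))"
    by (rule sum.Sigma) auto
  also have "\<dots> = Hardy g \<gamma>"
    unfolding Hardy_def
  proof (rule sum.reindex_bij_witness[where i = "\<lambda>\<beta>. (\<beta> i, \<beta>)" and j = snd])
    fix p assume "p \<in> Sigma ?A ?B"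
    then show "snd p \<in> {\<beta>\<in>P. \<gamma> \<le> \<beta>}"
      by (fastforce simp: le_fun_def split: if_splits)
  qed (auto simp: P_def le_fun_def W_split[of _ i])
  finally show ?thesis by simp
qed

lemma line_Hardy_square_le:
  assumes g: "\<And>\<beta>. \<beta> \<in> P \<Longrightarrow> 0 \<le> g \<beta>" and \<gamma>: "\<gamma> \<in> P"
  shows "(line_Hardy i g \<gamma>)\<^sup>2 \<le> 2 * line_Hardy i (\<lambda>\<alpha>. g \<alpha> * line_Hardy i g \<alpha>) \<gamma>"
proof -
  let ?C = "{x\<in>T i. \<gamma> i \<le> x}"
  have "(line_Hardy i g \<gamma>)\<^sup>2 \<le> 2 * (\<Sum>x\<in>?C. (w i x * g (\<gamma>(i := x))) * (\<Sum>y\<in>{y\<in>?C. x \<le> y}. w i y * g (\<gamma>(i := y))))"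
    unfolding line_Hardy_def
    by (rule chain_square_le)
       (use g \<gamma> ancestors_chain[of "\<gamma> i" i] in \<open>auto simp: upd_in_P w_nonneg P_in_T\<close>)
  also have "\<dots> = 2 * line_Hardy i (\<lambda>\<alpha>. g \<alpha> * line_Hardy i g \<alpha>) \<gamma>"
  proof -
    have "{y\<in>?C. x \<le> y} = {y\<in>T i. x \<le> y}" if "x \<in> ?C" for x
      using that by auto
    then show ?thesis by (simp add: line_Hardy_def mult.assoc)
  qed
  finally show ?thesis .
qed

text \<open>A pair of ancestors \<open>(\<alpha>, \<beta>)\<close> of \<open>\<omega>\<close> is either nested or, as there are at most three coordinates,
  ordered one way in a single coordinate \<open>i\<close> and the other way in all others. In the second case
  it is recorded at the node \<open>\<alpha>(i := \<beta> i)\<close>. In four coordinates a two-two split is possible.\<close>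

lemma Hardy_square_le:
  assumes card: "CARD('d) \<le> 3" and g: "\<And>\<beta>. \<beta> \<in> P \<Longrightarrow> 0 \<le> g \<beta>" and \<omega>: "\<omega> \<in> P"
  shows "(Hardy g \<omega>)\<^sup>2 \<le> 2 * Hardy (\<lambda>\<alpha>. g \<alpha> * Hardy g \<alpha>) \<omega>
    + 2 * (\<Sum>i\<in>UNIV. Hardy (\<lambda>\<gamma>. line_Hardy i g \<gamma> * slab_Hardy i g \<gamma>) \<omega>)"
proof -
  let ?U = "{\<beta>\<in>P. \<omega> \<le> \<beta>}"
  define F where "F \<alpha> \<beta> = W \<alpha> * g \<alpha> * (W \<beta> * g \<beta>)" for \<alpha> \<beta>
  define N where "N \<alpha> \<beta> = (if \<alpha> \<le> \<beta> then F \<alpha> \<beta> else 0)" for \<alpha> \<beta>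
  define X where "X i \<alpha> \<beta> = (if (\<forall>j. j \<noteq> i \<longrightarrow> \<alpha> j \<le> \<beta> j) \<and> \<beta> i \<le> \<alpha> i then F \<alpha> \<beta> else 0)" for i \<alpha> \<beta>
  have Fnn: "0 \<le> F \<alpha> \<beta>" if "\<alpha> \<in> P" "\<beta> \<in> P" for \<alpha> \<beta>
    unfolding F_def using that g W_nonneg by auto
  have Fsym: "F \<alpha> \<beta> = F \<beta> \<alpha>" for \<alpha> \<beta> by (simp add: F_def)
  have cover: "F \<alpha> \<beta> \<le> N \<alpha> \<beta> + N \<beta> \<alpha> + (\<Sum>i\<in>UNIV. X i \<alpha> \<beta> + X i \<beta> \<alpha>)"
    if ab: "\<alpha> \<in> ?U" "\<beta> \<in> ?U" for \<alpha> \<beta>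
  proof -
    have nn: "0 \<le> N \<alpha> \<beta>" "0 \<le> N \<beta> \<alpha>" "\<And>i. 0 \<le> X i \<alpha> \<beta>" "\<And>i. 0 \<le> X i \<beta> \<alpha>"
      using Fnn ab by (auto simp: N_def X_def)
    have tot: "\<alpha> j \<le> \<beta> j \<or> \<beta> j \<le> \<alpha> j" for j
      using ab ancestors_chain[of "\<omega> j" j] \<omega> by (auto simp: P_def le_fun_def)
    show ?thesis
    proof (cases "\<alpha> \<le> \<beta> \<or> \<beta> \<le> \<alpha>")
      case True
      moreover have "0 \<le> (\<Sum>i\<in>UNIV. X i \<alpha> \<beta> + X i \<beta> \<alpha>)"
        using nn by (intro sum_nonneg) auto
      ultimately show ?thesis using nn Fsym by (auto simp: N_def)
    next
      case False
      define A where "A = {j. \<not> \<alpha> j \<le> \<beta> j}"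
      define B where "B = {j. \<not> \<beta> j \<le> \<alpha> j}"
      have "A \<inter> B = {}" using tot by (auto simp: A_def B_def)
      then have "card A + card B \<le> 3"
        using card card_mono[of UNIV "A \<union> B"] by (simp add: card_Un_disjoint)
      moreover have "A \<noteq> {}" "B \<noteq> {}" using False by (auto simp: A_def B_def le_fun_def)
      then have "card A \<noteq> 0" "card B \<noteq> 0" by auto
      ultimately have "card A = 1 \<or> card B = 1" by linarith
      then obtain i where "A = {i} \<or> B = {i}" by (auto simp: card_1_singleton_iff)
      then have "X i \<alpha> \<beta> = F \<alpha> \<beta> \<or> X i \<beta> \<alpha> = F \<alpha> \<beta>"
      proof
        assume "A = {i}"
        then have "\<not> \<alpha> i \<le> \<beta> i" "\<And>j. j \<noteq> i \<Longrightarrow> \<alpha> j \<le> \<beta> j" by (auto simp: A_def)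
        with tot[of i] show ?thesis by (simp add: X_def)
      next
        assume "B = {i}"
        then have "\<not> \<beta> i \<le> \<alpha> i" "\<And>j. j \<noteq> i \<Longrightarrow> \<beta> j \<le> \<alpha> j" by (auto simp: B_def)
        with tot[of i] Fsym show ?thesis by (simp add: X_def)
      qed
      moreover have "X i \<alpha> \<beta> + X i \<beta> \<alpha> \<le> (\<Sum>i\<in>UNIV. X i \<alpha> \<beta> + X i \<beta> \<alpha>)"
        using nn by (intro member_le_sum) auto
      ultimately show ?thesis using nn by (smt (verit))
    qed
  qed
  have "(Hardy g \<omega>)\<^sup>2 = (\<Sum>\<alpha>\<in>?U. \<Sum>\<beta>\<in>?U. F \<alpha> \<beta>)"
    by (simp add: Hardy_def power2_eq_square sum_product F_def)
  also have "\<dots> \<le> (\<Sum>\<alpha>\<in>?U. \<Sum>\<beta>\<in>?U. N \<alpha> \<beta> + N \<beta> \<alpha> + (\<Sum>i\<in>UNIV. X i \<alpha> \<beta> + X i \<beta> \<alpha>))"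
    by (intro sum_mono cover)
  also have "\<dots> = (\<Sum>\<alpha>\<in>?U. \<Sum>\<beta>\<in>?U. N \<alpha> \<beta>) + (\<Sum>\<alpha>\<in>?U. \<Sum>\<beta>\<in>?U. N \<beta> \<alpha>)
      + ((\<Sum>i\<in>UNIV. \<Sum>\<alpha>\<in>?U. \<Sum>\<beta>\<in>?U. X i \<alpha> \<beta>) + (\<Sum>i\<in>UNIV. \<Sum>\<alpha>\<in>?U. \<Sum>\<beta>\<in>?U. X i \<beta> \<alpha>))"
  proof -
    have "(\<Sum>\<alpha>\<in>?U. \<Sum>\<beta>\<in>?U. \<Sum>i\<in>UNIV. Y i \<alpha> \<beta>) = (\<Sum>i\<in>UNIV. \<Sum>\<alpha>\<in>?U. \<Sum>\<beta>\<in>?U. Y i \<alpha> \<beta>)"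
      for Y :: "'d \<Rightarrow> ('d \<Rightarrow> 'a) \<Rightarrow> ('d \<Rightarrow> 'a) \<Rightarrow> real"
      by (subst sum.swap, subst (2) sum.swap, rule sum.swap[THEN trans])
         (simp add: sum.swap[of _ UNIV])
    then show ?thesis by (simp add: sum.distrib)
  qed
  also have "(\<Sum>\<alpha>\<in>?U. \<Sum>\<beta>\<in>?U. N \<beta> \<alpha>) = (\<Sum>\<alpha>\<in>?U. \<Sum>\<beta>\<in>?U. N \<alpha> \<beta>)"
    by (rule sum.swap)
  also have "(\<Sum>i\<in>UNIV. \<Sum>\<alpha>\<in>?U. \<Sum>\<beta>\<in>?U. X i \<beta> \<alpha>) = (\<Sum>i\<in>UNIV. \<Sum>\<alpha>\<in>?U. \<Sum>\<beta>\<in>?U. X i \<alpha> \<beta>)"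
    by (rule sum.cong[OF refl], rule sum.swap)
  also have "(\<Sum>\<alpha>\<in>?U. \<Sum>\<beta>\<in>?U. N \<alpha> \<beta>) = Hardy (\<lambda>\<alpha>. g \<alpha> * Hardy g \<alpha>) \<omega>"
  proof -
    have "(\<Sum>\<beta>\<in>?U. N \<alpha> \<beta>) = W \<alpha> * (g \<alpha> * Hardy g \<alpha>)" if "\<alpha> \<in> ?U" for \<alpha>
    proof -
      have "{\<beta>\<in>?U. \<alpha> \<le> \<beta>} = {\<beta>\<in>P. \<alpha> \<le> \<beta>}" using that by (auto intro: order_trans)
      then have "(\<Sum>\<beta>\<in>?U. N \<alpha> \<beta>) = (\<Sum>\<beta>\<in>{\<beta>\<in>P. \<alpha> \<le> \<beta>}. F \<alpha> \<beta>)"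
        unfolding N_def by (subst sum.inter_filter[symmetric]) auto
      then show ?thesis by (simp add: F_def Hardy_def sum_distrib_left mult.assoc)
    qed
    then show ?thesis by (simp add: Hardy_def[of "\<lambda>\<alpha>. g \<alpha> * Hardy g \<alpha>"])
  qed
  also have "(\<Sum>i\<in>UNIV. \<Sum>\<alpha>\<in>?U. \<Sum>\<beta>\<in>?U. X i \<alpha> \<beta>)
      = (\<Sum>i\<in>UNIV. Hardy (\<lambda>\<gamma>. line_Hardy i g \<gamma> * slab_Hardy i g \<gamma>) \<omega>)"
  proof (rule sum.cong[OF refl])
    fix i
    let ?R = "{(\<alpha>, \<beta>). \<alpha> \<in> ?U \<and> \<beta> \<in> ?U \<and> (\<forall>j. j \<noteq> i \<longrightarrow> \<alpha> j \<le> \<beta> j) \<and> \<beta> i \<le> \<alpha> i}"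
    let ?A = "\<lambda>\<gamma>. {x\<in>T i. \<gamma> i \<le> x}"
    let ?B = "\<lambda>\<gamma>. {\<beta>\<in>P. \<gamma> \<le> \<beta> \<and> \<beta> i = \<gamma> i}"
    have "(\<Sum>\<alpha>\<in>?U. \<Sum>\<beta>\<in>?U. X i \<alpha> \<beta>) = (\<Sum>(\<alpha>, \<beta>)\<in>?U \<times> ?U. X i \<alpha> \<beta>)"
      by (rule sum.cartesian_product)
    also have "\<dots> = (\<Sum>(\<alpha>, \<beta>)\<in>?R. F \<alpha> \<beta>)"
      by (rule sum.mono_neutral_cong_right) (auto simp: X_def split: if_splits)
    \<comment> \<open>Here \<gamma> is the coordinatewise minimum of the pair, x = \<alpha> i
      recovers \<alpha> from it, and \<beta> lies in the slab above \<gamma>. The weights match: W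
      \<alpha> * W \<beta> = W \<gamma> * w i x * W' i \<beta>.\<close>
    also have "\<dots> = (\<Sum>(\<gamma>, x, \<beta>)\<in>Sigma ?U (\<lambda>\<gamma>. ?A \<gamma> \<times> ?B \<gamma>).
        W \<gamma> * (w i x * g (\<gamma>(i := x)) * (W' i \<beta> * g \<beta>)))"
    proof (rule sum.reindex_bij_witness[where j = "\<lambda>(\<alpha>, \<beta>). (\<alpha>(i := \<beta> i), \<alpha> i, \<beta>)"
          and i = "\<lambda>(\<gamma>, x, \<beta>). (\<gamma>(i := x), \<beta>)"])
      fix p assume p: "p \<in> ?R"
      then show "(case p of (\<alpha>, \<beta>) \<Rightarrow> (\<alpha>(i := \<beta> i), \<alpha> i, \<beta>)) \<in> Sigma ?U (\<lambda>\<gamma>. ?A \<gamma> \<times> ?B \<gamma>)"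
        by (auto simp: P_def le_fun_def)
      obtain \<alpha> \<beta> where "p = (\<alpha>, \<beta>)" by fastforce
      then show "(case case p of (\<alpha>, \<beta>) \<Rightarrow> (\<alpha>(i := \<beta> i), \<alpha> i, \<beta>) of (\<gamma>, x, \<beta>) \<Rightarrow>
          W \<gamma> * (w i x * g (\<gamma>(i := x)) * (W' i \<beta> * g \<beta>))) = (case p of (\<alpha>, \<beta>) \<Rightarrow> F \<alpha> \<beta>)"
        by (simp add: F_def W_upd W_split[of _ i])
      show "(case case p of (\<alpha>, \<beta>) \<Rightarrow> (\<alpha>(i := \<beta> i), \<alpha> i, \<beta>) of (\<gamma>, x, \<beta>) \<Rightarrow> (\<gamma>(i := x), \<beta>)) = p"
        by (auto split: prod.splits)
    next
      fix p assume "p \<in> Sigma ?U (\<lambda>\<gamma>. ?A \<gamma> \<times> ?B \<gamma>)"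
      then obtain \<gamma> x \<beta> where p: "p = (\<gamma>, x, \<beta>)" "\<gamma> \<in> P" "\<omega> \<le> \<gamma>" "x \<in> T i" "\<gamma> i \<le> x" "\<beta> \<in> P" "\<gamma> \<le> \<beta>" "\<beta> i = \<gamma> i"
        by auto
      have "\<gamma>(i := \<beta> i) = \<gamma>" using p by auto
      then show "(case case p of (\<gamma>, x, \<beta>) \<Rightarrow> (\<gamma>(i := x), \<beta>) of (\<alpha>, \<beta>) \<Rightarrow> (\<alpha>(i := \<beta> i), \<alpha> i, \<beta>)) = p"
        using p(1) by simp
      show "(case p of (\<gamma>, x, \<beta>) \<Rightarrow> (\<gamma>(i := x), \<beta>)) \<in> ?R"
        using p by (auto simp: P_def le_fun_def intro: order_trans)
    qed
    also have "\<dots> = Hardy (\<lambda>\<gamma>. line_Hardy i g \<gamma> * slab_Hardy i g \<gamma>) \<omega>"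
    proof -
      have "(\<Sum>(x, \<beta>)\<in>?A \<gamma> \<times> ?B \<gamma>. W \<gamma> * (w i x * g (\<gamma>(i := x)) * (W' i \<beta> * g \<beta>)))
          = W \<gamma> * (line_Hardy i g \<gamma> * slab_Hardy i g \<gamma>)" for \<gamma>
        unfolding line_Hardy_def slab_Hardy_def sum_product
        by (simp add: sum.cartesian_product sum_distrib_left split_def)
      then show ?thesis
        unfolding Hardy_def by (subst sum.Sigma[symmetric]) (auto simp: split_def)
    qed
    finally show "(\<Sum>\<alpha>\<in>?U. \<Sum>\<beta>\<in>?U. X i \<alpha> \<beta>) = Hardy (\<lambda>\<gamma>. line_Hardy i g \<gamma> * slab_Hardy i g \<gamma>) \<omega>" .
  qed
  finally show ?thesis by simp
qed

end

section \<open>Energy estimate along one coordinate\<close>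

context multi_tree
begin

text \<open>Brings slab sums into the form used by \<open>forest_sum_le\<close>: as x moves in
  coordinate i, the sum is the total of point masses sitting at \<omega> i, and the size of each
  mass does not depend on x.\<close>

lemma slab_dual_Hardy_upd:
  assumes \<alpha>: "\<alpha> \<in> P" and x: "x \<in> T i"
  shows "slab_Hardy i (dual_Hardy \<sigma>) (\<alpha>(i := x))
    = (\<Sum>\<omega>\<in>{\<omega>\<in>P. \<omega> i \<le> x}. \<sigma> \<omega> *
        (\<Sum>\<beta>\<in>{\<beta>\<in>P. \<alpha> \<le> \<beta> \<and> \<beta> i = \<alpha> i \<and> (\<forall>j. j \<noteq> i \<longrightarrow> \<omega> j \<le> \<beta> j)}. W' i \<beta>))"
proof -
  let ?B = "{\<beta>\<in>P. \<alpha> \<le> \<beta> \<and> \<beta> i = \<alpha> i}"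
  have "slab_Hardy i (dual_Hardy \<sigma>) (\<alpha>(i := x)) = (\<Sum>\<beta>\<in>?B. W' i \<beta> * dual_Hardy \<sigma> (\<beta>(i := x)))"
    unfolding slab_Hardy_def
  proof (rule sum.reindex_bij_witness[where i = "\<lambda>\<beta>. \<beta>(i := x)" and j = "\<lambda>\<beta>. \<beta>(i := \<alpha> i)"])
    fix \<beta> assume \<beta>: "\<beta> \<in> {\<beta>\<in>P. \<alpha>(i := x) \<le> \<beta> \<and> \<beta> i = (\<alpha>(i := x)) i}"
    then show "\<beta>(i := \<alpha> i) \<in> ?B"
      using \<alpha> by (auto simp: le_fun_def upd_in_P P_in_T split: if_splits)
    show "(\<beta>(i := \<alpha> i))(i := x) = \<beta>" using \<beta> by auto
    show "W' i (\<beta>(i := \<alpha> i)) * dual_Hardy \<sigma> ((\<beta>(i := \<alpha> i))(i := x)) = W' i \<beta> * dual_Hardy \<sigma> \<beta>"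
      using \<beta> by (simp add: fun_upd_idem)
  next
    fix \<beta> assume \<beta>: "\<beta> \<in> ?B"
    then have "\<alpha> i = \<beta> i" by simp
    then show "(\<beta>(i := x))(i := \<alpha> i) = \<beta>" by simp
    show "\<beta>(i := x) \<in> {\<beta>\<in>P. \<alpha>(i := x) \<le> \<beta> \<and> \<beta> i = (\<alpha>(i := x)) i}"
      using \<beta> x by (auto simp: le_fun_def upd_in_P)
  qed
  also have "\<dots> = (\<Sum>\<beta>\<in>?B. \<Sum>\<omega>\<in>{\<omega>\<in>P. \<omega> i \<le> x}. if \<forall>j. j \<noteq> i \<longrightarrow> \<omega> j \<le> \<beta> j then \<sigma> \<omega> * W' i \<beta> else 0)"
  proof (rule sum.cong[OF refl])
    fix \<beta>
    have "{\<omega>\<in>P. \<omega> \<le> \<beta>(i := x)} = {\<omega> \<in> {\<omega>\<in>P. \<omega> i \<le> x}. \<forall>j. j \<noteq> i \<longrightarrow> \<omega> j \<le> \<beta> j}"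
      by (auto simp: le_fun_def split: if_splits)
    then show "W' i \<beta> * dual_Hardy \<sigma> (\<beta>(i := x))
        = (\<Sum>\<omega>\<in>{\<omega>\<in>P. \<omega> i \<le> x}. if \<forall>j. j \<noteq> i \<longrightarrow> \<omega> j \<le> \<beta> j then \<sigma> \<omega> * W' i \<beta> else 0)"
      unfolding dual_Hardy_def
      by (simp only: sum.inter_filter[OF finite_P_filter, symmetric] sum_distrib_left mult.commute)
  qed
  also have "\<dots> = (\<Sum>\<omega>\<in>{\<omega>\<in>P. \<omega> i \<le> x}. \<Sum>\<beta>\<in>?B. if \<forall>j. j \<noteq> i \<longrightarrow> \<omega> j \<le> \<beta> j then \<sigma> \<omega> * W' i \<beta> else 0)"
    by (rule sum.swap)
  also have "\<dots> = (\<Sum>\<omega>\<in>{\<omega>\<in>P. \<omega> i \<le> x}. \<sigma> \<omega> *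
        (\<Sum>\<beta>\<in>{\<beta>\<in>?B. \<forall>j. j \<noteq> i \<longrightarrow> \<omega> j \<le> \<beta> j}. W' i \<beta>))"
    by (simp only: sum.inter_filter[OF finite_P_filter, symmetric] sum_distrib_left)
  finally show ?thesis by (simp add: conj_assoc)
qed

text \<open>This is \<open>forest_sum_le\<close> on the line through \<alpha> in direction i. The
  potential restricted to this line is the one-tree potential of the slab sums by
  \<open>Hardy_eq_line_slab\<close>.\<close>

lemma slab_square_sum_le:
  assumes \<sigma>: "\<And>\<beta>. \<beta> \<in> P \<Longrightarrow> 0 \<le> \<sigma> \<beta>" and \<alpha>: "\<alpha> \<in> P"
    and \<phi>_def: "\<phi> = dual_Hardy \<sigma>" and pos: "0 < Hardy \<phi> \<alpha>"
  shows "(\<Sum>y\<in>{y\<in>T i. y \<le> \<alpha> i}. w i y * (slab_Hardy i \<phi> (\<alpha>(i := y)))\<^sup>2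
      / (Hardy \<phi> (\<alpha>(i := y)) * sqrt (Hardy \<phi> (\<alpha>(i := y)))))
    \<le> 3 * slab_Hardy i \<phi> \<alpha> / sqrt (Hardy \<phi> \<alpha>)"
proof -
  let ?m = "\<lambda>\<omega>. \<sigma> \<omega> * (\<Sum>\<beta>\<in>{\<beta>\<in>P. \<alpha> \<le> \<beta> \<and> \<beta> i = \<alpha> i \<and> (\<forall>j. j \<noteq> i \<longrightarrow> \<omega> j \<le> \<beta> j)}. W' i \<beta>)"
  have "(\<Sum>y\<in>{y\<in>T i. y \<le> \<alpha> i}. w i y * (slab_Hardy i \<phi> (\<alpha>(i := y)))\<^sup>2
      / (Hardy \<phi> (\<alpha>(i := y)) * sqrt (Hardy \<phi> (\<alpha>(i := y)))))
    \<le> 3 * slab_Hardy i \<phi> (\<alpha>(i := \<alpha> i)) / sqrt (Hardy \<phi> (\<alpha>(i := \<alpha> i)))"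
  proof (rule forest_sum_le[where O' = P and e = "\<lambda>\<omega>. \<omega> i" and m = ?m])
    show "0 \<le> ?m \<omega>" if "\<omega> \<in> P" for \<omega>
      using \<sigma>[OF that] by (intro mult_nonneg_nonneg sum_nonneg) (auto simp: W'_nonneg)
    show "slab_Hardy i \<phi> (\<alpha>(i := x)) = sum ?m {\<omega>\<in>P. \<omega> i \<le> x}" if "x \<in> T i" for x
      unfolding \<phi>_def by (rule slab_dual_Hardy_upd[OF \<alpha> that])
    show "Hardy \<phi> (\<alpha>(i := x)) = (\<Sum>y\<in>{y\<in>T i. x \<le> y}. w i y * slab_Hardy i \<phi> (\<alpha>(i := y)))"
      if "x \<in> T i" for x
      using Hardy_eq_line_slab[OF upd_in_P[OF \<alpha> that], of \<phi> i] by (simp add: line_Hardy_def)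
  qed (use finite_T finite_P w_nonneg \<alpha> pos ancestors_chain in \<open>auto simp: P_in_T fun_upd_idem\<close>)
  then show ?thesis by (simp add: fun_upd_idem)
qed

lemma sum_weighted_le_sqrt:
  fixes f g :: "('d \<Rightarrow> 'a) \<Rightarrow> real"
  shows "(\<Sum>\<alpha>\<in>P. W \<alpha> * (f \<alpha> * g \<alpha>)) \<le> sqrt (\<Sum>\<alpha>\<in>P. W \<alpha> * (f \<alpha>)\<^sup>2) * sqrt (\<Sum>\<alpha>\<in>P. W \<alpha> * (g \<alpha>)\<^sup>2)"
proof -
  have "(\<Sum>\<alpha>\<in>P. W \<alpha> * (f \<alpha> * g \<alpha>)) = (\<Sum>\<alpha>\<in>P. (sqrt (W \<alpha>) * f \<alpha>) * (sqrt (W \<alpha>) * g \<alpha>))"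
  proof (rule sum.cong[OF refl])
    fix \<alpha> assume "\<alpha> \<in> P"
    then have "W \<alpha> = sqrt (W \<alpha>) * sqrt (W \<alpha>)" by (simp add: W_nonneg)
    then show "W \<alpha> * (f \<alpha> * g \<alpha>) = (sqrt (W \<alpha>) * f \<alpha>) * (sqrt (W \<alpha>) * g \<alpha>)"
      by (metis mult.assoc mult.left_commute)
  qed
  also have "\<dots> \<le> sqrt (\<Sum>\<alpha>\<in>P. (sqrt (W \<alpha>) * f \<alpha>)\<^sup>2) * sqrt (\<Sum>\<alpha>\<in>P. (sqrt (W \<alpha>) * g \<alpha>)\<^sup>2)"
    by (rule sum_mult_le_sqrt)
  also have "\<dots> = sqrt (\<Sum>\<alpha>\<in>P. W \<alpha> * (f \<alpha>)\<^sup>2) * sqrt (\<Sum>\<alpha>\<in>P. W \<alpha> * (g \<alpha>)\<^sup>2)"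
    by (simp add: power_mult_distrib W_nonneg cong: sum.cong)
  finally show ?thesis .
qed

text \<open>The left-hand side is bounded by its own square root: expand one factor \<open>line_Hardy\<close>,
  sum over the descendants first, and apply the Cauchy-Schwarz inequality. The exponent \<open>3/2\<close> of the
  potential must exceed \<open>1\<close> for the sum over descendants, while the gain in
  \<open>low_potential_le\<close> below is lost at \<open>2\<close>.\<close>

lemma line_slab_energy_le:
  assumes \<sigma>: "\<And>\<beta>. \<beta> \<in> P \<Longrightarrow> 0 \<le> \<sigma> \<beta>"
    and \<phi>_def: "\<phi> = dual_Hardy \<sigma>" and V_def: "V = Hardy \<phi>"
    and Z_def: "Z = line_Hardy i (\<lambda>\<alpha>. \<phi> \<alpha> / sqrt (sqrt (V \<alpha>)))"
  shows "(\<Sum>\<gamma>\<in>P. W \<gamma> * ((slab_Hardy i \<phi> \<gamma>)\<^sup>2 * (Z \<gamma>)\<^sup>2 / (V \<gamma> * sqrt (V \<gamma>))))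
    \<le> 36 * (\<Sum>\<alpha>\<in>P. W \<alpha> * (\<phi> \<alpha>)\<^sup>2)" (is "?X \<le> 36 * ?E")
proof -
  let ?J = "slab_Hardy i \<phi>"
  define \<theta> where "\<theta> \<alpha> = \<phi> \<alpha> / sqrt (sqrt (V \<alpha>))" for \<alpha>
  define \<rho> where "\<rho> \<gamma> = (?J \<gamma>)\<^sup>2 / (V \<gamma> * sqrt (V \<gamma>))" for \<gamma>
  have \<phi>0: "0 \<le> \<phi> \<alpha>" for \<alpha> unfolding \<phi>_def using \<sigma> by (rule dual_Hardy_nonneg)
  have V0: "0 \<le> V \<alpha>" for \<alpha> unfolding V_def using \<phi>0 by (rule Hardy_nonneg)
  have \<theta>0: "0 \<le> \<theta> \<alpha>" for \<alpha> unfolding \<theta>_def using \<phi>0 V0 by simp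
  have \<rho>0: "0 \<le> \<rho> \<alpha>" for \<alpha> unfolding \<rho>_def using V0 by simp
  have Z_eq: "Z = line_Hardy i \<theta>" unfolding Z_def \<theta>_def ..
  have Z0: "0 \<le> Z \<alpha>" if "\<alpha> \<in> P" for \<alpha> unfolding Z_eq using \<theta>0 that by (intro line_Hardy_nonneg)
  have X0: "0 \<le> ?X" using V0 by (intro sum_nonneg mult_nonneg_nonneg divide_nonneg_nonneg) (auto simp: W_nonneg)
  have E0: "0 \<le> ?E" by (intro sum_nonneg) (auto simp: W_nonneg)
  have "?X = (\<Sum>\<gamma>\<in>P. W \<gamma> * \<rho> \<gamma> * (Z \<gamma>)\<^sup>2)"
    by (simp add: \<rho>_def mult.assoc)
  also have "\<dots> \<le> (\<Sum>\<gamma>\<in>P. W \<gamma> * \<rho> \<gamma> * (2 * line_Hardy i (\<lambda>\<alpha>. \<theta> \<alpha> * Z \<alpha>) \<gamma>))"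
    unfolding Z_eq
    by (intro sum_mono mult_left_mono line_Hardy_square_le mult_nonneg_nonneg) (auto simp: W_nonneg \<rho>0 \<theta>0)
  also have "\<dots> = 2 * (\<Sum>\<gamma>\<in>P. \<Sum>x\<in>{x\<in>T i. \<gamma> i \<le> x}. W \<gamma> * \<rho> \<gamma> * w i x * (\<theta> (\<gamma>(i := x)) * Z (\<gamma>(i := x))))"
    unfolding line_Hardy_def[of i "\<lambda>\<alpha>. \<theta> \<alpha> * Z \<alpha>"] by (simp add: sum_distrib_left mult_ac)
  also have "(\<Sum>\<gamma>\<in>P. \<Sum>x\<in>{x\<in>T i. \<gamma> i \<le> x}. W \<gamma> * \<rho> \<gamma> * w i x * (\<theta> (\<gamma>(i := x)) * Z (\<gamma>(i := x))))
     = (\<Sum>(\<gamma>, x)\<in>Sigma P (\<lambda>\<gamma>. {x\<in>T i. \<gamma> i \<le> x}). W \<gamma> * \<rho> \<gamma> * w i x * (\<theta> (\<gamma>(i := x)) * Z (\<gamma>(i := x))))"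
    by (rule sum.Sigma) (auto simp: finite_P)
  \<comment> \<open>The endpoints of a segment in direction i change roles: the sum is now organised
    by the upper end \<alpha> and runs over its descendants \<alpha>(i := y). Both ends share the
    factor W', so W \<gamma> * w i x = W \<alpha> * w i y.\<close>
  also have "\<dots> = (\<Sum>(\<alpha>, y)\<in>Sigma P (\<lambda>\<alpha>. {y\<in>T i. y \<le> \<alpha> i}). W \<alpha> * (\<theta> \<alpha> * Z \<alpha>) * (w i y * \<rho> (\<alpha>(i := y))))"
  proof (rule sum.reindex_bij_witness[where i = "\<lambda>(\<alpha>, y). (\<alpha>(i := y), \<alpha> i)" and j = "\<lambda>(\<gamma>, x). (\<gamma>(i := x), \<gamma> i)"])
    fix p assume "p \<in> Sigma P (\<lambda>\<gamma>. {x\<in>T i. \<gamma> i \<le> x})"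
    then obtain \<gamma> x where p: "p = (\<gamma>, x)" "\<gamma> \<in> P" "x \<in> T i" "\<gamma> i \<le> x" by auto
    show "(case case p of (\<gamma>, x) \<Rightarrow> (\<gamma>(i := x), \<gamma> i) of (\<alpha>, y) \<Rightarrow> W \<alpha> * (\<theta> \<alpha> * Z \<alpha>) * (w i y * \<rho> (\<alpha>(i := y))))
      = (case p of (\<gamma>, x) \<Rightarrow> W \<gamma> * \<rho> \<gamma> * w i x * (\<theta> (\<gamma>(i := x)) * Z (\<gamma>(i := x))))"
      by (simp add: p(1) W_upd W_split[of \<gamma> i] mult_ac)
  qed (auto simp: upd_in_P P_in_T)
  also have "\<dots> = (\<Sum>\<alpha>\<in>P. W \<alpha> * (\<theta> \<alpha> * Z \<alpha>) * (\<Sum>y\<in>{y\<in>T i. y \<le> \<alpha> i}. w i y * \<rho> (\<alpha>(i := y))))"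
    by (subst sum.Sigma[symmetric]) (auto simp: finite_P sum_distrib_left)
  also have "\<dots> \<le> (\<Sum>\<alpha>\<in>P. W \<alpha> * (3 * (\<phi> \<alpha> * (?J \<alpha> * Z \<alpha> / (sqrt (sqrt (V \<alpha>)) * sqrt (V \<alpha>))))))"
  proof (rule sum_mono)
    fix \<alpha> assume \<alpha>: "\<alpha> \<in> P"
    show "W \<alpha> * (\<theta> \<alpha> * Z \<alpha>) * (\<Sum>y\<in>{y\<in>T i. y \<le> \<alpha> i}. w i y * \<rho> (\<alpha>(i := y)))
      \<le> W \<alpha> * (3 * (\<phi> \<alpha> * (?J \<alpha> * Z \<alpha> / (sqrt (sqrt (V \<alpha>)) * sqrt (V \<alpha>)))))"
    proof (cases "V \<alpha> = 0")
      case True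
      \<comment> \<open>If the potential vanishes, \<theta> is a quotient by zero and therefore
        0.\<close>
      then show ?thesis by (simp add: \<theta>_def)
    next
      case False
      then have "0 < V \<alpha>" using V0[of \<alpha>] by linarith
      then have "(\<Sum>y\<in>{y\<in>T i. y \<le> \<alpha> i}. w i y * \<rho> (\<alpha>(i := y))) \<le> 3 * ?J \<alpha> / sqrt (V \<alpha>)"
        using slab_square_sum_le[OF \<sigma> \<alpha> \<phi>_def, of i] by (simp add: V_def \<rho>_def)
      then have "W \<alpha> * (\<theta> \<alpha> * Z \<alpha>) * (\<Sum>y\<in>{y\<in>T i. y \<le> \<alpha> i}. w i y * \<rho> (\<alpha>(i := y)))
        \<le> W \<alpha> * (\<theta> \<alpha> * Z \<alpha>) * (3 * ?J \<alpha> / sqrt (V \<alpha>))"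
        using \<alpha> \<theta>0 Z0 by (intro mult_left_mono) (auto simp: W_nonneg)
      then show ?thesis by (simp add: \<theta>_def mult_ac)
    qed
  qed
  also have "\<dots> = 3 * (\<Sum>\<alpha>\<in>P. W \<alpha> * (\<phi> \<alpha> * (?J \<alpha> * Z \<alpha> / (sqrt (sqrt (V \<alpha>)) * sqrt (V \<alpha>)))))"
    by (simp add: sum_distrib_left mult_ac)
  \<comment> \<open>The powers 1/4 from \<theta> and 1/2 from the sum over descendants add to 3/4,
    so the squared second factor has exactly the 3/2 of the left-hand side. Absorbing it turns the
    constant 2 * 3 into 36.\<close>
  also have "\<dots> \<le> 3 * (sqrt ?E * sqrt (\<Sum>\<alpha>\<in>P. W \<alpha> * (?J \<alpha> * Z \<alpha> / (sqrt (sqrt (V \<alpha>)) * sqrt (V \<alpha>)))\<^sup>2))"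
    by (intro mult_left_mono sum_weighted_le_sqrt) auto
  also have "(\<Sum>\<alpha>\<in>P. W \<alpha> * (?J \<alpha> * Z \<alpha> / (sqrt (sqrt (V \<alpha>)) * sqrt (V \<alpha>)))\<^sup>2) = ?X"
    by (simp add: power_divide power_mult_distrib V0 mult_ac)
  finally have "?X \<le> 6 * (sqrt ?E * sqrt ?X)" by simp
  from le_square_of_le_sqrt_mult[OF this X0 E0] show ?thesis by simp
qed

end

section \<open>Ancestors of low potential, and the box condition\<close>

context multi_tree
begin

lemma Hardy_cong: "(\<And>\<alpha>. \<alpha> \<in> P \<Longrightarrow> g \<alpha> = h \<alpha>) \<Longrightarrow> Hardy g \<omega> = Hardy h \<omega>"
  unfolding Hardy_def by (auto intro: sum.cong)

lemma term_le_Hardy: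
  assumes "\<And>\<beta>. \<beta> \<in> P \<Longrightarrow> 0 \<le> g \<beta>" "\<alpha> \<in> P"
  shows "W \<alpha> * g \<alpha> \<le> Hardy g \<alpha>"
  unfolding Hardy_def
  by (rule member_le_sum) (use assms in \<open>auto simp: W_nonneg\<close>)

text \<open>Let g be \<phi> restricted to the low ancestors. Squaring the Hardy sum of g, the nested
  pairs are too small to matter, so the crossing pairs dominate. There the threshold, which depends
  on \<omega>, is traded for powers of V; a single factor V \<omega> remains and cancels. The
  functions on the right-hand side no longer depend on \<omega>, so an embedding can be applied to
  them.\<close>

lemma low_potential_pointwise:
  assumes card: "CARD('d) \<le> 3" and \<phi>0: "\<And>\<beta>. \<beta> \<in> P \<Longrightarrow> 0 \<le> \<phi> \<beta>"
    and V_def: "V = Hardy \<phi>"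
    and k: "2 \<le> k" and \<omega>: "\<omega> \<in> P"
    and low: "V \<omega> / 4 < (\<Sum>\<alpha>\<in>{\<alpha>\<in>P. \<omega> \<le> \<alpha> \<and> k ^ 4 * V \<alpha> \<le> V \<omega>}. W \<alpha> * \<phi> \<alpha>)"
  shows "V \<omega> \<le> 64 / k * (\<Sum>i\<in>UNIV. Hardy (\<lambda>\<gamma>. slab_Hardy i \<phi> \<gamma> *
      line_Hardy i (\<lambda>\<alpha>. \<phi> \<alpha> / sqrt (sqrt (V \<alpha>))) \<gamma> / (sqrt (sqrt (V \<gamma>)) * sqrt (V \<gamma>))) \<omega>)"
    (is "_ \<le> _ * (\<Sum>i\<in>UNIV. Hardy (?\<psi> i) \<omega>)")
proof -
  define t where "t = V \<omega>"
  define g where "g \<alpha> = (if k ^ 4 * V \<alpha> \<le> t then \<phi> \<alpha> else 0)" for \<alpha>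
  have g0: "0 \<le> g \<beta>" and g\<phi>: "g \<beta> \<le> \<phi> \<beta>" if "\<beta> \<in> P" for \<beta>
    using \<phi>0[OF that] by (auto simp: g_def)
  have V0: "0 \<le> V \<alpha>" for \<alpha> unfolding V_def using \<phi>0 by (rule Hardy_nonneg)
  define G where "G = Hardy g \<omega>"
  have "G = (\<Sum>\<alpha>\<in>{\<alpha> \<in> {\<alpha>\<in>P. \<omega> \<le> \<alpha>}. k ^ 4 * V \<alpha> \<le> t}. W \<alpha> * \<phi> \<alpha>)"
    unfolding G_def Hardy_def g_def
    by (subst sum.inter_filter) (auto intro!: sum.cong)
  also have "{\<alpha> \<in> {\<alpha>\<in>P. \<omega> \<le> \<alpha>}. k ^ 4 * V \<alpha> \<le> t} = {\<alpha>\<in>P. \<omega> \<le> \<alpha> \<and> k ^ 4 * V \<alpha> \<le> V \<omega>}"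
    by (auto simp: t_def)
  finally have tG: "t < 4 * G" using low by (simp add: t_def)
  have t0: "0 \<le> t" using V0 by (simp add: t_def)
  have k4: "16 \<le> k ^ 4" using power_mono[OF k, of 4] by simp
  \<comment> \<open>On the support of g the inner sum is at most the potential, which is at most t /
    k^4. With t < 4 * G and k^4 >= 16 the nested pairs, taken twice, make up at most half of G^2 and
    can be absorbed.\<close>
  have "Hardy (\<lambda>\<alpha>. g \<alpha> * Hardy g \<alpha>) \<omega> \<le> Hardy (\<lambda>\<alpha>. t / k ^ 4 * g \<alpha>) \<omega>"
  proof (rule Hardy_mono)
    fix \<beta> assume \<beta>: "\<beta> \<in> P"
    show "g \<beta> * Hardy g \<beta> \<le> t / k ^ 4 * g \<beta>"
    proof (cases "k ^ 4 * V \<beta> \<le> t")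
      case True
      have "Hardy g \<beta> \<le> V \<beta>" unfolding V_def by (rule Hardy_mono) (rule g\<phi>)
      also have "\<dots> \<le> t / k ^ 4" using True k4 by (subst pos_le_divide_eq) (auto simp: mult.commute)
      finally show ?thesis by (subst mult.commute) (rule mult_right_mono[OF _ g0[OF \<beta>]])
    qed (simp add: g_def)
  qed
  also have "\<dots> = t / k ^ 4 * G" by (simp only: Hardy_cmult G_def)
  also have "\<dots> \<le> (4 * G) / 16 * G"
    using tG t0 k4 by (intro mult_right_mono frac_le) auto
  finally have 1: "Hardy (\<lambda>\<alpha>. g \<alpha> * Hardy g \<alpha>) \<omega> \<le> G\<^sup>2 / 4" by (simp add: power2_eq_square)
  have "G\<^sup>2 \<le> 2 * Hardy (\<lambda>\<alpha>. g \<alpha> * Hardy g \<alpha>) \<omega>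
    + 2 * (\<Sum>i\<in>UNIV. Hardy (\<lambda>\<gamma>. line_Hardy i g \<gamma> * slab_Hardy i g \<gamma>) \<omega>)"
    unfolding G_def by (rule Hardy_square_le[OF card g0 \<omega>])
  with 1 have 2: "G\<^sup>2 \<le> 4 * (\<Sum>i\<in>UNIV. Hardy (\<lambda>\<gamma>. line_Hardy i g \<gamma> * slab_Hardy i g \<gamma>) \<omega>)" by simp
  have "Hardy (\<lambda>\<gamma>. line_Hardy i g \<gamma> * slab_Hardy i g \<gamma>) \<omega> \<le> Hardy (\<lambda>\<gamma>. t / k * ?\<psi> i \<gamma>) \<omega>" for i
  proof (rule Hardy_mono)
    fix \<gamma> assume \<gamma>: "\<gamma> \<in> P" "\<omega> \<le> \<gamma>"
    have V\<gamma>: "V \<gamma> \<le> t" unfolding t_def V_def by (rule Hardy_antimono) (use \<phi>0 \<gamma> in auto)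
    \<comment> \<open>Write t as t^(1/4) times t^(3/4). The first factor is at least k *
      V(\<alpha>)^(1/4) because \<alpha> is low, the second at least V(\<gamma>)^(3/4) because
      \<gamma> lies above \<omega>. Hence \<phi> \<alpha> <= c * \<phi> \<alpha> /
      V(\<alpha>)^(1/4), and \<omega> survives only in the factor t of c.\<close>
    define c where "c = t / k / (sqrt (sqrt (V \<gamma>)) * sqrt (V \<gamma>))"
    have c0: "0 \<le> c" unfolding c_def using t0 k V0 by simp
    have "line_Hardy i g \<gamma> \<le> c * line_Hardy i (\<lambda>\<alpha>. \<phi> \<alpha> / sqrt (sqrt (V \<alpha>))) \<gamma>"
      unfolding line_Hardy_def sum_distrib_left
    proof (rule sum_mono)
      fix x assume x: "x \<in> {x\<in>T i. \<gamma> i \<le> x}"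
      let ?\<alpha> = "\<gamma>(i := x)"
      have \<alpha>: "?\<alpha> \<in> P" "\<gamma> \<le> ?\<alpha>" using x \<gamma> by (auto simp: upd_in_P le_fun_def)
      have "g ?\<alpha> \<le> c * (\<phi> ?\<alpha> / sqrt (sqrt (V ?\<alpha>)))"
      proof (cases "k ^ 4 * V ?\<alpha> \<le> t \<and> \<phi> ?\<alpha> \<noteq> 0")
        case False
        then show ?thesis using c0 \<phi>0[OF \<alpha>(1)] V0 by (auto simp: g_def)
      next
        case True
        \<comment> \<open>A node with positive \<phi> contributes to its own potential, so the
          divisors below are positive.\<close>
        then have "0 < \<phi> ?\<alpha>" using \<phi>0[OF \<alpha>(1)] by linarith
        then have "0 < W ?\<alpha> * \<phi> ?\<alpha>" using W_pos[OF \<alpha>(1)] by simp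
        also have "\<dots> \<le> V ?\<alpha>" unfolding V_def by (rule term_le_Hardy[OF \<phi>0 \<alpha>(1)])
        finally have Va: "0 < V ?\<alpha>" .
        have Vg: "V ?\<alpha> \<le> V \<gamma>" unfolding V_def by (rule Hardy_antimono) (use \<phi>0 \<alpha> in auto)
        define p qa qg where "p = sqrt (sqrt t)" and "qa = sqrt (sqrt (V ?\<alpha>))" and "qg = sqrt (sqrt (V \<gamma>))"
        have p2: "p\<^sup>2 = sqrt t" and qg2: "sqrt (V \<gamma>) = qg\<^sup>2"
          using t0 V0 by (simp_all add: p_def qg_def)
        then have p4: "p * (p * p\<^sup>2) = t"
          using t0 by (simp add: power2_eq_square flip: mult.assoc)
        have "sqrt (sqrt (k ^ 4 * V ?\<alpha>)) \<le> p"
          unfolding p_def using True by (intro real_sqrt_le_mono) auto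
        moreover have "sqrt (sqrt (k ^ 4 * V ?\<alpha>)) = k * qa"
        proof -
          have "sqrt (k ^ 4) = k\<^sup>2" by (rule real_sqrt_unique) simp_all
          moreover have "sqrt (k\<^sup>2) = k" using k by simp
          ultimately show ?thesis by (simp only: real_sqrt_mult qa_def)
        qed
        ultimately have kq: "k * qa \<le> p" by simp
        have q: "0 < qa" "0 < qg" "qg \<le> p"
          using Va Vg V\<gamma> by (auto simp: qa_def qg_def p_def)
        have "(k * qa) * (qg * qg\<^sup>2) \<le> p * (p * p\<^sup>2)"
          using kq q k by (intro mult_mono power_mono) auto
        also have "\<dots> = t" by (rule p4)
        finally have "1 \<le> t / (k * qa * (qg * qg\<^sup>2))"
          using q k by (simp add: field_simps)
        then have "\<phi> ?\<alpha> * 1 \<le> \<phi> ?\<alpha> * (t / (k * qa * (qg * qg\<^sup>2)))"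
          using \<open>0 < \<phi> ?\<alpha>\<close> by (intro mult_left_mono) auto
        also have "\<dots> = c * (\<phi> ?\<alpha> / qa)"
        proof -
          have "c = t / k / (qg * sqrt (V \<gamma>))" by (simp only: c_def qg_def)
          then show ?thesis using qg2 by (simp add: mult_ac)
        qed
        finally show ?thesis using True by (simp add: g_def qa_def)
      qed
      then have "w i x * g ?\<alpha> \<le> w i x * (c * (\<phi> ?\<alpha> / sqrt (sqrt (V ?\<alpha>))))"
        using x by (intro mult_left_mono) (auto simp: w_nonneg)
      then show "w i x * g ?\<alpha> \<le> c * (w i x * (\<phi> ?\<alpha> / sqrt (sqrt (V ?\<alpha>))))"
        by (simp only: mult.left_commute)
    qed
    moreover have "slab_Hardy i g \<gamma> \<le> slab_Hardy i \<phi> \<gamma>"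
      unfolding slab_Hardy_def
      by (intro sum_mono mult_left_mono) (auto simp: W'_nonneg g\<phi>)
    ultimately have "line_Hardy i g \<gamma> * slab_Hardy i g \<gamma>
      \<le> (c * line_Hardy i (\<lambda>\<alpha>. \<phi> \<alpha> / sqrt (sqrt (V \<alpha>))) \<gamma>) * slab_Hardy i \<phi> \<gamma>"
      using \<gamma> g0 \<phi>0 V0 c0
      by (intro mult_mono mult_nonneg_nonneg line_Hardy_nonneg slab_Hardy_nonneg) auto
    then show "line_Hardy i g \<gamma> * slab_Hardy i g \<gamma> \<le> t / k * ?\<psi> i \<gamma>"
      by (simp add: c_def mult_ac)
  qed
  then have "(\<Sum>i\<in>UNIV. Hardy (\<lambda>\<gamma>. line_Hardy i g \<gamma> * slab_Hardy i g \<gamma>) \<omega>)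
      \<le> t / k * (\<Sum>i\<in>UNIV. Hardy (?\<psi> i) \<omega>)"
    unfolding sum_distrib_left by (intro sum_mono) (simp only: Hardy_cmult)
  with 2 have 3: "G\<^sup>2 \<le> 4 * (t / k * (\<Sum>i\<in>UNIV. Hardy (?\<psi> i) \<omega>))"
    by linarith
  have \<psi>0: "0 \<le> ?\<psi> i \<gamma>" if "\<gamma> \<in> P" for i \<gamma>
  proof -
    have "0 \<le> line_Hardy i (\<lambda>\<alpha>. \<phi> \<alpha> / sqrt (sqrt (V \<alpha>))) \<gamma>"
      by (rule line_Hardy_nonneg[OF _ that]) (simp add: \<phi>0 V0)
    moreover have "0 \<le> slab_Hardy i \<phi> \<gamma>"
      by (rule slab_Hardy_nonneg) (rule \<phi>0)
    ultimately show ?thesis by (simp add: V0)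
  qed
  show ?thesis
  proof (cases "t = 0")
    case True
    have "0 \<le> 64 / k * (\<Sum>i\<in>UNIV. Hardy (?\<psi> i) \<omega>)"
      using k by (intro mult_nonneg_nonneg sum_nonneg Hardy_nonneg \<psi>0) auto
    then show ?thesis using True unfolding t_def by linarith
  next
    case False
    then have tp: "0 < t" using t0 by simp
    \<comment> \<open>The hypothesis \<open>low\<close> costs 16 and the absorption 4, which gives
      64; one factor t then cancels.\<close>
    have "t\<^sup>2 \<le> (4 * G)\<^sup>2" using tG tp by (intro power_mono) auto
    also have "\<dots> \<le> 16 * (4 * (t / k * (\<Sum>i\<in>UNIV. Hardy (?\<psi> i) \<omega>)))"
      using 3 by (simp add: power_mult_distrib)
    also have "\<dots> = t * (64 / k * (\<Sum>i\<in>UNIV. Hardy (?\<psi> i) \<omega>))"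
      by simp
    finally have "t * t \<le> t * (64 / k * (\<Sum>i\<in>UNIV. Hardy (?\<psi> i) \<omega>))"
      unfolding power2_eq_square .
    then show ?thesis using tp unfolding t_def by (rule mult_left_le_imp_le)
  qed
qed

text \<open>Where the low part is at most V \<omega> / 4 it goes into the first term. Elsewhere it
  is at most V \<omega>, which the pointwise bound controls by Hardy sums of fixed functions \<psi>.
  The embedding with constant N applies to these, and their energy is at most 36 times that of
  \<phi>. The gain is the factor 1 / k^2.\<close>

lemma low_potential_le:
  assumes card: "CARD('d) \<le> 3"
    and \<sigma>: "\<And>\<beta>. \<beta> \<in> P \<Longrightarrow> 0 \<le> \<sigma> \<beta>" and \<mu>: "\<And>\<beta>. \<beta> \<in> P \<Longrightarrow> 0 \<le> \<mu> \<beta>"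
    and \<phi>_def: "\<phi> = dual_Hardy \<sigma>" and V_def: "V = Hardy \<phi>" and k: "2 \<le> k"
    and emb: "\<And>g. (\<Sum>\<omega>\<in>P. \<mu> \<omega> * (Hardy g \<omega>)\<^sup>2) \<le> N * (\<Sum>\<alpha>\<in>P. W \<alpha> * (g \<alpha>)\<^sup>2)" and N: "0 \<le> N"
  shows "(\<Sum>\<omega>\<in>P. \<mu> \<omega> * (V \<omega> * (\<Sum>\<alpha>\<in>{\<alpha>\<in>P. \<omega> \<le> \<alpha> \<and> k ^ 4 * V \<alpha> \<le> V \<omega>}. W \<alpha> * \<phi> \<alpha>)))
    \<le> (\<Sum>\<omega>\<in>P. \<mu> \<omega> * (V \<omega>)\<^sup>2) / 4 + 1327104 / k\<^sup>2 * (N * (\<Sum>\<alpha>\<in>P. W \<alpha> * (\<phi> \<alpha>)\<^sup>2))"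
proof -
  define Z where "Z i = line_Hardy i (\<lambda>\<alpha>. \<phi> \<alpha> / sqrt (sqrt (V \<alpha>)))" for i
  define \<psi> where "\<psi> i \<gamma> = slab_Hardy i \<phi> \<gamma> * Z i \<gamma> / (sqrt (sqrt (V \<gamma>)) * sqrt (V \<gamma>))" for i \<gamma>
  define Lo where "Lo \<omega> = (\<Sum>\<alpha>\<in>{\<alpha>\<in>P. \<omega> \<le> \<alpha> \<and> k ^ 4 * V \<alpha> \<le> V \<omega>}. W \<alpha> * \<phi> \<alpha>)" for \<omega>
  let ?E = "\<Sum>\<alpha>\<in>P. W \<alpha> * (\<phi> \<alpha>)\<^sup>2"
  have \<phi>0: "0 \<le> \<phi> \<alpha>" for \<alpha> unfolding \<phi>_def using \<sigma> by (rule dual_Hardy_nonneg)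
  have V0: "0 \<le> V \<alpha>" for \<alpha> unfolding V_def using \<phi>0 by (rule Hardy_nonneg)
  have \<psi>E: "(\<Sum>\<gamma>\<in>P. W \<gamma> * (\<psi> i \<gamma>)\<^sup>2) \<le> 36 * ?E" for i
  proof -
    have "(\<psi> i \<gamma>)\<^sup>2 = (slab_Hardy i \<phi> \<gamma>)\<^sup>2 * (Z i \<gamma>)\<^sup>2 / (V \<gamma> * sqrt (V \<gamma>))" for \<gamma>
      unfolding \<psi>_def using V0 by (simp add: power_divide power_mult_distrib mult_ac)
    then show ?thesis
      using line_slab_energy_le[OF \<sigma> \<phi>_def V_def Z_def, of i] by simp
  qed
  have LoV: "Lo \<omega> \<le> V \<omega>" for \<omega>
    unfolding Lo_def V_def Hardy_def
    by (rule sum_mono2) (auto simp: W_nonneg \<phi>0)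
  have pt: "V \<omega> * Lo \<omega> \<le> (V \<omega>)\<^sup>2 / 4 + 4096 / k\<^sup>2 * (3 * (\<Sum>i\<in>UNIV. (Hardy (\<psi> i) \<omega>)\<^sup>2))"
    if \<omega>: "\<omega> \<in> P" for \<omega>
  proof (cases "V \<omega> / 4 < Lo \<omega>")
    case False
    then have "V \<omega> * Lo \<omega> \<le> V \<omega> * (V \<omega> / 4)" using V0 by (intro mult_left_mono) auto
    moreover have "0 \<le> 4096 / k\<^sup>2 * (3 * (\<Sum>i\<in>UNIV. (Hardy (\<psi> i) \<omega>)\<^sup>2))"
      by (intro mult_nonneg_nonneg sum_nonneg) auto
    ultimately show ?thesis unfolding power2_eq_square by linarith
  next
    case True
    have "V \<omega> \<le> 64 / k * (\<Sum>i\<in>UNIV. Hardy (\<psi> i) \<omega>)"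
      using low_potential_pointwise[OF card \<phi>0 V_def k \<omega>] True unfolding Lo_def \<psi>_def Z_def by simp
    then have "(V \<omega>)\<^sup>2 \<le> (64 / k * (\<Sum>i\<in>UNIV. Hardy (\<psi> i) \<omega>))\<^sup>2"
      using V0 by (intro power_mono) auto
    also have "\<dots> = 4096 / k\<^sup>2 * (\<Sum>i\<in>UNIV. Hardy (\<psi> i) \<omega>)\<^sup>2"
      by (simp add: power_mult_distrib power_divide)
    also have "\<dots> \<le> 4096 / k\<^sup>2 * (3 * (\<Sum>i\<in>UNIV. (Hardy (\<psi> i) \<omega>)\<^sup>2))"
    proof (rule mult_left_mono)
      have "(\<Sum>i\<in>UNIV. Hardy (\<psi> i) \<omega>)\<^sup>2 \<le> (\<Sum>i\<in>UNIV. (Hardy (\<psi> i) \<omega>)\<^sup>2) * real CARD('d)"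
        using sum_squared_le_sum_of_squares[of "\<lambda>i. Hardy (\<psi> i) \<omega>" UNIV] by simp
      also have "\<dots> \<le> (\<Sum>i\<in>UNIV. (Hardy (\<psi> i) \<omega>)\<^sup>2) * 3"
        using card by (intro mult_left_mono sum_nonneg) auto
      finally show "(\<Sum>i\<in>UNIV. Hardy (\<psi> i) \<omega>)\<^sup>2 \<le> 3 * (\<Sum>i\<in>UNIV. (Hardy (\<psi> i) \<omega>)\<^sup>2)" by simp
    qed simp
    finally have "(V \<omega>)\<^sup>2 \<le> 4096 / k\<^sup>2 * (3 * (\<Sum>i\<in>UNIV. (Hardy (\<psi> i) \<omega>)\<^sup>2))" .
    moreover have "V \<omega> * Lo \<omega> \<le> (V \<omega>)\<^sup>2"
      unfolding power2_eq_square using LoV V0 by (intro mult_left_mono) auto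
    moreover have "0 \<le> (V \<omega>)\<^sup>2 / 4" by simp
    ultimately show ?thesis by linarith
  qed
  have "(\<Sum>\<omega>\<in>P. \<mu> \<omega> * (\<Sum>i\<in>UNIV. (Hardy (\<psi> i) \<omega>)\<^sup>2)) = (\<Sum>i\<in>UNIV. \<Sum>\<omega>\<in>P. \<mu> \<omega> * (Hardy (\<psi> i) \<omega>)\<^sup>2)"
    unfolding sum_distrib_left by (rule sum.swap)
  also have "\<dots> \<le> (\<Sum>i\<in>(UNIV::'d set). N * (36 * ?E))"
    by (intro sum_mono order_trans[OF emb] mult_left_mono \<psi>E N)
  also have "\<dots> = real CARD('d) * (N * (36 * ?E))" by simp
  also have "\<dots> \<le> 3 * (N * (36 * ?E))"
    using card N by (intro mult_right_mono mult_nonneg_nonneg sum_nonneg) (auto simp: W_nonneg)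
  finally have \<psi>: "4096 / k\<^sup>2 * (3 * (\<Sum>\<omega>\<in>P. \<mu> \<omega> * (\<Sum>i\<in>UNIV. (Hardy (\<psi> i) \<omega>)\<^sup>2)))
      \<le> 4096 / k\<^sup>2 * (3 * (3 * (N * (36 * ?E))))"
    by (intro mult_left_mono) auto
  \<comment> \<open>The constant is 1327104 = 64^2 * 3 * 3 * 36: the pointwise bound squared,
    Cauchy-Schwarz over at most three coordinates, one embedding for each of them, and the energy of
    \<psi>.\<close>
  have "(\<Sum>\<omega>\<in>P. \<mu> \<omega> * (V \<omega> * Lo \<omega>))
    \<le> (\<Sum>\<omega>\<in>P. \<mu> \<omega> * ((V \<omega>)\<^sup>2 / 4 + 4096 / k\<^sup>2 * (3 * (\<Sum>i\<in>UNIV. (Hardy (\<psi> i) \<omega>)\<^sup>2))))"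
    using \<mu> pt by (intro sum_mono mult_left_mono)
  also have "\<dots> = (\<Sum>\<omega>\<in>P. \<mu> \<omega> * (V \<omega>)\<^sup>2) / 4
      + 4096 / k\<^sup>2 * (3 * (\<Sum>\<omega>\<in>P. \<mu> \<omega> * (\<Sum>i\<in>UNIV. (Hardy (\<psi> i) \<omega>)\<^sup>2)))"
  proof -
    have "(\<Sum>\<omega>\<in>P. \<mu> \<omega> * (c * h \<omega>)) = c * (\<Sum>\<omega>\<in>P. \<mu> \<omega> * h \<omega>)" for c and h :: "('d \<Rightarrow> 'a) \<Rightarrow> real"
      by (simp add: sum_distrib_left mult.left_commute)
    then show ?thesis
      by (simp only: distrib_left sum.distrib sum_divide_distrib times_divide_eq_right)
  qed
  finally show ?thesis using \<psi> unfolding Lo_def by simp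
qed

text \<open>Expanding the squared Hardy sum into pairs R, S leaves a sum over the common descendants
  of R and S. These are the descendants of one rectangle, so the one-box condition applies to each
  pair and the expansion is reversed.\<close>

lemma box_square_le:
  assumes \<phi>0: "\<And>\<beta>. \<beta> \<in> P \<Longrightarrow> 0 \<le> \<phi> \<beta>" and \<mu>: "\<And>\<beta>. \<beta> \<in> P \<Longrightarrow> 0 \<le> \<mu> \<beta>" and B: "0 \<le> B"
    and box: "\<And>Q. Q \<in> P \<Longrightarrow> (\<Sum>R\<in>{R\<in>P. R \<le> Q}. W R * (dual_Hardy \<mu> R)\<^sup>2) \<le> B * dual_Hardy \<mu> Q"
  shows "(\<Sum>\<alpha>\<in>P. W \<alpha> * (Hardy \<phi> \<alpha> * dual_Hardy \<mu> \<alpha>)\<^sup>2) \<le> B * (\<Sum>\<omega>\<in>P. \<mu> \<omega> * (Hardy \<phi> \<omega>)\<^sup>2)"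
proof -
  define f where "f \<alpha> = W \<alpha> * \<phi> \<alpha>" for \<alpha>
  have f0: "0 \<le> f \<alpha>" if "\<alpha> \<in> P" for \<alpha> using \<phi>0[OF that] W_nonneg[OF that] by (simp add: f_def)
  have expand: "(\<Sum>\<alpha>\<in>P. c \<alpha> * (Hardy \<phi> \<alpha>)\<^sup>2)
      = (\<Sum>R\<in>P. \<Sum>S\<in>P. f R * f S * (\<Sum>\<alpha>\<in>{\<alpha>\<in>P. \<alpha> \<le> R \<and> \<alpha> \<le> S}. c \<alpha>))" for c
  proof -
    have H: "Hardy \<phi> \<alpha> = (\<Sum>R\<in>P. if \<alpha> \<le> R then f R else 0)" for \<alpha>
      unfolding Hardy_def f_def by (rule sum.inter_filter[OF finite_P])
    have "(\<Sum>\<alpha>\<in>P. c \<alpha> * (Hardy \<phi> \<alpha>)\<^sup>2)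
        = (\<Sum>\<alpha>\<in>P. \<Sum>R\<in>P. \<Sum>S\<in>P. if \<alpha> \<le> R \<and> \<alpha> \<le> S then f R * f S * c \<alpha> else 0)"
      unfolding H power2_eq_square sum_product
      unfolding sum_distrib_left
      by (intro sum.cong refl) auto
    also have "\<dots> = (\<Sum>R\<in>P. \<Sum>\<alpha>\<in>P. \<Sum>S\<in>P. if \<alpha> \<le> R \<and> \<alpha> \<le> S then f R * f S * c \<alpha> else 0)"
      by (rule sum.swap)
    also have "\<dots> = (\<Sum>R\<in>P. \<Sum>S\<in>P. \<Sum>\<alpha>\<in>P. if \<alpha> \<le> R \<and> \<alpha> \<le> S then f R * f S * c \<alpha> else 0)"
      by (rule sum.cong[OF refl], rule sum.swap)
    finally show ?thesis
      by (simp add: sum.inter_filter[OF finite_P, symmetric] sum_distrib_left)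
  qed
  have "(\<Sum>\<alpha>\<in>P. W \<alpha> * (Hardy \<phi> \<alpha> * dual_Hardy \<mu> \<alpha>)\<^sup>2)
      = (\<Sum>\<alpha>\<in>P. (W \<alpha> * (dual_Hardy \<mu> \<alpha>)\<^sup>2) * (Hardy \<phi> \<alpha>)\<^sup>2)"
    by (simp add: power_mult_distrib mult_ac)
  also have "\<dots> = (\<Sum>R\<in>P. \<Sum>S\<in>P. f R * f S * (\<Sum>\<alpha>\<in>{\<alpha>\<in>P. \<alpha> \<le> R \<and> \<alpha> \<le> S}. W \<alpha> * (dual_Hardy \<mu> \<alpha>)\<^sup>2))"
    by (rule expand)
  also have "\<dots> \<le> (\<Sum>R\<in>P. \<Sum>S\<in>P. f R * f S * (B * (\<Sum>\<alpha>\<in>{\<alpha>\<in>P. \<alpha> \<le> R \<and> \<alpha> \<le> S}. \<mu> \<alpha>)))"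
  proof (intro sum_mono mult_left_mono mult_nonneg_nonneg f0)
    fix R S assume RS: "R \<in> P" "S \<in> P"
    show "(\<Sum>\<alpha>\<in>{\<alpha>\<in>P. \<alpha> \<le> R \<and> \<alpha> \<le> S}. W \<alpha> * (dual_Hardy \<mu> \<alpha>)\<^sup>2)
        \<le> B * (\<Sum>\<alpha>\<in>{\<alpha>\<in>P. \<alpha> \<le> R \<and> \<alpha> \<le> S}. \<mu> \<alpha>)"
    proof (cases "{\<alpha>\<in>P. \<alpha> \<le> R \<and> \<alpha> \<le> S} = {}")
      case True
      then show ?thesis by (simp only: sum.empty)
    next
      case False
      then obtain \<alpha> where \<alpha>: "\<alpha> \<in> P" "\<alpha> \<le> R" "\<alpha> \<le> S" by auto
      \<comment> \<open>The intersection of R and S: their sides are comparable in every coordinate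
        since both lie above \<alpha>. Without a common descendant both sums are empty.\<close>
      define Q where "Q j = (if R j \<le> S j then R j else S j)" for j
      have Q: "Q \<in> P" using RS by (auto simp: Q_def P_def)
      have tot: "R j \<le> S j \<or> S j \<le> R j" for j
        using ancestors_chain[of "\<alpha> j" j "R j" "S j"] \<alpha> RS by (auto simp: P_def le_fun_def)
      have "(\<beta> j \<le> R j \<and> \<beta> j \<le> S j) \<longleftrightarrow> \<beta> j \<le> Q j" for \<beta> j
        using tot[of j] by (auto simp: Q_def dest: order_trans)
      then have "(\<beta> \<le> R \<and> \<beta> \<le> S) \<longleftrightarrow> \<beta> \<le> Q" for \<beta>
        unfolding le_fun_def by auto
      then show ?thesis using box[OF Q] by (simp add: dual_Hardy_def[of \<mu> Q])
    qed
  qed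
  also have "\<dots> = B * (\<Sum>R\<in>P. \<Sum>S\<in>P. f R * f S * (\<Sum>\<alpha>\<in>{\<alpha>\<in>P. \<alpha> \<le> R \<and> \<alpha> \<le> S}. \<mu> \<alpha>))"
    by (simp add: sum_distrib_left mult_ac)
  also have "\<dots> = B * (\<Sum>\<omega>\<in>P. \<mu> \<omega> * (Hardy \<phi> \<omega>)\<^sup>2)"
    by (simp only: expand)
  finally show ?thesis .
qed

end

section \<open>The extremal function and the embedding on products of forests\<close>

context multi_tree
begin

lemma Hardy_abs_le: "\<bar>Hardy g \<omega>\<bar> \<le> Hardy (\<lambda>\<alpha>. \<bar>g \<alpha>\<bar>) \<omega>"
proof -
  have "\<bar>Hardy g \<omega>\<bar> \<le> (\<Sum>\<beta>\<in>{\<beta>\<in>P. \<omega> \<le> \<beta>}. \<bar>W \<beta> * g \<beta>\<bar>)"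
    unfolding Hardy_def by (rule sum_abs)
  also have "\<dots> = Hardy (\<lambda>\<alpha>. \<bar>g \<alpha>\<bar>) \<omega>"
    unfolding Hardy_def by (rule sum.cong) (auto simp: abs_mult W_nonneg)
  finally show ?thesis .
qed

text \<open>Compactness of the unit sphere of a finite-dimensional space. Replacing a maximiser by
  its absolute value keeps the norm and can only increase the form, which makes it
  nonnegative.\<close>

lemma extremal_exists:
  assumes "P \<noteq> {}" and \<mu>: "\<And>\<beta>. \<beta> \<in> P \<Longrightarrow> 0 \<le> \<mu> \<beta>"
  obtains \<phi> N where "\<And>\<alpha>. \<alpha> \<in> P \<Longrightarrow> 0 \<le> \<phi> \<alpha>" "(\<Sum>\<alpha>\<in>P. W \<alpha> * (\<phi> \<alpha>)\<^sup>2) = 1"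
    "(\<Sum>\<omega>\<in>P. \<mu> \<omega> * (Hardy \<phi> \<omega>)\<^sup>2) = N"
    "\<And>g. (\<Sum>\<omega>\<in>P. \<mu> \<omega> * (Hardy g \<omega>)\<^sup>2) \<le> N * (\<Sum>\<alpha>\<in>P. W \<alpha> * (g \<alpha>)\<^sup>2)"
proof -
  define F where "F g = (\<Sum>\<omega>\<in>P. \<mu> \<omega> * (Hardy g \<omega>)\<^sup>2)" for g
  define E where "E g = (\<Sum>\<alpha>\<in>P. W \<alpha> * (g \<alpha>)\<^sup>2)" for g
  \<comment> \<open>The index type may be infinite, so functions are forced to vanish off P. On P
    the unit norm bounds them by 1 / sqrt (W \<alpha>), and the resulting product of intervals is
    compact.\<close>
  define b where "b \<alpha> = (if \<alpha> \<in> P then 1 / sqrt (W \<alpha>) else 0)" for \<alpha>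
  define K where "K = PiE UNIV (\<lambda>\<alpha>. {- b \<alpha>..b \<alpha>}) \<inter> {g. E g = 1}"
  have contW: "continuous_on UNIV (\<lambda>g::('d \<Rightarrow> 'a) \<Rightarrow> real. g \<alpha>)" for \<alpha>
    by (rule continuous_on_product_coordinates)
  have contE: "continuous_on UNIV E"
    unfolding E_def by (intro continuous_intros contW)
  have contF: "continuous_on UNIV F"
    unfolding F_def Hardy_def by (intro continuous_intros contW)
  have "compactin (product_topology (\<lambda>_. euclidean) UNIV) (PiE UNIV (\<lambda>\<alpha>. {- b \<alpha>..b \<alpha>}))"
    by (simp add: compactin_PiE)
  then have "compact (PiE UNIV (\<lambda>\<alpha>. {- b \<alpha>..b \<alpha>}))"
    by (simp add: euclidean_product_topology)
  moreover have "closed {g. E g = 1}"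
    using contE by (intro closed_Collect_eq) auto
  ultimately have "compact K" unfolding K_def by (rule compact_Int_closed)
  have in_K: "(\<lambda>\<alpha>. if \<alpha> \<in> P then g \<alpha> else 0) \<in> K" if "E g = 1" for g
  proof -
    have "\<bar>g \<alpha>\<bar> \<le> 1 / sqrt (W \<alpha>)" if "\<alpha> \<in> P" for \<alpha>
    proof -
      have "W \<alpha> * (g \<alpha>)\<^sup>2 \<le> E g" unfolding E_def
        using that finite_P by (intro member_le_sum) (auto simp: W_nonneg)
      then have "(g \<alpha>)\<^sup>2 \<le> 1 / W \<alpha>" using \<open>E g = 1\<close> W_pos[OF that] by (simp add: field_simps)
      then have "sqrt ((g \<alpha>)\<^sup>2) \<le> sqrt (1 / W \<alpha>)" by (rule real_sqrt_le_mono)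
      then show ?thesis by (simp add: real_sqrt_divide)
    qed
    then have "(\<lambda>\<alpha>. if \<alpha> \<in> P then g \<alpha> else 0) \<in> PiE UNIV (\<lambda>\<alpha>. {- b \<alpha>..b \<alpha>})"
      by (force simp: b_def abs_le_iff)
    moreover have "E (\<lambda>\<alpha>. if \<alpha> \<in> P then g \<alpha> else 0) = E g"
      unfolding E_def by (rule sum.cong) auto
    ultimately show ?thesis using that by (simp add: K_def)
  qed
  have scale: "E (\<lambda>\<alpha>. c * g \<alpha>) = c\<^sup>2 * E g" "F (\<lambda>\<alpha>. c * g \<alpha>) = c\<^sup>2 * F g" for c g
    by (simp_all add: E_def F_def Hardy_cmult power_mult_distrib sum_distrib_left mult.left_commute)
  have normalise: "E (\<lambda>\<alpha>. (1 / sqrt (E g)) * g \<alpha>) = 1" if "0 < E g" for g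
    using that by (simp only: scale) (simp add: power_divide)
  have E0: "0 \<le> E g" for g unfolding E_def by (intro sum_nonneg) (auto simp: W_nonneg)
  have "0 < E (\<lambda>_. 1)" unfolding E_def using assms(1) finite_P W_pos by (simp add: sum_pos)
  from in_K[OF normalise[OF this]] have "K \<noteq> {}" by blast
  from continuous_attains_sup[OF \<open>compact K\<close> this continuous_on_subset[OF contF]]
  obtain g0 where g0: "g0 \<in> K" "\<And>g. g \<in> K \<Longrightarrow> F g \<le> F g0" by auto
  define \<phi> where "\<phi> \<alpha> = \<bar>g0 \<alpha>\<bar>" for \<alpha>
  have E\<phi>: "E \<phi> = 1" using g0(1) by (simp add: K_def E_def \<phi>_def)
  have F\<phi>: "F g0 \<le> F \<phi>" unfolding F_def
  proof (intro sum_mono mult_left_mono \<mu>)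
    fix \<omega>
    have "\<bar>Hardy g0 \<omega>\<bar> \<le> Hardy \<phi> \<omega>" using Hardy_abs_le unfolding \<phi>_def .
    then show "(Hardy g0 \<omega>)\<^sup>2 \<le> (Hardy \<phi> \<omega>)\<^sup>2" by (rule power2_le_iff_abs_le[THEN iffD2, rotated]) (auto intro: Hardy_nonneg simp: \<phi>_def)
  qed
  have bound: "F g \<le> F \<phi>" if "E g = 1" for g
  proof -
    have "F g = F (\<lambda>\<alpha>. if \<alpha> \<in> P then g \<alpha> else 0)"
      unfolding F_def by (intro sum.cong refl arg_cong2[where f = "(*)"] arg_cong[where f = "\<lambda>x. x\<^sup>2"] Hardy_cong) auto
    also have "\<dots> \<le> F g0" by (intro g0(2) in_K that)
    finally show ?thesis using F\<phi> by simp
  qed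
  have "F g \<le> F \<phi> * E g" for g
  proof (cases "E g = 0")
    case True
    then have "\<And>\<alpha>. \<alpha> \<in> P \<Longrightarrow> W \<alpha> * (g \<alpha>)\<^sup>2 = 0"
      unfolding E_def using finite_P by (subst (asm) sum_nonneg_eq_0_iff) (auto simp: W_nonneg)
    then have "g \<alpha> = 0" if "\<alpha> \<in> P" for \<alpha> using W_pos[OF that] that by fastforce
    then have "F g = 0" by (simp add: F_def Hardy_def)
    then show ?thesis using True by simp
  next
    case False
    then have Ep: "0 < E g" using E0[of g] by linarith
    have "(1 / sqrt (E g))\<^sup>2 * F g \<le> F \<phi>"
      using bound[OF normalise[OF Ep]] by (simp only: scale)
    then show ?thesis using Ep by (simp add: power_divide field_simps)
  qed
  then show thesis
    using that[of \<phi> "F \<phi>"] E\<phi> by (simp add: \<phi>_def E_def F_def)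
qed

text \<open>The Euler-Lagrange equation, obtained without differentiating. The dual transform \<psi>
  has inner product 1 with \<phi>, and its norm is at most 1 by duality with the embedding; hence
  the squared norm of \<psi> - \<phi> is at most 1 + 1 - 2 = 0.\<close>

lemma extremal_equation:
  assumes \<mu>: "\<And>\<beta>. \<beta> \<in> P \<Longrightarrow> 0 \<le> \<mu> \<beta>" and N: "0 < N"
    and E: "(\<Sum>\<alpha>\<in>P. W \<alpha> * (\<phi> \<alpha>)\<^sup>2) = 1"
    and F: "(\<Sum>\<omega>\<in>P. \<mu> \<omega> * (Hardy \<phi> \<omega>)\<^sup>2) = N"
    and emb: "\<And>g. (\<Sum>\<omega>\<in>P. \<mu> \<omega> * (Hardy g \<omega>)\<^sup>2) \<le> N * (\<Sum>\<alpha>\<in>P. W \<alpha> * (g \<alpha>)\<^sup>2)"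
    and \<alpha>: "\<alpha> \<in> P"
  shows "dual_Hardy (\<lambda>\<omega>. \<mu> \<omega> * Hardy \<phi> \<omega> / N) \<alpha> = \<phi> \<alpha>"
proof -
  define h where "h \<omega> = \<mu> \<omega> * Hardy \<phi> \<omega> / N" for \<omega>
  define \<psi> where "\<psi> = dual_Hardy h"
  have inner: "(\<Sum>\<alpha>\<in>P. W \<alpha> * g \<alpha> * \<psi> \<alpha>) = (\<Sum>\<omega>\<in>P. h \<omega> * Hardy g \<omega>)" for g
    unfolding \<psi>_def by (rule sum_Hardy_swap[symmetric])
  have \<phi>\<psi>: "(\<Sum>\<alpha>\<in>P. W \<alpha> * \<phi> \<alpha> * \<psi> \<alpha>) = 1"
  proof -
    have "(\<Sum>\<omega>\<in>P. h \<omega> * Hardy \<phi> \<omega>) = (\<Sum>\<omega>\<in>P. \<mu> \<omega> * (Hardy \<phi> \<omega>)\<^sup>2) / N"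
      by (simp add: h_def power2_eq_square sum_divide_distrib mult.assoc)
    then show ?thesis using F N by (simp add: inner)
  qed
  have "(\<Sum>\<alpha>\<in>P. W \<alpha> * (\<psi> \<alpha>)\<^sup>2) \<le> 1"
  proof -
    let ?x = "\<Sum>\<alpha>\<in>P. W \<alpha> * (\<psi> \<alpha>)\<^sup>2"
    have x0: "0 \<le> ?x" by (intro sum_nonneg) (auto simp: W_nonneg)
    have "?x = (\<Sum>\<alpha>\<in>P. W \<alpha> * \<psi> \<alpha> * \<psi> \<alpha>)"
      by (simp add: power2_eq_square mult.assoc)
    also have "\<dots> = (\<Sum>\<omega>\<in>P. h \<omega> * Hardy \<psi> \<omega>)" by (rule inner)
    also have "\<dots> = (\<Sum>\<omega>\<in>P. (sqrt (\<mu> \<omega>) * Hardy \<phi> \<omega> / N) * (sqrt (\<mu> \<omega>) * Hardy \<psi> \<omega>))"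
    proof (rule sum.cong[OF refl])
      fix \<omega> assume "\<omega> \<in> P"
      then have "sqrt (\<mu> \<omega>) * sqrt (\<mu> \<omega>) = \<mu> \<omega>" using \<mu> by simp
      moreover have "(sqrt (\<mu> \<omega>) * Hardy \<phi> \<omega> / N) * (sqrt (\<mu> \<omega>) * Hardy \<psi> \<omega>)
          = (sqrt (\<mu> \<omega>) * sqrt (\<mu> \<omega>)) * Hardy \<phi> \<omega> / N * Hardy \<psi> \<omega>"
        by (simp only: times_divide_eq_left times_divide_eq_right mult_ac)
      ultimately show "h \<omega> * Hardy \<psi> \<omega> = (sqrt (\<mu> \<omega>) * Hardy \<phi> \<omega> / N) * (sqrt (\<mu> \<omega>) * Hardy \<psi> \<omega>)"
        by (simp add: h_def)
    qed
    also have "\<dots> \<le> sqrt (\<Sum>\<omega>\<in>P. (sqrt (\<mu> \<omega>) * Hardy \<phi> \<omega> / N)\<^sup>2) * sqrt (\<Sum>\<omega>\<in>P. (sqrt (\<mu> \<omega>) * Hardy \<psi> \<omega>)\<^sup>2)"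
      by (rule sum_mult_le_sqrt)
    also have "(\<Sum>\<omega>\<in>P. (sqrt (\<mu> \<omega>) * Hardy \<phi> \<omega> / N)\<^sup>2) = 1 / N"
    proof -
      have "(\<Sum>\<omega>\<in>P. (sqrt (\<mu> \<omega>) * Hardy \<phi> \<omega> / N)\<^sup>2) = (\<Sum>\<omega>\<in>P. \<mu> \<omega> * (Hardy \<phi> \<omega>)\<^sup>2) / N\<^sup>2"
        by (simp add: power_divide power_mult_distrib \<mu> sum_divide_distrib cong: sum.cong)
      then show ?thesis using F N by (simp add: power2_eq_square)
    qed
    also have "(\<Sum>\<omega>\<in>P. (sqrt (\<mu> \<omega>) * Hardy \<psi> \<omega>)\<^sup>2) = (\<Sum>\<omega>\<in>P. \<mu> \<omega> * (Hardy \<psi> \<omega>)\<^sup>2)"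
      by (simp add: power_mult_distrib \<mu> cong: sum.cong)
    also have "sqrt (1 / N) * sqrt (\<Sum>\<omega>\<in>P. \<mu> \<omega> * (Hardy \<psi> \<omega>)\<^sup>2) \<le> sqrt (1 / N) * sqrt (N * ?x)"
      using N by (intro mult_left_mono real_sqrt_le_mono emb) auto
    also have "\<dots> = 1 * (sqrt 1 * sqrt ?x)"
      using N by (simp add: real_sqrt_mult real_sqrt_divide)
    finally show ?thesis using le_square_of_le_sqrt_mult[of ?x 1 1] x0 by simp
  qed
  moreover have "(\<Sum>\<alpha>\<in>P. W \<alpha> * (\<psi> \<alpha> - \<phi> \<alpha>)\<^sup>2)
      = (\<Sum>\<alpha>\<in>P. W \<alpha> * (\<psi> \<alpha>)\<^sup>2) + (\<Sum>\<alpha>\<in>P. W \<alpha> * (\<phi> \<alpha>)\<^sup>2) - 2 * (\<Sum>\<alpha>\<in>P. W \<alpha> * \<phi> \<alpha> * \<psi> \<alpha>)"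
    by (simp add: power2_diff distrib_left right_diff_distrib sum.distrib sum_subtractf sum_distrib_left mult_ac)
  ultimately have "(\<Sum>\<alpha>\<in>P. W \<alpha> * (\<psi> \<alpha> - \<phi> \<alpha>)\<^sup>2) \<le> 0"
    using E \<phi>\<psi> by simp
  moreover have "W \<alpha> * (\<psi> \<alpha> - \<phi> \<alpha>)\<^sup>2 \<le> (\<Sum>\<alpha>\<in>P. W \<alpha> * (\<psi> \<alpha> - \<phi> \<alpha>)\<^sup>2)"
    using \<alpha> finite_P by (intro member_le_sum) (auto simp: W_nonneg)
  ultimately have "W \<alpha> * (\<psi> \<alpha> - \<phi> \<alpha>)\<^sup>2 \<le> 0" by linarith
  then have "\<psi> \<alpha> = \<phi> \<alpha>" using W_pos[OF \<alpha>] by (simp add: mult_le_0_iff)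
  then show ?thesis by (simp add: \<psi>_def h_def[abs_def])
qed

text \<open>Here \<open>N\<close> is the best constant, \<open>\<phi>\<close> an extremal function and \<open>V\<close> its potential. Since
  \<open>\<phi>\<close> is the dual Hardy transform of \<open>\<mu> * V / N\<close>, its norm splits into the contribution of the pairs
  \<open>\<omega> \<le> \<alpha>\<close> with \<open>K * V \<alpha> \<le> V \<omega>\<close>, which is at most half of the total, and that of the other
  pairs, to which the box condition applies.\<close>

theorem box_imp_Hardy_embedding:
  assumes card: "CARD('d) \<le> 3" and \<mu>: "\<And>\<beta>. \<beta> \<in> P \<Longrightarrow> 0 \<le> \<mu> \<beta>" and B: "0 \<le> B"
    and box: "\<And>Q. Q \<in> P \<Longrightarrow> (\<Sum>R\<in>{R\<in>P. R \<le> Q}. W R * (dual_Hardy \<mu> R)\<^sup>2) \<le> B * dual_Hardy \<mu> Q"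
  shows "(\<Sum>\<omega>\<in>P. \<mu> \<omega> * (Hardy g \<omega>)\<^sup>2) \<le> (4 * 2304 ^ 8 * B) * (\<Sum>\<alpha>\<in>P. W \<alpha> * (g \<alpha>)\<^sup>2)"
proof (cases "P = {}")
  case True
  then show ?thesis by simp
next
  case False
  \<comment> \<open>Chosen so that 1327104 / k^2 = 1/4: the low pairs then contribute at most 1/4 +
    1/4 of the total.\<close>
  define k :: real where "k = 2304"
  define K where "K = k ^ 4"
  have K0: "0 < K" by (simp add: K_def k_def)
  from extremal_exists[of \<mu>, OF False \<mu>] obtain \<phi>0 N where \<phi>0: "\<And>\<alpha>. \<alpha> \<in> P \<Longrightarrow> 0 \<le> \<phi>0 \<alpha>"
    "(\<Sum>\<alpha>\<in>P. W \<alpha> * (\<phi>0 \<alpha>)\<^sup>2) = 1" "(\<Sum>\<omega>\<in>P. \<mu> \<omega> * (Hardy \<phi>0 \<omega>)\<^sup>2) = N"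
    and emb: "\<And>g. (\<Sum>\<omega>\<in>P. \<mu> \<omega> * (Hardy g \<omega>)\<^sup>2) \<le> N * (\<Sum>\<alpha>\<in>P. W \<alpha> * (g \<alpha>)\<^sup>2)" by blast
  have N0: "0 \<le> N" using \<phi>0(3) \<mu> by (auto intro!: sum_nonneg)
  have "N \<le> 4 * K\<^sup>2 * B"
  proof (cases "N = 0")
    case True
    then show ?thesis using B by simp
  next
    case False
    then have Np: "0 < N" using N0 by simp
    define V where "V = Hardy \<phi>0"
    define \<sigma> where "\<sigma> \<omega> = \<mu> \<omega> * V \<omega> / N" for \<omega>
    define \<phi> where "\<phi> = dual_Hardy \<sigma>"
    have \<phi>\<phi>0: "\<phi> \<alpha> = \<phi>0 \<alpha>" if "\<alpha> \<in> P" for \<alpha>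
      unfolding \<phi>_def \<sigma>_def[abs_def] V_def by (rule extremal_equation[OF \<mu> Np \<phi>0(2,3) emb that])
    have V: "V = Hardy \<phi>" unfolding V_def by (rule ext, rule Hardy_cong) (simp add: \<phi>\<phi>0)
    have V0: "0 \<le> V \<alpha>" for \<alpha> unfolding V_def using \<phi>0(1) by (rule Hardy_nonneg)
    have \<sigma>0: "0 \<le> \<sigma> \<omega>" if "\<omega> \<in> P" for \<omega> using \<mu>[OF that] V0 Np by (simp add: \<sigma>_def)
    have E1: "(\<Sum>\<alpha>\<in>P. W \<alpha> * (\<phi> \<alpha>)\<^sup>2) = 1" using \<phi>0(2) by (simp add: \<phi>\<phi>0 cong: sum.cong)
    have VN: "(\<Sum>\<omega>\<in>P. \<mu> \<omega> * (V \<omega>)\<^sup>2) = N" using \<phi>0(3) by (simp add: V_def)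
    define Lo where "Lo \<omega> = (\<Sum>\<alpha>\<in>{\<alpha>\<in>P. \<omega> \<le> \<alpha> \<and> K * V \<alpha> \<le> V \<omega>}. W \<alpha> * \<phi> \<alpha>)" for \<omega>
    have "(\<Sum>\<omega>\<in>P. \<mu> \<omega> * (V \<omega> * Lo \<omega>)) \<le> N / 4 + 1327104 / k\<^sup>2 * (N * 1)"
      unfolding Lo_def K_def VN[symmetric] E1[symmetric]
      by (rule low_potential_le[OF card \<sigma>0 \<mu> \<phi>_def V _ _ _, where k = k])
         (use emb N0 VN in \<open>auto simp: k_def\<close>)
    also have "\<dots> = N / 2" by (simp add: k_def)
    finally have lo: "(\<Sum>\<omega>\<in>P. \<mu> \<omega> * (V \<omega> * Lo \<omega>)) \<le> N / 2" .
    have "1 = (\<Sum>\<alpha>\<in>P. W \<alpha> * \<phi> \<alpha> * (\<Sum>\<omega>\<in>{\<omega>\<in>P. \<omega> \<le> \<alpha>}. \<sigma> \<omega>))"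
      unfolding E1[symmetric] by (simp add: \<phi>_def dual_Hardy_def power2_eq_square mult.assoc)
    also have "\<dots> \<le> (\<Sum>\<alpha>\<in>P. W \<alpha> * \<phi> \<alpha> * ((\<Sum>\<omega>\<in>{\<omega>\<in>P. \<omega> \<le> \<alpha> \<and> K * V \<alpha> \<le> V \<omega>}. \<sigma> \<omega>) + K / N * (V \<alpha> * dual_Hardy \<mu> \<alpha>)))"
    proof (intro sum_mono mult_left_mono)
      fix \<alpha> assume \<alpha>: "\<alpha> \<in> P"
      have "(\<Sum>\<omega>\<in>{\<omega>\<in>P. \<omega> \<le> \<alpha>}. \<sigma> \<omega>)
          \<le> (\<Sum>\<omega>\<in>{\<omega>\<in>P. \<omega> \<le> \<alpha>}. (if K * V \<alpha> \<le> V \<omega> then \<sigma> \<omega> else 0) + K / N * (V \<alpha> * \<mu> \<omega>))"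
      proof (rule sum_mono)
        fix \<omega> assume "\<omega> \<in> {\<omega>\<in>P. \<omega> \<le> \<alpha>}"
        then have m: "0 \<le> \<mu> \<omega>" using \<mu> by auto
        show "\<sigma> \<omega> \<le> (if K * V \<alpha> \<le> V \<omega> then \<sigma> \<omega> else 0) + K / N * (V \<alpha> * \<mu> \<omega>)"
        proof (cases "K * V \<alpha> \<le> V \<omega>")
          case True
          then show ?thesis using m V0 K0 Np by simp
        next
          case False
          then have "\<mu> \<omega> * V \<omega> / N \<le> \<mu> \<omega> * (K * V \<alpha>) / N"
            using m Np by (intro divide_right_mono mult_left_mono) auto
          then show ?thesis using False by (simp add: \<sigma>_def mult_ac)
        qed
      qed
      also have "\<dots> = (\<Sum>\<omega>\<in>{\<omega>\<in>P. \<omega> \<le> \<alpha> \<and> K * V \<alpha> \<le> V \<omega>}. \<sigma> \<omega>) + K / N * (V \<alpha> * dual_Hardy \<mu> \<alpha>)"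
        by (simp add: sum.distrib dual_Hardy_def sum_distrib_left sum.inter_filter[symmetric] conj_assoc)
      finally show "(\<Sum>\<omega>\<in>{\<omega>\<in>P. \<omega> \<le> \<alpha>}. \<sigma> \<omega>)
        \<le> (\<Sum>\<omega>\<in>{\<omega>\<in>P. \<omega> \<le> \<alpha> \<and> K * V \<alpha> \<le> V \<omega>}. \<sigma> \<omega>) + K / N * (V \<alpha> * dual_Hardy \<mu> \<alpha>)" .
      show "0 \<le> W \<alpha> * \<phi> \<alpha>" using \<alpha> \<phi>0(1) by (simp add: \<phi>\<phi>0 W_nonneg)
    qed
    also have "\<dots> = (\<Sum>\<alpha>\<in>P. \<Sum>\<omega>\<in>P. if \<omega> \<le> \<alpha> \<and> K * V \<alpha> \<le> V \<omega> then \<sigma> \<omega> * (W \<alpha> * \<phi> \<alpha>) else 0)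
        + K / N * (\<Sum>\<alpha>\<in>P. W \<alpha> * (\<phi> \<alpha> * (V \<alpha> * dual_Hardy \<mu> \<alpha>)))"
    proof -
      have "W \<alpha> * \<phi> \<alpha> * (\<Sum>\<omega>\<in>{\<omega>\<in>P. \<omega> \<le> \<alpha> \<and> K * V \<alpha> \<le> V \<omega>}. \<sigma> \<omega>)
          = (\<Sum>\<omega>\<in>P. if \<omega> \<le> \<alpha> \<and> K * V \<alpha> \<le> V \<omega> then \<sigma> \<omega> * (W \<alpha> * \<phi> \<alpha>) else 0)" for \<alpha>
        by (simp add: sum.inter_filter[OF finite_P, symmetric] sum_distrib_left mult.commute)
      then show ?thesis
        by (simp add: distrib_left sum.distrib sum_distrib_left mult.left_commute mult.assoc)
    qed
    also have "(\<Sum>\<alpha>\<in>P. \<Sum>\<omega>\<in>P. if \<omega> \<le> \<alpha> \<and> K * V \<alpha> \<le> V \<omega> then \<sigma> \<omega> * (W \<alpha> * \<phi> \<alpha>) else 0)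
        = (\<Sum>\<omega>\<in>P. \<sigma> \<omega> * Lo \<omega>)"
      by (subst sum.swap) (simp add: Lo_def sum.inter_filter[OF finite_P, symmetric] sum_distrib_left)
    also have "\<dots> = (\<Sum>\<omega>\<in>P. \<mu> \<omega> * (V \<omega> * Lo \<omega>)) / N"
      by (simp add: \<sigma>_def sum_divide_distrib mult.assoc)
    finally have "1 \<le> (\<Sum>\<omega>\<in>P. \<mu> \<omega> * (V \<omega> * Lo \<omega>)) / N
        + K / N * (\<Sum>\<alpha>\<in>P. W \<alpha> * (\<phi> \<alpha> * (V \<alpha> * dual_Hardy \<mu> \<alpha>)))" .
    moreover have "(\<Sum>\<omega>\<in>P. \<mu> \<omega> * (V \<omega> * Lo \<omega>)) / N \<le> 1 / 2"
      using lo Np by (simp add: field_simps)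
    moreover have "(\<Sum>\<alpha>\<in>P. W \<alpha> * (\<phi> \<alpha> * (V \<alpha> * dual_Hardy \<mu> \<alpha>))) \<le> sqrt (B * N)"
    proof -
      have "(\<Sum>\<alpha>\<in>P. W \<alpha> * (\<phi> \<alpha> * (V \<alpha> * dual_Hardy \<mu> \<alpha>)))
          \<le> sqrt (\<Sum>\<alpha>\<in>P. W \<alpha> * (\<phi> \<alpha>)\<^sup>2) * sqrt (\<Sum>\<alpha>\<in>P. W \<alpha> * (V \<alpha> * dual_Hardy \<mu> \<alpha>)\<^sup>2)"
        by (rule sum_weighted_le_sqrt)
      also have "\<dots> = sqrt (\<Sum>\<alpha>\<in>P. W \<alpha> * (V \<alpha> * dual_Hardy \<mu> \<alpha>)\<^sup>2)" by (simp add: E1)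
      also have "\<dots> \<le> sqrt (B * N)"
        unfolding V_def using box_square_le[of \<phi>0 \<mu> B, OF _ \<mu> B box] \<phi>0(1,3) by (intro real_sqrt_le_mono) simp
      finally show ?thesis .
    qed
    then have "K / N * (\<Sum>\<alpha>\<in>P. W \<alpha> * (\<phi> \<alpha> * (V \<alpha> * dual_Hardy \<mu> \<alpha>))) \<le> K / N * sqrt (B * N)"
      using K0 Np by (intro mult_left_mono) auto
    \<comment> \<open>At least half of the unit norm comes from the pairs with V \<omega> < K * V
      \<alpha>. Solving for N gives 4 * K^2 * B, where K^2 = k^8.\<close>
    ultimately have "1 / 2 \<le> K / N * sqrt (B * N)" by linarith
    then have "N \<le> 2 * K * sqrt (B * N)" using Np by (simp add: field_simps)
    then have "N \<le> (2 * K) * (sqrt B * sqrt N)" by (simp add: real_sqrt_mult)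
    from le_square_of_le_sqrt_mult[OF this N0 B] K0 show ?thesis
      by (simp add: power_mult_distrib)
  qed
  also have "4 * K\<^sup>2 * B = 4 * 2304 ^ 8 * B" by (simp add: K_def k_def flip: power_mult)
  finally have "N * (\<Sum>\<alpha>\<in>P. W \<alpha> * (g \<alpha>)\<^sup>2) \<le> (4 * 2304 ^ 8 * B) * (\<Sum>\<alpha>\<in>P. W \<alpha> * (g \<alpha>)\<^sup>2)"
    by (intro mult_right_mono sum_nonneg) (auto simp: W_nonneg)
  with emb[of g] show ?thesis by linarith
qed

text \<open>The form in which measures use the embedding: \<kappa> will be the integral of a
  function over a cell, e that of its square, and the last hypothesis is Cauchy-Schwarz on the cell.
  Written as an inequality between products it also covers cells of measure zero.\<close>

corollary box_imp_dual_embedding: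
  assumes card: "CARD('d) \<le> 3" and \<mu>: "\<And>\<beta>. \<beta> \<in> P \<Longrightarrow> 0 \<le> \<mu> \<beta>" and B: "0 \<le> B"
    and box: "\<And>Q. Q \<in> P \<Longrightarrow> (\<Sum>R\<in>{R\<in>P. R \<le> Q}. W R * (dual_Hardy \<mu> R)\<^sup>2) \<le> B * dual_Hardy \<mu> Q"
    and e: "\<And>\<omega>. \<omega> \<in> P \<Longrightarrow> 0 \<le> e \<omega>" and \<kappa>: "\<And>\<omega>. \<omega> \<in> P \<Longrightarrow> (\<kappa> \<omega>)\<^sup>2 \<le> \<mu> \<omega> * e \<omega>"
  shows "(\<Sum>R\<in>P. W R * (dual_Hardy \<kappa> R)\<^sup>2) \<le> (4 * 2304 ^ 8 * B) * (\<Sum>\<omega>\<in>P. e \<omega>)"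
proof -
  define C where "C = 4 * 2304 ^ 8 * B"
  have C0: "0 \<le> C" using B by (simp add: C_def)
  let ?\<psi> = "dual_Hardy \<kappa>"
  let ?x = "\<Sum>R\<in>P. W R * (?\<psi> R)\<^sup>2"
  have x0: "0 \<le> ?x" by (intro sum_nonneg) (auto simp: W_nonneg)
  have e0: "0 \<le> (\<Sum>\<omega>\<in>P. e \<omega>)" using e by (rule sum_nonneg)
  have "?x = (\<Sum>R\<in>P. W R * ?\<psi> R * ?\<psi> R)" by (simp add: power2_eq_square mult.assoc)
  also have "\<dots> = (\<Sum>\<omega>\<in>P. \<kappa> \<omega> * Hardy ?\<psi> \<omega>)" by (rule sum_Hardy_swap[symmetric])
  also have "\<dots> \<le> (\<Sum>\<omega>\<in>P. sqrt (e \<omega>) * (sqrt (\<mu> \<omega>) * \<bar>Hardy ?\<psi> \<omega>\<bar>))"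
  proof (rule sum_mono)
    fix \<omega> assume "\<omega> \<in> P"
    then have "sqrt ((\<kappa> \<omega>)\<^sup>2) \<le> sqrt (\<mu> \<omega> * e \<omega>)" by (intro real_sqrt_le_mono \<kappa>)
    then have "\<bar>\<kappa> \<omega>\<bar> * \<bar>Hardy ?\<psi> \<omega>\<bar> \<le> (sqrt (\<mu> \<omega>) * sqrt (e \<omega>)) * \<bar>Hardy ?\<psi> \<omega>\<bar>"
      by (intro mult_right_mono) (auto simp: real_sqrt_mult)
    then show "\<kappa> \<omega> * Hardy ?\<psi> \<omega> \<le> sqrt (e \<omega>) * (sqrt (\<mu> \<omega>) * \<bar>Hardy ?\<psi> \<omega>\<bar>)"
      using abs_ge_self[of "\<kappa> \<omega> * Hardy ?\<psi> \<omega>"] by (simp add: abs_mult mult_ac)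
  qed
  also have "\<dots> \<le> sqrt (\<Sum>\<omega>\<in>P. (sqrt (e \<omega>))\<^sup>2) * sqrt (\<Sum>\<omega>\<in>P. (sqrt (\<mu> \<omega>) * \<bar>Hardy ?\<psi> \<omega>\<bar>)\<^sup>2)"
    by (rule sum_mult_le_sqrt)
  also have "\<dots> = sqrt (\<Sum>\<omega>\<in>P. e \<omega>) * sqrt (\<Sum>\<omega>\<in>P. \<mu> \<omega> * (Hardy ?\<psi> \<omega>)\<^sup>2)"
    using e \<mu> by (simp add: power_mult_distrib cong: sum.cong)
  also have "\<dots> \<le> sqrt (\<Sum>\<omega>\<in>P. e \<omega>) * sqrt (C * ?x)"
    using box_imp_Hardy_embedding[OF card \<mu> B box, of ?\<psi>] e0
    by (intro mult_left_mono real_sqrt_le_mono) (auto simp: C_def)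
  finally have "?x \<le> sqrt C * (sqrt (\<Sum>\<omega>\<in>P. e \<omega>) * sqrt ?x)"
    by (simp add: real_sqrt_mult mult_ac)
  from le_square_of_le_sqrt_mult[OF this x0 e0] C0 show ?thesis by (simp add: C_def)
qed

end

subsection \<open>Dyadic lattices\<close>

lemma norm_cis_diff: "norm (cis a - cis b) = 2 * \<bar>sin ((a - b) / 2)\<bar>"
proof -
  have "cis a - cis b = cis b * (cis (a - b) - 1)"
    by (simp add: right_diff_distrib cis_mult)
  also have "cis (a - b) = exp (\<i> * of_real (a - b))"
    by (rule cis_conv_exp)
  finally show ?thesis by (simp add: norm_mult dist_exp_i_1 del: of_real_diff)
qed

lemma norm_cis_diff_le: "norm (cis a - cis b) \<le> \<bar>a - b\<bar>"
  using abs_sin_x_le_abs_x[of "(a - b) / 2"] by (simp add: norm_cis_diff)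

text \<open>By concavity the sine lies above its chord from 0 to pi/2.\<close>

lemma Jordan_inequality:
  assumes "0 \<le> x" "x \<le> pi / 2"
  shows "2 * x / pi \<le> sin x"
proof -
  have "convex_on {0..pi} (\<lambda>x::real. - sin x)"
    by (rule f''_ge0_imp_convex[where f' = "\<lambda>x. - cos x" and f'' = sin])
       (auto intro!: derivative_eq_intros sin_ge_zero)
  from convex_onD[OF this, of "2 * x / pi" 0 "pi / 2"] assms
  show ?thesis by (simp add: field_simps)
qed

lemma obtain_angle_diff:
  assumes "norm q = 1"
  obtains \<theta> where "q = cis (\<alpha> + \<theta>)" "\<bar>\<theta>\<bar> \<le> pi / 2 * norm (cis \<alpha> - q)"
proof -
  define u where "u = q * cis (- \<alpha>)"
  have u: "norm u = 1" using assms by (simp add: u_def norm_mult)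
  define \<theta> where "\<theta> = Arg u"
  have "u \<noteq> 0" using u by auto
  then have "cis \<theta> = u" using u by (simp add: \<theta>_def cis_Arg sgn_div_norm)
  then have q: "q = cis (\<alpha> + \<theta>)"
    by (simp add: u_def cis_mult[symmetric] mult.left_commute) (simp add: cis_mult)
  have "\<bar>\<theta>\<bar> \<le> pi" using Arg_bounded[of u] by (auto simp: \<theta>_def)
  then have "2 * (\<bar>\<theta>\<bar> / 2) / pi \<le> sin (\<bar>\<theta>\<bar> / 2)" by (intro Jordan_inequality) auto
  moreover have "norm (cis \<alpha> - q) = 2 * \<bar>sin (\<theta> / 2)\<bar>"
    unfolding q by (simp add: norm_cis_diff)
  moreover have "sin (\<bar>\<theta>\<bar> / 2) \<le> \<bar>sin (\<theta> / 2)\<bar>" by (auto simp: abs_if)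
  ultimately have "2 * \<bar>\<theta>\<bar> / pi \<le> norm (cis \<alpha> - q)" by simp
  then have "\<bar>\<theta>\<bar> \<le> pi / 2 * norm (cis \<alpha> - q)" by (simp add: field_simps)
  with q show thesis by (rule that)
qed

text \<open>A half-open arc is the increasing union of compact arcs.\<close>

lemma half_open_arc_borel:
  assumes "half_open_arc l I" "0 < l"
  shows "I \<in> sets borel"
proof -
  from assms(1) obtain a where I: "I = cis ` {a..<a + l} \<or> I = cis ` {a<..a + l}"
    unfolding half_open_arc_def by blast
  have closed: "closed (cis ` {x..y})" for x y
    by (intro compact_imp_closed compact_continuous_image) (auto intro!: continuous_intros)
  have ex: "\<exists>n. l / real (Suc n) \<le> d" if "0 < d" for d
  proof -
    obtain n where "l / d < real n" using reals_Archimedean2 by blast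
    then have "l < d * real n" using that by (simp add: field_simps)
    also have "\<dots> \<le> d * real (Suc n)" using that by (intro mult_left_mono) auto
    finally show ?thesis by (intro exI[of _ n]) (simp add: field_simps)
  qed
  have pos: "0 < l / real (Suc n)" for n using assms(2) by simp
  have 1: "{a..<a + l} = (\<Union>n. {a..a + l - l / real (Suc n)})"
  proof (intro equalityI subsetI)
    fix x assume x: "x \<in> {a..<a + l}"
    then obtain n where "l / real (Suc n) \<le> a + l - x" using ex[of "a + l - x"] by auto
    then have "x \<in> {a..a + l - l / real (Suc n)}" using x by simp
    then show "x \<in> (\<Union>n. {a..a + l - l / real (Suc n)})" by blast
  next
    fix x assume "x \<in> (\<Union>n. {a..a + l - l / real (Suc n)})"
    then obtain n where "x \<in> {a..a + l - l / real (Suc n)}" by blast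
    with pos[of n] show "x \<in> {a..<a + l}" by simp
  qed
  have 2: "{a<..a + l} = (\<Union>n. {a + l / real (Suc n)..a + l})"
  proof (intro equalityI subsetI)
    fix x assume x: "x \<in> {a<..a + l}"
    then obtain n where "l / real (Suc n) \<le> x - a" using ex[of "x - a"] by auto
    then have "x \<in> {a + l / real (Suc n)..a + l}" using x by simp
    then show "x \<in> (\<Union>n. {a + l / real (Suc n)..a + l})" by blast
  next
    fix x assume "x \<in> (\<Union>n. {a + l / real (Suc n)..a + l})"
    then obtain n where "x \<in> {a + l / real (Suc n)..a + l}" by blast
    with pos[of n] show "x \<in> {a<..a + l}" by simp
  qed
  show ?thesis
    using I closed by (auto simp: 1 2 image_UN simp del: of_nat_Suc)
qed

section \<open>Combinatorics and geometry of one dyadic lattice\<close>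

locale lattice =
  fixes D :: "nat \<Rightarrow> complex set set"
  assumes D: "dyadic_lattice D"
begin

lemma partition: "partition_on (sphere 0 1) (D m)"
  using D unfolding dyadic_lattice_def by blast

lemma card_D: "card (D m) = 2 ^ m"
  using D unfolding dyadic_lattice_def by blast

lemma finite_D: "finite (D m)"
  using card_D[of m] by (metis card.infinite power_not_zero zero_neq_numeral)

lemma arc: "I \<in> D m \<Longrightarrow> half_open_arc (2 * pi / 2 ^ m) I"
  using D unfolding dyadic_lattice_def by blast

lemma children: "I \<in> D m \<Longrightarrow> \<exists>J\<in>D (Suc m). \<exists>K\<in>D (Suc m). J \<noteq> K \<and> I = J \<union> K"
  using D unfolding dyadic_lattice_def by blast

lemma nonempty: "I \<in> D m \<Longrightarrow> I \<noteq> {}"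
  using partition_onD3[OF partition] by blast

lemma norm_arc: "I \<in> D m \<Longrightarrow> u \<in> I \<Longrightarrow> norm u = 1"
  using partition_onD1[OF partition, of m] by (auto simp: set_eq_iff)

lemma arc_subset: "I \<in> D m \<Longrightarrow> I \<subseteq> sphere 0 1"
  using partition_onD1[OF partition, of m] by auto

lemma ex_arc: "norm u = 1 \<Longrightarrow> \<exists>I\<in>D m. u \<in> I"
  using partition_onD1[OF partition, of m] by (auto simp: set_eq_iff)

lemma arc_unique: "I \<in> D m \<Longrightarrow> J \<in> D m \<Longrightarrow> u \<in> I \<Longrightarrow> u \<in> J \<Longrightarrow> I = J"
  using partition_onD2[OF partition, of m] by (auto simp: disjoint_def)

lemma D_0: "D 0 = {sphere 0 1}"
proof -
  obtain X where X: "D 0 = {X}" using card_D[of 0] by (auto simp: card_1_singleton_iff)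
  then show ?thesis using partition_onD1[OF partition, of 0] by simp
qed

text \<open>The lattice axioms lead from an arc to its halves. For the way back, take the arc one
  generation up through a point of J: that point lies in one of its halves, which must be J because
  each generation is a partition.\<close>

lemma parent: "J \<in> D (m + k) \<Longrightarrow> \<exists>I\<in>D m. J \<subseteq> I"
proof (induction k arbitrary: J)
  case 0
  then show ?case by auto
next
  case (Suc k)
  obtain u where u: "u \<in> J" using nonempty[OF Suc.prems] by blast
  then obtain I where I: "I \<in> D (m + k)" "u \<in> I"
    using ex_arc[of u "m + k"] norm_arc[OF Suc.prems] by blast
  obtain J' K' where JK: "J' \<in> D (Suc (m + k))" "K' \<in> D (Suc (m + k))" "I = J' \<union> K'"
    using children[OF I(1)] by blast
  have J: "J \<in> D (Suc (m + k))" using Suc.prems by simp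
  have "J = J' \<or> J = K'"
    using arc_unique[OF J JK(1) u] arc_unique[OF J JK(2) u] I(2) JK(3) by blast
  then have "J \<subseteq> I" using JK(3) by blast
  with Suc.IH[OF I(1)] show ?case by blast
qed

lemma nested:
  assumes "I \<in> D m" "J \<in> D m'" "m \<le> m'" "u \<in> I" "u \<in> J"
  shows "J \<subseteq> I"
proof -
  obtain I' where "I' \<in> D m" "J \<subseteq> I'" using parent[of J m "m' - m"] assms by auto
  moreover from this have "I = I'" using arc_unique[of I m I' u] assms by blast
  ultimately show ?thesis by simp
qed

text \<open>An arc of a second, later generation would be contained in each of its two halves,
  making them equal. No lengths are compared.\<close>

lemma generation_less_contradiction:
  assumes "I \<in> D m" "I \<in> D m'" "m < m'"
  shows False
proof -
  obtain J K where JK: "J \<in> D (Suc m)" "K \<in> D (Suc m)" "J \<noteq> K" "I = J \<union> K"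
    using children[OF assms(1)] by blast
  obtain u v where "u \<in> J" "v \<in> K" using nonempty JK by blast
  then have "I \<subseteq> J" "I \<subseteq> K"
    using nested[of J "Suc m" I m' u] nested[of K "Suc m" I m' v] JK assms by auto
  then have "J = K" using JK by blast
  with JK show False by blast
qed

lemma generation_unique: "I \<in> D m \<Longrightarrow> I \<in> D m' \<Longrightarrow> m = m'"
  using generation_less_contradiction by (metis linorder_neqE_nat)

lemma generation_eq: "I \<in> D m \<Longrightarrow> generation D I = m"
  unfolding generation_def by (rule the_equality) (auto dest: generation_unique)

lemma generation_mono:
  assumes "I \<in> D m" "J \<in> D m'" "J \<subseteq> I"
  shows "m \<le> m'"
proof (rule ccontr)
  assume *: "\<not> m \<le> m'"
  obtain u where "u \<in> J" using nonempty assms by blast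
  then have "I \<subseteq> J" using nested[of J m' I m u] assms * by auto
  then have "I = J" using assms by blast
  then show False using generation_unique assms * by auto
qed

lemma mem_tent_iff:
  assumes "I \<in> D m"
  shows "z \<in> tent D I \<longleftrightarrow> norm z < 1 \<and> (m = 0 \<or> (1 - 1 / 2 ^ m \<le> norm z \<and> z / of_real (norm z) \<in> I))"
proof (cases "m = 0")
  case True
  then show ?thesis using assms by (simp add: D_0 tent_def)
next
  case False
  then have "I \<noteq> sphere 0 1" using assms generation_unique[of I m 0] by (auto simp: D_0)
  then show ?thesis using False assms by (auto simp: tent_def generation_eq)
qed

lemma tent_subset_ball: "I \<in> D m \<Longrightarrow> tent D I \<subseteq> ball 0 1"
  using mem_tent_iff[of I m] by auto

lemma tent_mono:
  assumes "I \<in> D m" "J \<in> D m'" "J \<subseteq> I"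
  shows "tent D J \<subseteq> tent D I"
proof
  fix z assume z: "z \<in> tent D J"
  have m: "m \<le> m'" using generation_mono assms .
  then have "(1::real) / 2 ^ m' \<le> 1 / 2 ^ m" by (intro divide_left_mono) (auto intro: power_increasing)
  then show "z \<in> tent D I" using z m mem_tent_iff[OF assms(1), of z] mem_tent_iff[OF assms(2), of z] assms(3) by auto
qed

lemma tents_chain:
  assumes "I \<in> D m" "J \<in> D m'" "z \<in> tent D I" "z \<in> tent D J"
  shows "I \<subseteq> J \<or> J \<subseteq> I"
proof (cases "m = 0 \<or> m' = 0")
  case True
  then have "I = sphere 0 1 \<or> J = sphere 0 1" using assms(1,2) D_0 by auto
  then show ?thesis using arc_subset[OF assms(1)] arc_subset[OF assms(2)] by blast
next
  case False
  then have u: "z / of_real (norm z) \<in> I" "z / of_real (norm z) \<in> J"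
    using assms(3,4) mem_tent_iff[OF assms(1), of z] mem_tent_iff[OF assms(2), of z] by auto
  show ?thesis
  proof (cases "m \<le> m'")
    case True
    then show ?thesis using nested[OF assms(1,2) True u] by simp
  next
    case False
    then show ?thesis using nested[OF assms(2,1) _ u(2,1)] by simp
  qed
qed

lemma tents_same_generation:
  assumes "I \<in> D m" "J \<in> D m" "z \<in> tent D I" "z \<in> tent D J"
  shows "I = J"
proof -
  obtain u where "u \<in> I" "u \<in> J"
    using tents_chain[OF assms] nonempty[OF assms(1)] nonempty[OF assms(2)] by blast
  then show ?thesis using arc_unique assms by blast
qed

lemma arc_borel: "I \<in> D m \<Longrightarrow> I \<in> sets borel"
  by (rule half_open_arc_borel[OF arc]) auto

lemma tent_borel:
  assumes I: "I \<in> D m"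
  shows "tent D I \<in> sets borel"
proof -
  note [measurable] = arc_borel[OF I]
  have "tent D I = {z \<in> space borel. norm z < 1 \<and> (m = 0 \<or> (1 - 1 / 2 ^ m \<le> norm z \<and> z / of_real (norm z) \<in> I))}"
    using mem_tent_iff[OF I] by auto
  also have "\<dots> \<in> sets borel" by measurable
  finally show ?thesis .
qed

lemma arc_angle:
  assumes "I \<in> D m"
  obtains a where "\<And>p. p \<in> I \<Longrightarrow> \<exists>\<alpha>\<in>{a..a + 2 * pi / 2 ^ m}. p = cis \<alpha>"
proof -
  obtain a where "I = cis ` {a..<a + 2 * pi / 2 ^ m} \<or> I = cis ` {a<..a + 2 * pi / 2 ^ m}"
    using arc[OF assms] unfolding half_open_arc_def by blast
  then have "I \<subseteq> cis ` {a..a + 2 * pi / 2 ^ m}" by (elim disjE; simp only:; intro image_mono; auto)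
  then show thesis using that[of a] by blast
qed

lemma arc_diameter:
  assumes "I \<in> D m" "p \<in> I" "q \<in> I"
  shows "norm (p - q) \<le> 2 * pi / 2 ^ m"
proof -
  obtain a where a: "\<And>p. p \<in> I \<Longrightarrow> \<exists>\<alpha>\<in>{a..a + 2 * pi / 2 ^ m}. p = cis \<alpha>"
    using arc_angle[OF assms(1)] by blast
  obtain \<alpha> \<beta> where "p = cis \<alpha>" "q = cis \<beta>" "\<alpha> \<in> {a..a + 2 * pi / 2 ^ m}" "\<beta> \<in> {a..a + 2 * pi / 2 ^ m}"
    using a[OF assms(2)] a[OF assms(3)] by blast
  then show ?thesis using norm_cis_diff_le[of \<alpha> \<beta>] by (auto simp: abs_le_iff)
qed

text \<open>With p and q the radial projections, 1 - z * cnj v splits into a radial part of size at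
  most 2 / 2^m and an angular part bounded by the diameter 2 pi / 2^m of the arc; 2 + 2 pi is below
  9.\<close>

lemma common_tent_close:
  assumes I: "I \<in> D m" and z: "z \<in> tent D I" and v: "v \<in> tent D I"
  shows "norm (1 - z * cnj v) \<le> 9 / 2 ^ m"
proof (cases "m = 0")
  case True
  have "norm (z * cnj v) \<le> 1 * 1"
    unfolding norm_mult using z v mem_tent_iff[OF I, of z] mem_tent_iff[OF I, of v] by (intro mult_mono) auto
  then have "norm (1 - z * cnj v) \<le> 1 + 1"
    by (intro order_trans[OF norm_triangle_ineq4]) auto
  then show ?thesis using True by simp
next
  case False
  define p q where "p = z / of_real (norm z)" and "q = v / of_real (norm v)"
  have pq: "p \<in> I" "q \<in> I" and nz: "1 - 1 / 2 ^ m \<le> norm z" "norm z < 1" and nv: "1 - 1 / 2 ^ m \<le> norm v" "norm v < 1"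
    using False z v mem_tent_iff[OF I, of z] mem_tent_iff[OF I, of v] by (auto simp: p_def q_def)
  have n1: "norm p = 1" "norm q = 1" using norm_arc[OF I] pq by auto
  then have zv: "z = of_real (norm z) * p" "v = of_real (norm v) * q" by (auto simp: p_def q_def)
  have "1 - z * cnj v = of_real (1 - norm z * norm v) + of_real (norm z * norm v) * ((q - p) * cnj q)"
  proof -
    have "q * cnj q = 1" using n1 by (simp add: complex_norm_square[symmetric])
    then show ?thesis by (subst (1) zv(1), subst (1) zv(2)) (simp add: algebra_simps)
  qed
  also have "norm \<dots> \<le> (1 - norm z * norm v) + 1 * (norm (q - p) * 1)"
  proof (rule order_trans[OF norm_triangle_ineq], rule add_mono)
    have le: "norm z * norm v \<le> 1" using nz nv by (intro mult_le_one) auto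
    then show "norm (of_real (1 - norm z * norm v) :: complex) \<le> 1 - norm z * norm v"
      unfolding norm_of_real by simp
    show "norm (of_real (norm z * norm v) * ((q - p) * cnj q)) \<le> 1 * (norm (q - p) * 1)"
      unfolding norm_mult using le n1 by (intro mult_mono) (auto simp: norm_mult)
  qed
  also have "norm (q - p) \<le> 2 * pi / 2 ^ m" by (rule arc_diameter[OF I pq(2,1)])
  also have "1 - norm z * norm v \<le> 2 / 2 ^ m"
  proof -
    have "(1 - norm z) * norm v \<le> 1 - norm z" using nz nv by (intro mult_left_le) auto
    then have "1 - norm z * norm v \<le> (1 - norm z) + (1 - norm v)" by (simp add: algebra_simps)
    then show ?thesis using nz nv by simp
  qed
  finally have "norm (1 - z * cnj v) \<le> (2 + 2 * pi) / 2 ^ m" by (simp add: add_divide_distrib)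
  also have "\<dots> \<le> 9 / 2 ^ m"
    using pi_less_4 pi_approx by (intro divide_right_mono) auto
  finally show ?thesis .
qed

text \<open>Adjacency is measured by distance, so arcs count as adjacent to themselves. The
  threshold 4 / 2^m exceeds the bound 3 / 2^m produced by close points, and it corresponds to an
  angle of at most 2 pi / 2^m, one arc length.\<close>

definition adjacent :: "nat \<Rightarrow> complex set \<Rightarrow> complex set \<Rightarrow> bool"
  where "adjacent m I J \<longleftrightarrow> I \<in> D m \<and> J \<in> D m \<and> (\<exists>p\<in>I. \<exists>q\<in>J. norm (p - q) \<le> 4 / 2 ^ m)"

lemma adjacent_sym: "adjacent m I J \<longleftrightarrow> adjacent m J I"
  unfolding adjacent_def by (metis norm_minus_commute)

text \<open>An arc of length \<open>l\<close> within distance \<open>l\<close> of \<open>I\<close>, an arc starting at angle \<open>a\<close>, contains one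
  of the points \<open>cis (a + k * l)\<close> with \<open>-2 \<le> k \<le> 3\<close>.\<close>

lemma card_adjacent: "card {J. adjacent m I J} \<le> 6"
proof (cases "I \<in> D m")
  case False
  then have "{J. adjacent m I J} = {}" by (auto simp: adjacent_def)
  then show ?thesis by simp
next
  case True
  define l where "l = 2 * pi / 2 ^ m"
  have l: "0 < l" by (simp add: l_def)
  obtain a where a: "\<And>p. p \<in> I \<Longrightarrow> \<exists>\<alpha>\<in>{a..a + l}. p = cis \<alpha>"
    using arc_angle[OF True] unfolding l_def by blast
  define f where "f k = (THE J. J \<in> D m \<and> cis (a + of_int k * l) \<in> J)" for k :: int
  have "{J. adjacent m I J} \<subseteq> f ` {-2..3}"
  proof
    fix J assume "J \<in> {J. adjacent m I J}"
    then obtain p q where J: "J \<in> D m" and p: "p \<in> I" and q: "q \<in> J" and pq: "norm (p - q) \<le> 4 / 2 ^ m"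
      unfolding adjacent_def by blast
    obtain \<alpha> where \<alpha>: "\<alpha> \<in> {a..a + l}" "p = cis \<alpha>" using a[OF p] by blast
    obtain \<theta> where \<theta>: "q = cis (\<alpha> + \<theta>)" "\<bar>\<theta>\<bar> \<le> pi / 2 * norm (cis \<alpha> - q)"
      using obtain_angle_diff norm_arc[OF J q] by blast
    have "pi / 2 * norm (cis \<alpha> - q) \<le> pi / 2 * (4 / 2 ^ m)"
      using pq \<alpha>(2) by (intro mult_left_mono) auto
    then have \<theta>l: "\<bar>\<theta>\<bar> \<le> l" using \<theta>(2) by (simp add: l_def)
    obtain b \<beta> where b: "J = cis ` {b..<b + l} \<and> \<beta> \<in> {b..<b + l} \<or> J = cis ` {b<..b + l} \<and> \<beta> \<in> {b<..b + l}"
      and \<beta>: "q = cis \<beta>"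
      using arc[OF J] q unfolding half_open_arc_def l_def[symmetric] by blast
    \<comment> \<open>Both \<alpha> + \<theta> and \<beta> are angles of q, so \<delta> is a period
      of \<open>cis\<close>.\<close>
    define \<delta> where "\<delta> = \<alpha> + \<theta> - \<beta>"
    have "cis \<delta> = cis (\<alpha> + \<theta>) / cis \<beta>" by (simp add: \<delta>_def cis_divide)
    then have cis\<delta>: "cis \<delta> = 1" using \<theta>(1) \<beta> by simp
    have cis_shift: "cis (x - \<delta>) = cis x" for x
      using cis\<delta> by (simp flip: cis_divide)
    \<comment> \<open>A half-open interval of length l contains a point of the progression a + k * l
      - \<delta>. Rounding up serves the interval closed on the left, rounding down plus one that
      closed on the right.\<close>
    obtain k :: int where k: "a + k * l - \<delta> \<in> {b..b + l}" "cis (a + k * l - \<delta>) \<in> J"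
    proof (cases "J = cis ` {b..<b + l}")
      case True
      let ?k = "\<lceil>(b + \<delta> - a) / l\<rceil>"
      have "(b + \<delta> - a) / l \<le> ?k" "?k < (b + \<delta> - a) / l + 1" by linarith+
      then have "(b + \<delta> - a) / l * l \<le> ?k * l" "?k * l < ((b + \<delta> - a) / l + 1) * l"
        using l by (simp_all only: mult_le_cancel_right_pos mult_less_cancel_right_pos)
      then have "b + \<delta> - a \<le> ?k * l" "?k * l < b + \<delta> - a + l"
        using l by (simp_all add: distrib_right)
      then have "a + ?k * l - \<delta> \<in> {b..<b + l}" by auto
      then show thesis using True that[of ?k] by auto
    next
      case False
      let ?k = "\<lfloor>(b + \<delta> - a) / l\<rfloor> + 1"
      have "(b + \<delta> - a) / l < ?k" "?k \<le> (b + \<delta> - a) / l + 1" by linarith+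
      then have "(b + \<delta> - a) / l * l < ?k * l" "?k * l \<le> ((b + \<delta> - a) / l + 1) * l"
        using l by (simp_all only: mult_le_cancel_right_pos mult_less_cancel_right_pos)
      then have "b + \<delta> - a < ?k * l" "?k * l \<le> b + \<delta> - a + l"
        using l by (simp_all add: distrib_right)
      then have "a + ?k * l - \<delta> \<in> {b<..b + l}" by auto
      then show thesis using False b that[of ?k] by auto
    qed
    \<comment> \<open>The angle of q is within l of {a..a + l}, and a + k * l is within l of the
      angle of q; together k runs from -2 to 3.\<close>
    have "\<beta> + \<delta> \<in> {a - l..a + 2 * l}" using \<theta>l \<alpha>(1) by (auto simp: \<delta>_def abs_le_iff)
    moreover have "\<beta> \<in> {b..b + l}" using b by auto
    ultimately have "- 2 * l \<le> k * l" "k * l \<le> 3 * l" using k(1) by auto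
    then have "- 2 \<le> real_of_int k" "real_of_int k \<le> 3" using l by (simp_all only: mult_le_cancel_right_pos)
    then have "k \<in> {-2..3}" by simp
    moreover have "f k = J"
      unfolding f_def
    proof (rule the_equality)
      show *: "J \<in> D m \<and> cis (a + k * l) \<in> J" using J k(2) cis_shift by simp
      show "J' = J" if "J' \<in> D m \<and> cis (a + k * l) \<in> J'" for J'
        using that * arc_unique by blast
    qed
    ultimately show "J \<in> f ` {-2..3}" by blast
  qed
  then have "card {J. adjacent m I J} \<le> card (f ` {-2..3})" by (rule card_mono[rotated]) simp
  also have "\<dots> \<le> card {-2..3::int}" by (rule card_image_le) simp
  finally show ?thesis by simp
qed

text \<open>A converse of \<open>common_tent_close\<close>. Close points can be separated by an
  endpoint of dyadic arcs, so one common arc has to be replaced by two adjacent ones. Generation 0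
  is treated apart since z or v may be 0.\<close>

lemma close_points_adjacent:
  assumes z: "norm z < 1" and v: "norm v < 1" and close: "m = 0 \<or> 2 ^ m * norm (1 - z * cnj v) \<le> 1"
  shows "\<exists>I J. adjacent m I J \<and> z \<in> tent D I \<and> v \<in> tent D J"
proof (cases "m = 0")
  case True
  then have "adjacent m (sphere 0 1) (sphere 0 1)"
    by (auto simp: adjacent_def D_0 intro!: bexI[of _ 1])
  then show ?thesis using z v by (auto simp: tent_def)
next
  case False
  define e where "e = norm (1 - z * cnj v)"
  have e: "e \<le> 1 / 2 ^ m" using close False by (simp add: e_def field_simps)
  have "(1::real) / 2 ^ m \<le> 1 / 2 ^ 1" using False by (intro divide_left_mono power_increasing) auto
  with e have "e \<le> 1 / 2 ^ 1" by (rule order_trans)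
  \<comment> \<open>For m > 0 this keeps both points away from the origin, so that their radial
    projections exist.\<close>
  then have half: "e \<le> 1 / 2" by simp
  have "1 - norm z * norm v \<le> e"
    using norm_triangle_ineq2[of 1 "z * cnj v"] by (simp add: e_def norm_mult)
  moreover have "norm z * norm v \<le> norm z" "norm z * norm v \<le> norm v"
    using z v by (auto intro: mult_left_le mult_left_le_one_le)
  ultimately have nz: "1 - norm z \<le> e" and nv: "1 - norm v \<le> e" by linarith+
  have "(norm (z - v))\<^sup>2 \<le> e\<^sup>2"
  proof -
    \<comment> \<open>The identity behind the pseudohyperbolic distance: the product is |1 - z * cnj
      v|^2 - |z - v|^2.\<close>
    have "0 \<le> (1 - (norm z)\<^sup>2) * (1 - (norm v)\<^sup>2)"
      using z v by (intro mult_nonneg_nonneg) (auto simp: power_le_one)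
    also have "\<dots> = e\<^sup>2 - (norm (z - v))\<^sup>2"
      unfolding e_def cmod_power2 by (simp add: algebra_simps power2_eq_square)
    finally show ?thesis by simp
  qed
  then have zv: "norm (z - v) \<le> e" by (rule power2_le_imp_le) (simp add: e_def)
  define p q where "p = z / of_real (norm z)" and "q = v / of_real (norm v)"
  have "0 < norm z" "0 < norm v" using nz nv half by linarith+
  then have nn: "z \<noteq> 0" "v \<noteq> 0" by auto
  then have n1: "norm p = 1" "norm q = 1" by (auto simp: p_def q_def norm_divide)
  have "p - z = of_real (1 - norm z) * p" "q - v = of_real (1 - norm v) * q"
    using nn by (simp_all add: p_def q_def field_simps)
  then have "norm (p - z) = 1 - norm z" "norm (q - v) = 1 - norm v"
    using n1 z v by (simp_all only: norm_mult norm_of_real) auto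
  moreover have "norm (p - q) \<le> norm (p - z) + norm (z - v) + norm (q - v)"
    by (metis (no_types, opaque_lifting) norm_minus_commute norm_diff_triangle_le order_refl add.commute)
  moreover have "(4::real) / 2 ^ m = 4 * (1 / 2 ^ m)" "(0::real) \<le> 1 / 2 ^ m" by simp_all
  ultimately have pq: "norm (p - q) \<le> 4 / 2 ^ m" using nz nv zv e by linarith
  obtain I J where IJ: "I \<in> D m" "p \<in> I" "J \<in> D m" "q \<in> J" using ex_arc n1 by meson
  then have "adjacent m I J" using pq by (auto simp: adjacent_def)
  moreover have "z \<in> tent D I" "v \<in> tent D J"
    using IJ(2,4) z v nz nv e mem_tent_iff[OF IJ(1), of z] mem_tent_iff[OF IJ(3), of v] by (auto simp: p_def q_def)
  ultimately show ?thesis by blast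
qed

end

subsection \<open>One-variable kernels\<close>

text \<open>Here y stands for |1 - z * cnj v|, \<beta> for 1 - s_j, and the summand is the weight of
  an arc of generation m. Generation 0 is always present because the tent over the circle is the
  whole disc. The threshold b is 9 for common tents and 1 for adjacent ones.\<close>

definition scale_sum :: "real \<Rightarrow> real \<Rightarrow> real \<Rightarrow> real"
  where "scale_sum \<beta> b y = (\<Sum>m\<in>{m::nat. m = 0 \<or> 2 ^ m * y \<le> b}. 2 powr (real m * \<beta>))"

lemma scales_eq_atMost:
  fixes y b :: real
  assumes y: "0 < y" and b: "0 < b"
  obtains M where "{m::nat. m = 0 \<or> 2 ^ m * y \<le> b} = {..M}" "M = 0 \<or> 2 ^ M * y \<le> b" "b < 2 ^ Suc M * y"
proof -
  let ?S = "{m::nat. m = 0 \<or> 2 ^ m * y \<le> b}"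
  obtain n where n: "b / y < 2 ^ n" using real_arch_pow[of 2 "b / y"] by auto
  have "?S \<subseteq> {..n}"
  proof
    fix m assume "m \<in> ?S"
    then consider "m = 0" | "2 ^ m * y \<le> b" by auto
    then show "m \<in> {..n}"
    proof cases
      case 2
      then have "2 ^ m \<le> b / y" using y by (simp add: field_simps)
      also note n
      finally have "m < n" by simp
      then show ?thesis by simp
    qed simp
  qed
  then have fin: "finite ?S" by (rule finite_subset) simp
  define M where "M = Max ?S"
  have M: "M \<in> ?S" unfolding M_def using fin by (intro Max_in) auto
  have le: "m \<le> M" if "m \<in> ?S" for m unfolding M_def using fin that by (rule Max_ge)
  have "?S = {..M}"
  proof (intro equalityI subsetI)
    fix m assume m: "m \<in> {..M}"
    show "m \<in> ?S"
    proof (cases "M = 0")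
      case False
      then have "2 ^ M * y \<le> b" using M by auto
      moreover have "2 ^ m * y \<le> 2 ^ M * y"
        using m y by (intro mult_right_mono power_increasing) auto
      ultimately show ?thesis by simp
    qed (use m in simp)
  qed (use le in auto)
  moreover have "Suc M \<notin> ?S" using le[of "Suc M"] by linarith
  then have "b < 2 ^ Suc M * y" by simp
  ultimately show thesis using that[of M] M by blast
qed

text \<open>The closed form of \<open>scale_sum\<close> up to constants: for \<beta> = 0 the number
  of scales, for \<beta> > 0 the largest term of a geometric sum. The 5 keeps the logarithmic case
  at least 4 for y <= 2.\<close>

definition size_fun :: "real \<Rightarrow> real \<Rightarrow> real"
  where "size_fun \<beta> y = (if \<beta> = 0 then 5 - ln y else y powr (- \<beta>))"

lemma size_fun_ge: "\<beta> = 0 \<Longrightarrow> 0 < y \<Longrightarrow> y \<le> 2 \<Longrightarrow> 4 \<le> size_fun \<beta> y"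
proof -
  assume *: "\<beta> = 0" "0 < y" "y \<le> 2"
  then have "ln y \<le> ln 2" by simp
  then have "4 \<le> 5 - ln y" using ln_2_less_1 by linarith
  then show ?thesis using * by (simp add: size_fun_def)
qed

text \<open>With M the last scale, 2^M <= b / y unless M = 0. The sum is M + 1 for \<beta> = 0 and
  geometric otherwise. The constant found here is unbounded as \<beta> tends to 0, which is
  admissible because the final constant may depend on s.\<close>

lemma scale_sum_le:
  assumes \<beta>: "0 \<le> \<beta>" and b: "0 < b"
  shows "\<exists>C>0. \<forall>y. 0 < y \<and> y \<le> 2 \<longrightarrow> scale_sum \<beta> b y \<le> C * size_fun \<beta> y"
proof (cases "\<beta> = 0")
  case True
  show ?thesis
  proof (intro exI[of _ "2 * \<bar>ln b\<bar> + 3"] conjI allI impI)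
    fix y :: real assume y: "0 < y \<and> y \<le> 2"
    obtain M where M: "{m::nat. m = 0 \<or> 2 ^ m * y \<le> b} = {..M}"
      "M = 0 \<or> 2 ^ M * y \<le> b"
      using scales_eq_atMost[of y b] y b by metis
    define h where "h = size_fun \<beta> y"
    have h: "4 \<le> h" "- ln y \<le> h" using size_fun_ge[OF True] y True by (auto simp: h_def size_fun_def)
    have "real M * ln 2 \<le> \<bar>ln b\<bar> + h"
    proof (cases "M = 0")
      case False
      then have "ln (2 ^ M * y) \<le> ln b" using M(2) y by (intro ln_mono) auto
      then show ?thesis using y h(2) by (simp add: ln_mult ln_realpow)
    qed (use h in simp)
    moreover have "real M * (1 / 2) \<le> real M * ln 2"
      using ln2_ge_two_thirds by (intro mult_left_mono) auto
    moreover have "\<bar>ln b\<bar> * 1 \<le> \<bar>ln b\<bar> * h" using h by (intro mult_left_mono) auto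
    ultimately have "real M + 1 \<le> 2 * (\<bar>ln b\<bar> * h) + 2 * h + h" using h by linarith
    moreover have "scale_sum \<beta> b y = real M + 1" using True M(1) by (simp add: scale_sum_def)
    ultimately show "scale_sum \<beta> b y \<le> (2 * \<bar>ln b\<bar> + 3) * size_fun \<beta> y"
      by (simp add: h_def[symmetric] algebra_simps)
  qed auto
next
  case False
  define \<rho> where "\<rho> = 2 powr \<beta>"
  have \<rho>: "1 < \<rho>" using False \<beta> by (simp add: \<rho>_def)
  show ?thesis
  proof (intro exI[of _ "(2 powr \<beta> + b powr \<beta>) * (\<rho> / (\<rho> - 1))"] conjI allI impI)
    fix y :: real assume y: "0 < y \<and> y \<le> 2"
    obtain M where M: "{m::nat. m = 0 \<or> 2 ^ m * y \<le> b} = {..M}"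
      "M = 0 \<or> 2 ^ M * y \<le> b"
      using scales_eq_atMost[of y b] y b by metis
    have pow: "2 powr (real m * \<beta>) = \<rho> ^ m" for m
      by (simp add: \<rho>_def powr_powr[symmetric] powr_realpow[symmetric] mult.commute)
    have "\<rho> ^ M \<le> (2 powr \<beta> + b powr \<beta>) * y powr (- \<beta>)"
    proof (cases "M = 0")
      case True
      have "y powr \<beta> \<le> 2 powr \<beta>" using y \<beta> by (intro powr_mono2) auto
      then have "1 \<le> 2 powr \<beta> * y powr (- \<beta>)" using y by (simp add: powr_minus field_simps)
      moreover have "0 \<le> b powr \<beta> * y powr (- \<beta>)" by simp
      ultimately have "1 \<le> (2 powr \<beta> + b powr \<beta>) * y powr (- \<beta>)"
        unfolding distrib_right by linarith
      then show ?thesis using True by simp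
    next
      case False
      then have "2 ^ M \<le> b / y" using M(2) y by (simp add: field_simps)
      then have "(2 ^ M) powr \<beta> \<le> (b / y) powr \<beta>" using \<beta> by (intro powr_mono2) auto
      also have "(2 ^ M) powr \<beta> = \<rho> ^ M" using pow[of M] by (simp add: powr_realpow[symmetric] powr_powr)
      also have "(b / y) powr \<beta> = b powr \<beta> * y powr (- \<beta>)"
        using y b by (simp add: powr_divide powr_minus field_simps)
      finally have "\<rho> ^ M \<le> b powr \<beta> * y powr (- \<beta>)" .
      moreover have "0 \<le> 2 powr \<beta> * y powr (- \<beta>)" by simp
      ultimately show ?thesis unfolding distrib_right by linarith
    qed
    then have "\<rho> ^ M * (\<rho> / (\<rho> - 1)) \<le> (2 powr \<beta> + b powr \<beta>) * y powr (- \<beta>) * (\<rho> / (\<rho> - 1))"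
      using \<rho> by (intro mult_right_mono) auto
    moreover have "scale_sum \<beta> b y \<le> \<rho> ^ M * (\<rho> / (\<rho> - 1))"
    proof -
      have "scale_sum \<beta> b y = (\<Sum>m<Suc M. \<rho> ^ m)"
        unfolding scale_sum_def M(1) pow by (simp add: lessThan_Suc_atMost)
      also have "\<dots> = (\<rho> ^ Suc M - 1) / (\<rho> - 1)" using \<rho> by (subst geometric_sum) auto
      also have "\<dots> \<le> \<rho> ^ Suc M / (\<rho> - 1)" using \<rho> by (intro divide_right_mono) auto
      finally show ?thesis by (simp add: mult.commute)
    qed
    ultimately show "scale_sum \<beta> b y \<le> (2 powr \<beta> + b powr \<beta>) * (\<rho> / (\<rho> - 1)) * size_fun \<beta> y"
      using False by (simp add: size_fun_def mult_ac)
  next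
    show "(0::real) < (2 powr \<beta> + b powr \<beta>) * (\<rho> / (\<rho> - 1))"
      using \<rho> by (intro mult_pos_pos add_pos_nonneg divide_pos_pos) auto
  qed
qed

text \<open>The first missing scale gives 1 / y < 2^(M + 1) / b. For \<beta> > 0 the last term of
  the sum alone is already large enough.\<close>

lemma size_fun_le:
  assumes \<beta>: "0 \<le> \<beta>" and b: "0 < b"
  shows "\<exists>C>0. \<forall>y. 0 < y \<and> y \<le> 2 \<longrightarrow> size_fun \<beta> y \<le> C * scale_sum \<beta> b y"
proof (cases "\<beta> = 0")
  case True
  show ?thesis
  proof (intro exI[of _ "\<bar>ln b\<bar> + 6"] conjI allI impI)
    fix y :: real assume y: "0 < y \<and> y \<le> 2"
    obtain M where M: "{m::nat. m = 0 \<or> 2 ^ m * y \<le> b} = {..M}"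
      "b < 2 ^ Suc M * y"
      using scales_eq_atMost[of y b] y b by metis
    have "ln b \<le> ln (2 ^ Suc M * y)" using M(2) b by (intro ln_mono) auto
    also have "\<dots> = real (Suc M) * ln 2 + ln y" using y by (simp only: ln_mult ln_realpow) simp
    finally have 1: "ln b \<le> real (Suc M) * ln 2 + ln y" .
    define S where "S = real (Suc M)"
    have S: "1 \<le> S" by (simp add: S_def)
    have "S * ln 2 \<le> S * 1" using ln_2_less_1 S by (intro mult_left_mono) auto
    moreover have "\<bar>ln b\<bar> * 1 \<le> \<bar>ln b\<bar> * S" using S by (intro mult_left_mono) auto
    ultimately have "5 - ln y \<le> \<bar>ln b\<bar> * S + 6 * S" using 1 S unfolding S_def[symmetric] by linarith
    then have "5 - ln y \<le> \<bar>ln b\<bar> * real (Suc M) + 6 * real (Suc M)" unfolding S_def .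
    moreover have "scale_sum \<beta> b y = real (Suc M)" using True M(1) by (simp add: scale_sum_def)
    ultimately show "size_fun \<beta> y \<le> (\<bar>ln b\<bar> + 6) * scale_sum \<beta> b y"
      using True by (simp add: size_fun_def distrib_right del: of_nat_Suc)
  qed auto
next
  case False
  show ?thesis
  proof (intro exI[of _ "(2 / b) powr \<beta>"] conjI allI impI)
    fix y :: real assume y: "0 < y \<and> y \<le> 2"
    obtain M where M: "{m::nat. m = 0 \<or> 2 ^ m * y \<le> b} = {..M}"
      "b < 2 ^ Suc M * y"
      using scales_eq_atMost[of y b] y b by metis
    have "1 / y \<le> (2 / b) * 2 ^ M" using M(2) y b by (simp add: field_simps)
    then have "(1 / y) powr \<beta> \<le> ((2 / b) * 2 ^ M) powr \<beta>" using \<beta> y by (intro powr_mono2) auto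
    also have "\<dots> = (2 / b) powr \<beta> * 2 powr (real M * \<beta>)"
    proof -
      have "(2 ^ M) powr \<beta> = 2 powr (real M * \<beta>)" by (simp add: powr_realpow[symmetric] powr_powr)
      then show ?thesis using b by (subst powr_mult) auto
    qed
    also have "\<dots> \<le> (2 / b) powr \<beta> * scale_sum \<beta> b y"
      unfolding scale_sum_def M(1) by (intro mult_left_mono member_le_sum) auto
    also have "(1 / y) powr \<beta> = size_fun \<beta> y"
      using False y by (simp add: size_fun_def powr_divide powr_minus field_simps)
    finally show "size_fun \<beta> y \<le> (2 / b) powr \<beta> * scale_sum \<beta> b y" .
  qed (use b in auto)
qed

text \<open>The constant \<open>5\<close>, like the bound on \<open>\<beta>\<close> below, confines the values to a narrow sector, so that
  the product of three of them stays away from the imaginary axis.\<close>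

definition kernel_fun :: "real \<Rightarrow> complex \<Rightarrow> complex"
  where "kernel_fun \<beta> x = (if \<beta> = 0 then 5 - Ln (1 - x) else (1 - x) powr (- of_real \<beta>))"

definition kernel_coeff :: "real \<Rightarrow> nat \<Rightarrow> real"
  where "kernel_coeff \<beta> n =
    (if \<beta> = 0 then (if n = 0 then 5 else 1 / real n) else pochhammer \<beta> n / fact n)"

lemma kernel_coeff_pos: "0 \<le> \<beta> \<Longrightarrow> 0 < kernel_coeff \<beta> n"
  by (auto simp: kernel_coeff_def intro!: divide_pos_pos pochhammer_pos)

lemma kernel_sums:
  assumes "norm x < 1"
  shows "(\<lambda>n. of_real (kernel_coeff \<beta> n) * x ^ n) sums kernel_fun \<beta> x"
proof (cases "\<beta> = 0")
  case True
  have "(\<lambda>n. - ((- (- x)) ^ n) / of_nat n) sums Ln (1 + (- x))"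
    using assms by (intro Ln_series') simp
  then have "(\<lambda>n. - (- ((- (- x)) ^ n) / of_nat n)) sums - Ln (1 + (- x))"
    by (rule sums_minus)
  moreover have "(\<lambda>n. if n = 0 then 5 else 0) sums (5 :: complex)"
    using sums_single[of 0 "\<lambda>_. 5::complex"] by (simp cong: if_cong)
  ultimately have "(\<lambda>n. (if n = 0 then 5 else 0) + - (- ((- (- x)) ^ n) / of_nat n)) sums (5 + - Ln (1 + (- x)))"
    by (intro sums_add)
  moreover have "(\<lambda>n. (if n = 0 then 5 else 0) + - (- ((- (- x)) ^ n) / of_nat n))
      = (\<lambda>n. of_real (kernel_coeff \<beta> n) * x ^ n)"
    using True by (auto simp: kernel_coeff_def)
  ultimately show ?thesis using True by (simp add: kernel_fun_def)
next
  case False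
  have "(\<lambda>n. ((- of_real \<beta>) gchoose n) * (- x) ^ n) sums (1 + (- x)) powr (- of_real \<beta>)"
    using assms by (intro gen_binomial_complex) simp
  moreover have "((- of_real \<beta>) gchoose n) * (- x) ^ n = of_real (kernel_coeff \<beta> n) * x ^ n" for n
  proof -
    have "((- of_real \<beta>) gchoose n) = (- 1) ^ n * (of_real (kernel_coeff \<beta> n) :: complex)"
      using False by (simp add: gbinomial_pochhammer kernel_coeff_def pochhammer_of_real[symmetric])
    moreover have "(- x) ^ n = (- 1) ^ n * x ^ n" by (rule power_minus)
    moreover have "((- 1) ^ n * (- 1) ^ n :: complex) = 1" by (simp flip: power_add)
    moreover have "(- 1) ^ n * c * ((- 1) ^ n * x ^ n) = ((- 1) ^ n * (- 1) ^ n) * (c * x ^ n)" for c :: complex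
      by (simp only: mult_ac)
    ultimately show ?thesis by simp
  qed
  ultimately show ?thesis using False by (simp add: kernel_fun_def)
qed

section \<open>Growth of the kernel coefficients\<close>

lemma kernel_coeff_Suc:
  assumes "\<beta> \<noteq> 0"
  shows "kernel_coeff \<beta> (Suc n) = kernel_coeff \<beta> n * (1 - (1 - \<beta>) / real (Suc n))"
  using assms by (simp add: kernel_coeff_def pochhammer_Suc field_simps)

text \<open>The ratio of consecutive coefficients is 1 - (1 - \<beta>) * t with t = 1 / (n + 1). It
  is at most (1 + t) powr (\<beta> - 1) by 1 - u <= exp (- u) and ln (1 + t) <= t, and these powers
  telescope.\<close>

lemma kernel_coeff_upper:
  assumes "0 < \<beta>" "\<beta> \<le> 1"
  shows "kernel_coeff \<beta> n \<le> (real n + 1) powr (- (1 - \<beta>))"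
proof (induction n)
  case 0
  then show ?case using assms by (simp add: kernel_coeff_def)
next
  case (Suc n)
  define t where "t = 1 / (real n + 1)"
  have t: "0 < t" "t \<le> 1" by (auto simp: t_def)
  have "1 - (1 - \<beta>) * t \<le> exp (- ((1 - \<beta>) * t))" using exp_ge_add_one_self[of "- ((1 - \<beta>) * t)"] by simp
  also have "\<dots> \<le> exp (- ((1 - \<beta>) * ln (1 + t)))"
    using t assms ln_add_one_self_le_self[of t] by (auto intro: mult_left_mono)
  also have "\<dots> = (1 + t) powr (- (1 - \<beta>))" using t by (simp add: powr_def algebra_simps)
  finally have step: "1 - (1 - \<beta>) * t \<le> (1 + t) powr (- (1 - \<beta>))" .
  have "kernel_coeff \<beta> (Suc n) = kernel_coeff \<beta> n * (1 - (1 - \<beta>) * t)"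
    using assms by (subst kernel_coeff_Suc) (auto simp: t_def)
  also have "\<dots> \<le> (real n + 1) powr (- (1 - \<beta>)) * (1 + t) powr (- (1 - \<beta>))"
  proof (rule mult_mono[OF Suc.IH step])
    show "0 \<le> 1 - (1 - \<beta>) * t" using t assms mult_le_one[of "1 - \<beta>" t] by simp
  qed auto
  also have "\<dots> = ((real n + 1) * (1 + t)) powr (- (1 - \<beta>))" using t by (subst powr_mult) auto
  also have "(real n + 1) * (1 + t) = real (Suc n) + 1" by (simp add: t_def field_simps)
  finally show ?case .
qed

text \<open>Now the ratio is bounded below by (1 - t) powr (1 - \<beta>), the weighted inequality of
  the means. Telescoping must start at index 1, whose coefficient is \<beta>, since t = 1 would give
  a zero factor.\<close>

lemma kernel_coeff_lower:
  assumes "0 < \<beta>" "\<beta> \<le> 1"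
  shows "\<beta> * (real n + 1) powr (- (1 - \<beta>)) \<le> kernel_coeff \<beta> n"
proof -
  have "\<beta> * real (Suc n) powr (- (1 - \<beta>)) \<le> kernel_coeff \<beta> (Suc n)" for n
  proof (induction n)
    case 0
    then show ?case using assms by (simp add: kernel_coeff_def)
  next
    case (Suc n)
    define t where "t = 1 / real (Suc (Suc n))"
    have t: "0 < t" "t < 1" by (auto simp: t_def)
    have "exp ((1 - (1 - \<beta>)) *\<^sub>R 0 + (1 - \<beta>) *\<^sub>R ln (1 - t)) \<le> (1 - (1 - \<beta>)) * exp 0 + (1 - \<beta>) * exp (ln (1 - t))"
      using assms by (intro convex_onD[OF exp_convex]) auto
    then have step: "(1 - t) powr (1 - \<beta>) \<le> 1 - (1 - \<beta>) * t"
      using t by (simp add: powr_def algebra_simps)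
    have "\<beta> * real (Suc (Suc n)) powr (- (1 - \<beta>))
        = (\<beta> * real (Suc n) powr (- (1 - \<beta>))) * (1 - t) powr (1 - \<beta>)"
    proof -
      have "1 - t = real (Suc n) / real (Suc (Suc n))" by (simp add: t_def field_simps)
      then have "(1 - t) powr (1 - \<beta>) = real (Suc n) powr (1 - \<beta>) / real (Suc (Suc n)) powr (1 - \<beta>)"
        by (simp add: powr_divide)
      moreover have "real (Suc n) powr (1 - \<beta>) \<noteq> 0" by simp
      ultimately show ?thesis by (simp only: powr_minus) (simp add: field_simps)
    qed
    also have "\<dots> \<le> kernel_coeff \<beta> (Suc n) * (1 - (1 - \<beta>) * t)"
      using assms kernel_coeff_pos[of \<beta> "Suc n"] by (intro mult_mono Suc.IH step) auto
    also have "\<dots> = kernel_coeff \<beta> (Suc (Suc n))"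
      using assms by (subst (2) kernel_coeff_Suc) (auto simp: t_def)
    finally show ?case .
  qed
  note * = this
  show ?thesis
  proof (cases n)
    case 0
    then show ?thesis using assms by (simp add: kernel_coeff_def)
  next
    case (Suc k)
    have "\<beta> * (real n + 1) powr (- (1 - \<beta>)) \<le> \<beta> * real n powr (- (1 - \<beta>))"
      using assms Suc by (intro mult_left_mono powr_mono2') auto
    also have "\<dots> \<le> kernel_coeff \<beta> n" using *[of k] Suc by simp
    finally show ?thesis .
  qed
qed

lemma kernel_coeff_bounds:
  assumes "0 \<le> \<beta>" "\<beta> \<le> 1"
  shows "\<exists>C>0. \<forall>n. kernel_coeff \<beta> n \<le> C * (real n + 1) powr (- (1 - \<beta>))
    \<and> (real n + 1) powr (- (1 - \<beta>)) \<le> C * kernel_coeff \<beta> n"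
proof (cases "\<beta> = 0")
  case True
  have "kernel_coeff 0 n \<le> 5 * (1 / (real n + 1)) \<and> 1 / (real n + 1) \<le> 5 * kernel_coeff 0 n" for n
    by (cases "n = 0") (auto simp: kernel_coeff_def field_simps)
  then show ?thesis using True by (intro exI[of _ 5]) (auto simp: powr_minus_divide)
next
  case False
  then have \<beta>: "0 < \<beta>" using assms by simp
  show ?thesis
  proof (intro exI[of _ "1 / \<beta>"] conjI allI)
    fix n
    have "(real n + 1) powr (- (1 - \<beta>)) \<le> 1 / \<beta> * (real n + 1) powr (- (1 - \<beta>))"
      using \<beta> assms by (simp add: field_simps mult_left_le_one_le)
    then show "kernel_coeff \<beta> n \<le> 1 / \<beta> * (real n + 1) powr (- (1 - \<beta>))"
      using kernel_coeff_upper[OF \<beta> assms(2), of n] by linarith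
    show "(real n + 1) powr (- (1 - \<beta>)) \<le> 1 / \<beta> * kernel_coeff \<beta> n"
      using kernel_coeff_lower[OF \<beta> assms(2), of n] \<beta> by (simp add: field_simps)
  qed (use \<beta> in simp)
qed

section \<open>Argument and size of the kernel values\<close>

lemma Re_one_minus_pos: "norm x < 1 \<Longrightarrow> 0 < Re (1 - x)"
  using complex_Re_le_cmod[of x] by simp

lemma norm_one_minus_bounds: "norm (x::complex) < 1 \<Longrightarrow> 0 < norm (1 - x) \<and> norm (1 - x) \<le> 2"
  using norm_triangle_ineq4[of 1 x] by auto

text \<open>As 1 - x lies in the right half-plane, its argument is below pi/2. For \<beta> = 0 the
  kernel has imaginary part at most pi/2 and real part at least 4; for \<beta> > 0 the argument is
  multiplied by \<beta> <= 1/4. Both cases give pi/8.\<close>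

lemma kernel_sector:
  assumes x: "norm x < 1" and \<beta>: "0 \<le> \<beta>" "\<beta> \<le> 1 / 4"
  shows "\<exists>\<theta>. \<bar>\<theta>\<bar> \<le> pi / 8 \<and> kernel_fun \<beta> x = of_real (norm (kernel_fun \<beta> x)) * cis \<theta>"
proof (cases "\<beta> = 0")
  case True
  define k where "k = kernel_fun \<beta> x"
  have nz: "1 - x \<noteq> 0" using Re_one_minus_pos[OF x] by auto
  have Im: "\<bar>Im k\<bar> \<le> pi / 2"
    using Re_Ln_pos_lt_imp[OF Re_one_minus_pos[OF x]] True by (simp add: k_def kernel_fun_def)
  have "Re k = size_fun 0 (norm (1 - x))" using True nz by (simp add: k_def kernel_fun_def size_fun_def)
  then have Re: "4 \<le> Re k" using size_fun_ge norm_one_minus_bounds[OF x] by simp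
  have "\<bar>Arg k\<bar> = \<bar>arctan (Im k / Re k)\<bar>" using Re by (subst arg_conv_arctan) auto
  also have "\<dots> \<le> \<bar>Im k / Re k\<bar>" by (rule abs_arctan_le)
  also have "\<dots> \<le> (pi / 2) / 4" unfolding abs_divide using Im Re by (intro frac_le) auto
  finally have "\<bar>Arg k\<bar> \<le> pi / 8" by simp
  moreover have "k = of_real (norm k) * cis (Arg k)"
    using rcis_cmod_Arg[of k] by (simp add: rcis_def)
  ultimately show ?thesis unfolding k_def by blast
next
  case False
  define u where "u = Ln (1 - x)"
  have nz: "1 - x \<noteq> 0" using Re_one_minus_pos[OF x] by auto
  have u: "\<bar>Im u\<bar> < pi / 2"
    unfolding u_def using Re_Ln_pos_lt_imp[OF Re_one_minus_pos[OF x]] .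
  have k: "kernel_fun \<beta> x = exp (- of_real \<beta> * u)"
    using False nz by (simp add: kernel_fun_def powr_def u_def)
  have "exp (- of_real \<beta> * u) = of_real (exp (Re (- of_real \<beta> * u))) * cis (Im (- of_real \<beta> * u))"
    by (rule exp_eq_polar)
  then have "kernel_fun \<beta> x = of_real (norm (kernel_fun \<beta> x)) * cis (- \<beta> * Im u)"
    by (simp add: k norm_mult)
  moreover have "\<bar>- \<beta> * Im u\<bar> \<le> pi / 8"
  proof -
    have "\<bar>\<beta>\<bar> * \<bar>Im u\<bar> \<le> 1 / 4 * (pi / 2)" using u \<beta> by (intro mult_mono) auto
    then show ?thesis by (simp add: abs_mult)
  qed
  ultimately show ?thesis by blast
qed

lemma kernel_size:
  assumes x: "norm x < 1" and \<beta>: "0 \<le> \<beta>"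
  shows "size_fun \<beta> (norm (1 - x)) \<le> norm (kernel_fun \<beta> x)"
    "norm (kernel_fun \<beta> x) \<le> 2 * size_fun \<beta> (norm (1 - x))"
proof -
  have nz: "1 - x \<noteq> 0" using Re_one_minus_pos[OF x] by auto
  have "size_fun \<beta> (norm (1 - x)) \<le> norm (kernel_fun \<beta> x) \<and> norm (kernel_fun \<beta> x) \<le> 2 * size_fun \<beta> (norm (1 - x))"
  proof (cases "\<beta> = 0")
    case True
    define k where "k = kernel_fun \<beta> x"
    have Im: "\<bar>Im k\<bar> \<le> pi / 2"
      using Re_Ln_pos_lt_imp[OF Re_one_minus_pos[OF x]] True by (simp add: k_def kernel_fun_def)
    have Re: "Re k = size_fun \<beta> (norm (1 - x))" using True nz by (simp add: k_def kernel_fun_def size_fun_def)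
    then have "4 \<le> Re k" using size_fun_ge[OF True] norm_one_minus_bounds[OF x] by simp
    moreover have "Re k \<le> norm k" by (rule complex_Re_le_cmod)
    moreover have "norm k \<le> \<bar>Re k\<bar> + \<bar>Im k\<bar>" by (rule cmod_le)
    ultimately show ?thesis using Im Re pi_less_4 unfolding k_def[symmetric] by linarith
  next
    case False
    have "norm (kernel_fun \<beta> x) = norm (1 - x) powr (- \<beta>)"
      using False by (simp add: kernel_fun_def norm_powr_real_powr')
    then show ?thesis using False by (simp add: size_fun_def)
  qed
  then show "size_fun \<beta> (norm (1 - x)) \<le> norm (kernel_fun \<beta> x)"
    "norm (kernel_fun \<beta> x) \<le> 2 * size_fun \<beta> (norm (1 - x))" by auto
qed

lemma kernel_estimates:
  assumes "0 \<le> \<beta>" "\<beta> \<le> 1 / 4"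
  shows "\<exists>C\<ge>1. (\<forall>n. kernel_coeff \<beta> n \<le> C * (real n + 1) powr (- (1 - \<beta>))
        \<and> (real n + 1) powr (- (1 - \<beta>)) \<le> C * kernel_coeff \<beta> n)
      \<and> (\<forall>x. norm x < 1 \<longrightarrow> scale_sum \<beta> 9 (norm (1 - x)) \<le> C * norm (kernel_fun \<beta> x)
        \<and> norm (kernel_fun \<beta> x) \<le> C * scale_sum \<beta> 1 (norm (1 - x)))"
proof -
  obtain C1 where C1: "C1 > 0" "\<And>n. kernel_coeff \<beta> n \<le> C1 * (real n + 1) powr (- (1 - \<beta>))"
    "\<And>n. (real n + 1) powr (- (1 - \<beta>)) \<le> C1 * kernel_coeff \<beta> n"
    using kernel_coeff_bounds[of \<beta>] assms by auto
  obtain C2 where C2: "C2 > 0" "\<And>y. 0 < y \<Longrightarrow> y \<le> 2 \<Longrightarrow> scale_sum \<beta> 9 y \<le> C2 * size_fun \<beta> y"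
    using scale_sum_le[of \<beta> 9] assms by auto
  obtain C3 where C3: "C3 > 0" "\<And>y. 0 < y \<Longrightarrow> y \<le> 2 \<Longrightarrow> size_fun \<beta> y \<le> C3 * scale_sum \<beta> 1 y"
    using size_fun_le[of \<beta> 1] assms by auto
  define C where "C = max (max 1 C1) (max C2 (2 * C3))"
  have C: "1 \<le> C" "C1 \<le> C" "C2 \<le> C" "2 * C3 \<le> C" by (auto simp: C_def)
  have mono: "u \<le> C' * v \<Longrightarrow> C' \<le> C \<Longrightarrow> 0 \<le> v \<Longrightarrow> u \<le> C * v" for u v C' :: real
    by (meson mult_right_mono order_trans)
  show ?thesis
  proof (intro exI[of _ C] conjI allI impI C(1))
    fix n
    show "kernel_coeff \<beta> n \<le> C * (real n + 1) powr (- (1 - \<beta>))"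
      by (rule mono[OF C1(2) C(2)]) simp
    show "(real n + 1) powr (- (1 - \<beta>)) \<le> C * kernel_coeff \<beta> n"
      by (rule mono[OF C1(3) C(2)]) (simp add: kernel_coeff_pos assms less_imp_le)
  next
    fix x :: complex assume x: "norm x < 1"
    note y = conjunct1[OF norm_one_minus_bounds[OF x]] conjunct2[OF norm_one_minus_bounds[OF x]]
    have "C2 * size_fun \<beta> (norm (1 - x)) \<le> C2 * norm (kernel_fun \<beta> x)"
      using C2(1) kernel_size(1)[OF x assms(1)] by (intro mult_left_mono) auto
    with C2(2)[OF y] have "scale_sum \<beta> 9 (norm (1 - x)) \<le> C2 * norm (kernel_fun \<beta> x)" by linarith
    then show "scale_sum \<beta> 9 (norm (1 - x)) \<le> C * norm (kernel_fun \<beta> x)"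
      by (rule mono[OF _ C(3)]) simp
    have "norm (kernel_fun \<beta> x) \<le> (2 * C3) * scale_sum \<beta> 1 (norm (1 - x))"
      using kernel_size(2)[OF x assms(1)] C3(2)[OF y] by linarith
    then show "norm (kernel_fun \<beta> x) \<le> C * scale_sum \<beta> 1 (norm (1 - x))"
      by (rule mono[OF _ C(4)]) (auto simp: scale_sum_def intro: sum_nonneg)
  qed
qed

lemma norm_mult_cnj_less:
  assumes "norm z < 1" "norm v < 1"
  shows "norm (z * cnj v) < 1"
proof -
  have "norm z * norm v \<le> norm z * 1" using assms by (intro mult_left_mono) auto
  then show ?thesis using assms by (simp add: norm_mult)
qed

lemma finite_scales:
  assumes "norm (x::complex) < 1" "0 < b"
  shows "finite {m::nat. m = 0 \<or> 2 ^ m * norm (1 - x) \<le> b}"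
  using scales_eq_atMost[of "norm (1 - x)" b] norm_one_minus_bounds[OF assms(1)] assms(2)
  by (metis finite_atMost)

subsection \<open>Power series on the polydisc\<close>

text \<open>Orthogonality of characters of the cyclic group: a geometric sum whose ratio is an N-th
  root of unity.\<close>

lemma sum_roots_of_unity:
  assumes N: "0 < N"
  defines "\<zeta> \<equiv> cis (2 * pi / real N)"
  shows "(\<Sum>k<N. (\<zeta> ^ m * cnj \<zeta> ^ n) ^ k) = (if \<zeta> ^ m = \<zeta> ^ n then of_nat N else 0)"
proof -
  have z: "\<zeta> * cnj \<zeta> = 1" by (simp add: \<zeta>_def complex_norm_square[symmetric])
  have zn: "\<zeta> ^ n * cnj \<zeta> ^ n = 1" using z by (simp flip: power_mult_distrib)
  have zN: "\<zeta> ^ N = 1" using N by (simp add: \<zeta>_def Complex.DeMoivre)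
  define u where "u = \<zeta> ^ m * cnj \<zeta> ^ n"
  have uN: "u ^ N = 1"
  proof -
    have "u ^ N = (\<zeta> ^ N) ^ m * cnj ((\<zeta> ^ N) ^ n)"
      by (simp add: u_def power_mult_distrib mult.commute flip: power_mult)
    then show ?thesis by (simp add: zN)
  qed
  show ?thesis
  proof (cases "\<zeta> ^ m = \<zeta> ^ n")
    case True
    then have "u = 1" using zn by (simp add: u_def)
    then show ?thesis unfolding u_def[symmetric] using True by simp
  next
    case False
    have "u \<noteq> 1"
    proof
      assume "u = 1"
      then have "\<zeta> ^ m * (cnj \<zeta> ^ n * \<zeta> ^ n) = \<zeta> ^ n" by (simp add: u_def flip: mult.assoc)
      then show False using zn False by (simp add: mult.commute)
    qed
    then show ?thesis unfolding u_def[symmetric] using False uN by (simp add: geometric_sum)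
  qed
qed

lemma root_powers_distinct:
  assumes "m < N" "n < N" "cis (2 * pi / real N) ^ m = cis (2 * pi / real N) ^ n"
  shows "m = n"
proof -
  have "inj_on (\<lambda>k. cis (2 * pi * real k / real N)) {..<N}"
    using Complex.bij_betw_roots_unity[of N] assms(1) by (simp add: bij_betw_def)
  moreover have "cis (2 * pi * real m / real N) = cis (2 * pi * real n / real N)"
    using assms(3) by (simp add: Complex.DeMoivre mult.commute)
  ultimately show ?thesis using assms(1,2) by (auto dest: inj_onD)
qed

lemma has_sum_sum:
  fixes f :: "'k \<Rightarrow> 'a \<Rightarrow> 'b::topological_comm_monoid_add"
  assumes "finite K" "\<And>k. k \<in> K \<Longrightarrow> (f k has_sum s k) A"
  shows "((\<lambda>x. \<Sum>k\<in>K. f k x) has_sum (\<Sum>k\<in>K. s k)) A"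
  using assms by (induction K rule: finite_induct) (auto intro: has_sum_add)

text \<open>Averaging the series over a grid of \<open>N\<close>-th roots of unity retains only the
  coefficients whose index is congruent to a given one modulo \<open>N\<close>.\<close>

lemma power_series_zero:
  fixes c :: "('d::finite \<Rightarrow> nat) \<Rightarrow> complex"
  assumes "has_power_series (\<lambda>_. 0) c"
  shows "c n = 0"
proof -
  have series: "((\<lambda>m. c m * monomial m z) has_sum 0) UNIV" if "z \<in> polydisc" for z
    using assms that unfolding has_power_series_def by blast
  define t where "t m = norm (c m) * (\<Prod>j\<in>UNIV. (1 / 2) ^ m j)" for m
  define z0 :: "complex ^ 'd" where "z0 = (\<chi> j. 1 / 2)"
  have "z0 \<in> polydisc" by (simp add: z0_def polydisc_def)
  then have "(\<lambda>m. c m * monomial m z0) summable_on UNIV"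
    using series has_sum_imp_summable by blast
  then have "(\<lambda>m. norm (c m * monomial m z0)) summable_on UNIV"
    by (simp only: summable_on_iff_abs_summable_on_complex)
  moreover have tz: "norm (c m * monomial m z0) = t m" for m
    by (simp add: t_def z0_def monomial_def norm_mult norm_divide norm_power prod_norm[symmetric])
  ultimately obtain S where S: "(t has_sum S) UNIV" by (auto simp: summable_on_def)
  have t0: "0 \<le> t m" for m by (auto simp: t_def intro!: mult_nonneg_nonneg prod_nonneg)
  have "t n \<le> e" if e: "0 < e" for e
  proof -
    obtain F0 where F0: "finite F0" "dist (sum t F0) S \<le> e / 2"
      using has_sum_finite_approximation[OF S, of "e / 2"] e by auto
    define F where "F = insert n F0"
    have F: "finite F" "n \<in> F" using F0 by (auto simp: F_def)
    have "sum t F0 \<le> sum t F" using F t0 by (intro sum_mono2) (auto simp: F_def)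
    then have SF: "S - e / 2 \<le> sum t F" using F0(2) by (auto simp: dist_real_def abs_if split: if_splits)
    \<comment> \<open>N exceeds every index occurring in F, so within F congruence modulo N in all
      coordinates means equality.\<close>
    define N where "N = Suc (Max ((\<lambda>(m, j). m j) ` (F \<times> UNIV)))"
    have N: "m j < N" if "m \<in> F" for m j
      unfolding N_def less_Suc_eq_le using F that by (intro Max_ge) auto
    have N0: "0 < N" by (simp add: N_def)
    define \<zeta> where "\<zeta> = cis (2 * pi / real N)"
    define K where "K = PiE (UNIV :: 'd set) (\<lambda>_. {..<N})"
    define z :: "('d \<Rightarrow> nat) \<Rightarrow> complex ^ 'd" where "z k = (\<chi> j. \<zeta> ^ k j / 2)" for k
    define g where "g m = (if \<forall>j. \<zeta> ^ m j = \<zeta> ^ n j then c m * monomial m z0 else 0)" for m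
    have finK: "finite K" unfolding K_def by (rule finite_PiE) auto
    have zP: "z k \<in> polydisc" for k
      by (simp add: z_def polydisc_def norm_divide norm_power \<zeta>_def)
    have "((\<lambda>m. \<Sum>k\<in>K. (\<Prod>j\<in>UNIV. (cnj \<zeta> ^ n j) ^ k j) * (c m * monomial m (z k))) has_sum (\<Sum>k\<in>K. (\<Prod>j\<in>UNIV. (cnj \<zeta> ^ n j) ^ k j) * 0)) UNIV"
      by (intro has_sum_sum has_sum_cmult_right series zP finK)
    moreover have "(\<Sum>k\<in>K. (\<Prod>j\<in>UNIV. (cnj \<zeta> ^ n j) ^ k j) * (c m * monomial m (z k))) = of_nat N ^ CARD('d) * g m" for m
    proof -
      have "(\<Prod>j\<in>UNIV. (cnj \<zeta> ^ n j) ^ k j) * (c m * monomial m (z k))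
          = (c m * monomial m z0) * (\<Prod>j\<in>UNIV. (\<zeta> ^ m j * cnj \<zeta> ^ n j) ^ k j)" for k
      proof -
        have "(\<zeta> ^ k j / 2) ^ m j = (1 / 2) ^ m j * (\<zeta> ^ m j) ^ k j" for j
          by (simp add: power_divide mult.commute flip: power_mult)
        then have "monomial m (z k) = monomial m z0 * (\<Prod>j\<in>UNIV. (\<zeta> ^ m j) ^ k j)"
          by (simp add: monomial_def z_def z0_def prod.distrib)
        then show ?thesis by (simp add: power_mult_distrib prod.distrib mult_ac)
      qed
      then have "(\<Sum>k\<in>K. (\<Prod>j\<in>UNIV. (cnj \<zeta> ^ n j) ^ k j) * (c m * monomial m (z k)))
          = (c m * monomial m z0) * (\<Sum>k\<in>K. \<Prod>j\<in>UNIV. (\<zeta> ^ m j * cnj \<zeta> ^ n j) ^ k j)"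
        by (simp only: sum_distrib_left)
      also have "(\<Sum>k\<in>K. \<Prod>j\<in>UNIV. (\<zeta> ^ m j * cnj \<zeta> ^ n j) ^ k j)
          = (\<Prod>j\<in>UNIV. \<Sum>k<N. (\<zeta> ^ m j * cnj \<zeta> ^ n j) ^ k)"
        unfolding K_def by (rule prod_sum_PiE[symmetric]) auto
      also have "\<dots> = (\<Prod>j\<in>UNIV. if \<zeta> ^ m j = \<zeta> ^ n j then of_nat N else 0)"
        unfolding \<zeta>_def by (intro prod.cong refl sum_roots_of_unity N0)
      also have "\<dots> = (if \<forall>j. \<zeta> ^ m j = \<zeta> ^ n j then of_nat N ^ CARD('d) else 0)"
        by auto
      finally show ?thesis by (simp add: g_def)
    qed
    ultimately have "((\<lambda>m. of_nat N ^ CARD('d) * g m) has_sum 0) UNIV" by simp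
    then have "((\<lambda>m. of_nat N ^ CARD('d) * g m) has_sum (of_nat N ^ CARD('d) * 0)) UNIV" by simp
    then have g: "(g has_sum 0) UNIV"
      using N0 by (subst (asm) has_sum_cmult_right_iff) auto
    then have "(sum g \<longlongrightarrow> 0) (finite_subsets_at_top UNIV)" by (simp add: has_sum_def)
    then have "\<forall>\<^sub>F G in finite_subsets_at_top UNIV. dist (sum g G) 0 < e / 2"
      using e by (intro tendstoD) auto
    moreover have "\<forall>\<^sub>F G in finite_subsets_at_top UNIV. finite G \<and> F \<subseteq> G"
      using F by (auto simp: eventually_finite_subsets_at_top)
    ultimately have "\<forall>\<^sub>F G in finite_subsets_at_top UNIV. dist (sum g G) 0 < e / 2 \<and> finite G \<and> F \<subseteq> G"
      by (rule eventually_conj)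
    then obtain G where G: "norm (sum g G) < e / 2" "finite G" "F \<subseteq> G"
      using eventually_happens finite_subsets_at_top_neq_bot by fastforce
    have gF: "g m = 0" if "m \<in> F" "m \<noteq> n" for m
    proof -
      have "\<exists>j. \<zeta> ^ m j \<noteq> \<zeta> ^ n j"
      proof (rule ccontr)
        assume "\<not> (\<exists>j. \<zeta> ^ m j \<noteq> \<zeta> ^ n j)"
        then have "m j = n j" for j
          using root_powers_distinct[of "m j" N "n j"] N that(1) F(2) by (simp add: \<zeta>_def)
        then show False using that(2) by auto
      qed
      then show ?thesis by (auto simp: g_def)
    qed
    \<comment> \<open>Inside F only the term g n survives. The full sum is below e / 2, and the part
      outside F is at most S minus the sum of t over F, again at most e / 2.\<close>
    have "sum g G = sum g F + sum g (G - F)" using G by (metis add.commute sum.subset_diff)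
    also have "sum g F = g n" using F gF by (simp add: sum.remove[of F n])
    finally have "norm (g n) \<le> norm (sum g G) + norm (sum g (G - F))"
      by (metis add_diff_cancel_right' norm_triangle_ineq4)
    also have "norm (sum g (G - F)) \<le> sum t (G - F)"
      by (rule sum_norm_le) (use t0 in \<open>auto simp: g_def tz\<close>)
    also have "\<dots> = sum t G - sum t F" using G F by (simp add: sum_diff)
    also have "sum t G \<le> S" using finite_sum_le_has_sum[OF S G(2)] t0 by auto
    finally have "norm (g n) \<le> e" using G(1) SF by linarith
    moreover have "norm (g n) = t n" by (simp add: g_def tz)
    ultimately show ?thesis by simp
  qed
  then have "t n \<le> 0" by (rule field_le_epsilon[of _ 0, simplified])
  then show ?thesis using t0[of n] by (auto simp: t_def)
qed

lemma power_series_unique: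
  fixes f :: "complex ^ 'd::finite \<Rightarrow> complex"
  assumes "has_power_series f a" "has_power_series f b"
  shows "a = b"
proof
  fix n
  have "has_power_series (\<lambda>_. 0) (\<lambda>n. a n - b n)"
    unfolding has_power_series_def
  proof
    fix z :: "complex ^ 'd" assume "z \<in> polydisc"
    then have "((\<lambda>n. a n * monomial n z + - (b n * monomial n z)) has_sum (f z + - f z)) UNIV"
      using assms unfolding has_power_series_def by (intro has_sum_add has_sum_uminusI) auto
    then show "((\<lambda>n. (a n - b n) * monomial n z) has_sum 0) UNIV" by (simp add: left_diff_distrib)
  qed
  from power_series_zero[OF this, of n] show "a n = b n" by simp
qed

lemma taylor_coeff_eq: "has_power_series f a \<Longrightarrow> taylor_coeff f = a"
  unfolding taylor_coeff_def by (rule the_equality) (auto dest: power_series_unique)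

lemma has_power_series_taylor_coeff: "analytic_on_polydisc f \<Longrightarrow> has_power_series f (taylor_coeff f)"
  unfolding analytic_on_polydisc_def using taylor_coeff_eq by metis

text \<open>Cubes of multi-indices serve two purposes: truncated kernels factor over the
  coordinates, and the cubes are cofinal among finite sets, so an unconditional sum becomes the
  limit of a sequence.\<close>

definition index_box :: "nat \<Rightarrow> ('d::finite \<Rightarrow> nat) set"
  where "index_box L = PiE UNIV (\<lambda>_. {..<L})"

lemma finite_index_box [simp]: "finite (index_box L)"
  unfolding index_box_def by (rule finite_PiE) auto

lemma mem_index_box: "n \<in> index_box L \<longleftrightarrow> (\<forall>j. n j < L)"
  by (auto simp: index_box_def PiE_iff)

lemma filterlim_index_box:
  "filterlim (index_box :: nat \<Rightarrow> ('d::finite \<Rightarrow> nat) set) (finite_subsets_at_top UNIV) sequentially"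
  unfolding filterlim_finite_subsets_at_top
proof (intro allI impI)
  fix X :: "('d \<Rightarrow> nat) set" assume X: "finite X \<and> X \<subseteq> UNIV"
  define M where "M = Suc (Max (insert 0 ((\<lambda>(n, j). n j) ` (X \<times> UNIV))))"
  have "n j < M" if "n \<in> X" for n j
    unfolding M_def less_Suc_eq_le using X that by (intro Max_ge) auto
  then have "X \<subseteq> index_box L" if "M \<le> L" for L
    using that unfolding subset_iff mem_index_box by (meson less_le_trans)
  then show "\<forall>\<^sub>F L in sequentially. finite (index_box L) \<and> X \<subseteq> index_box L \<and> index_box L \<subseteq> UNIV"
    by (intro eventually_sequentiallyI[of M]) auto
qed

lemma polynomial_in_H_space:
  fixes a :: "('d::finite \<Rightarrow> nat) \<Rightarrow> complex"
  assumes F: "finite F"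
  defines "f \<equiv> \<lambda>z. \<Sum>n\<in>F. a n * monomial n z"
  shows "f \<in> H_space s"
    "H_norm_sq s f = (\<Sum>n\<in>F. (norm (a n))\<^sup>2 * (\<Prod>j\<in>UNIV. (real (n j) + 1) powr (s $ j)))"
proof -
  define b where "b n = (if n \<in> F then a n else 0)" for n
  have series: "has_power_series f b"
    unfolding has_power_series_def
  proof
    fix z :: "complex ^ 'd"
    show "((\<lambda>n. b n * monomial n z) has_sum f z) UNIV"
      by (rule has_sum_finite_neutralI[of F]) (use F in \<open>auto simp: b_def f_def\<close>)
  qed
  then have b: "taylor_coeff f = b" by (rule taylor_coeff_eq)
  have sum: "(H_term s f has_sum (\<Sum>n\<in>F. (norm (a n))\<^sup>2 * (\<Prod>j\<in>UNIV. (real (n j) + 1) powr (s $ j)))) UNIV"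
    by (rule has_sum_finite_neutralI[of F]) (use F in \<open>auto simp: b b_def H_term_def\<close>)
  show "f \<in> H_space s"
    using series sum by (auto simp: H_space_def analytic_on_polydisc_def dest: has_sum_imp_summable)
  show "H_norm_sq s f = (\<Sum>n\<in>F. (norm (a n))\<^sup>2 * (\<Prod>j\<in>UNIV. (real (n j) + 1) powr (s $ j)))"
    unfolding H_norm_sq_def by (rule infsumI[OF sum])
qed

lemma H_term_nonneg: "0 \<le> H_term s f n"
  by (auto simp: H_term_def intro!: mult_nonneg_nonneg prod_nonneg)

lemma sum_H_term_le: "f \<in> H_space s \<Longrightarrow> finite F \<Longrightarrow> (\<Sum>n\<in>F. H_term s f n) \<le> H_norm_sq s f"
  unfolding H_norm_sq_def H_space_def by (intro finite_sum_le_infsum) (auto simp: H_term_nonneg)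

lemma taylor_partial_sums_tendsto:
  assumes "f \<in> H_space s" "z \<in> polydisc"
  shows "(\<lambda>L. \<Sum>n\<in>index_box L. taylor_coeff f n * monomial n z) \<longlonglongrightarrow> f z"
proof -
  have "((\<lambda>n. taylor_coeff f n * monomial n z) has_sum f z) UNIV"
    using has_power_series_taylor_coeff[of f] assms by (auto simp: H_space_def has_power_series_def)
  then show ?thesis
    unfolding has_sum_def using filterlim_index_box by (rule filterlim_compose)
qed

subsection \<open>Measures on the polydisc and the finite tree\<close>

lemma space_polydisc_measure:
  assumes "finite_borel_measure_on_polydisc \<nu>"
  shows "space \<nu> = polydisc"
proof -
  have "sets \<nu> = sets (restrict_space borel polydisc)"
    using assms by (simp add: finite_borel_measure_on_polydisc_def)
  from sets_eq_imp_space_eq[OF this] show ?thesis by (simp add: space_restrict_space)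
qed

text \<open>The points outside the support are covered by open null sets. By the Lindelof property
  countably many of them suffice, so their union is null.\<close>

lemma AE_in_smaller_polydisc:
  fixes \<nu> :: "(complex ^ 'd::finite) measure"
  assumes \<nu>: "finite_borel_measure_on_polydisc \<nu>" and r: "0 < r"
    and supp: "measure_supp \<nu> \<subseteq> (\<lambda>z. r *\<^sub>R z) ` polydisc"
  shows "AE z in \<nu>. \<forall>j. norm (z $ j) < r"
proof -
  have sp: "space \<nu> = polydisc" by (rule space_polydisc_measure[OF \<nu>])
  have sets: "U \<inter> space \<nu> \<in> sets \<nu>" if "open U" for U
  proof -
    have "sets \<nu> = sets (restrict_space borel polydisc)"
      using \<nu> by (simp add: finite_borel_measure_on_polydisc_def)
    then show ?thesis using that sp by (auto simp: sets_restrict_space)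
  qed
  define F where "F = {U. open U \<and> emeasure \<nu> (U \<inter> space \<nu>) = 0}"
  have "\<And>S. S \<in> F \<Longrightarrow> open S" by (simp add: F_def)
  then obtain F' where F': "F' \<subseteq> F" "countable F'" "\<Union>F' = \<Union>F" by (rule Lindelof)
  have "(\<Union>U\<in>F'. U \<inter> space \<nu>) \<in> null_sets \<nu>"
    using F' sets by (intro null_sets_UN') (auto simp: F_def null_sets_def)
  moreover have "{z \<in> space \<nu>. \<not> (\<forall>j. norm (z $ j) < r)} \<subseteq> (\<Union>U\<in>F'. U \<inter> space \<nu>)"
  proof
    fix z assume z: "z \<in> {z \<in> space \<nu>. \<not> (\<forall>j. norm (z $ j) < r)}"
    have "z \<notin> measure_supp \<nu>"
    proof
      assume "z \<in> measure_supp \<nu>"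
      then obtain y where "y \<in> polydisc" "z = r *\<^sub>R y" using supp by blast
      then have "\<forall>j. norm (z $ j) < r" using r by (auto simp: polydisc_def)
      then show False using z by blast
    qed
    then have "z \<in> \<Union>F" using z by (auto simp: measure_supp_def F_def)
    then show "z \<in> (\<Union>U\<in>F'. U \<inter> space \<nu>)" using F'(3) z by auto
  qed
  ultimately show ?thesis by (rule AE_I')
qed

lemma integral_square_le:
  fixes f g :: "'a \<Rightarrow> real"
  assumes "integrable M (\<lambda>z. (f z)\<^sup>2)" "integrable M (\<lambda>z. (g z)\<^sup>2)" "integrable M (\<lambda>z. f z * g z)"
  shows "(\<integral>z. f z * g z \<partial>M)\<^sup>2 \<le> (\<integral>z. (f z)\<^sup>2 \<partial>M) * (\<integral>z. (g z)\<^sup>2 \<partial>M)"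
proof -
  define a b c where "a = (\<integral>z. (f z)\<^sup>2 \<partial>M)" and "b = (\<integral>z. f z * g z \<partial>M)" and "c = (\<integral>z. (g z)\<^sup>2 \<partial>M)"
  have a0: "0 \<le> a" and c0: "0 \<le> c" by (auto simp: a_def c_def)
  have q: "0 \<le> x\<^sup>2 * a - 2 * x * y * b + y\<^sup>2 * c" for x y
  proof -
    have "0 \<le> (\<integral>z. (x * f z - y * g z)\<^sup>2 \<partial>M)" by simp
    also have "\<dots> = (\<integral>z. x\<^sup>2 * (f z)\<^sup>2 - 2 * x * y * (f z * g z) + y\<^sup>2 * (g z)\<^sup>2 \<partial>M)"
      by (rule Bochner_Integration.integral_cong) (auto simp: power2_eq_square algebra_simps)
    also have "\<dots> = x\<^sup>2 * a - 2 * x * y * b + y\<^sup>2 * c"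
      unfolding a_def b_def c_def using assms by simp
    finally show ?thesis .
  qed
  have "b\<^sup>2 \<le> a * c"
  proof (cases "a = 0")
    case True
    have "b = 0"
    proof (rule ccontr)
      assume "b \<noteq> 0"
      \<comment> \<open>With a = 0 the form is affine in x, and this choice of x makes it
        -1.\<close>
      have "0 \<le> c - 2 * ((c + 1) / (2 * b)) * b"
        using q[of "(c + 1) / (2 * b)" 1] True by simp
      then show False using \<open>b \<noteq> 0\<close> by simp
    qed
    then show ?thesis using True by simp
  next
    case False
    have "0 \<le> a * (a * c - b\<^sup>2)" using q[of b a] by (simp add: power2_eq_square algebra_simps)
    then show ?thesis using False a0 by (simp add: zero_le_mult_iff)
  qed
  then show ?thesis by (simp add: a_def b_def c_def)
qed

text \<open>Since \<open>\<nu>\<close> is carried by \<open>{z. \<forall>j. norm (z $ j) < r}\<close>, the tents over arcs of generation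
  greater than \<open>M\<close> are null sets, which leaves a finite tree.\<close>

locale carleson =
  fixes D :: "'d::finite \<Rightarrow> nat \<Rightarrow> complex set set" and s :: "real ^ 'd" and r :: real
    and \<nu> :: "(complex ^ 'd) measure" and M :: nat
  assumes D: "\<And>j. dyadic_lattice (D j)" and r: "0 < r" "r < 1"
    and \<nu>: "finite_borel_measure_on_polydisc \<nu>"
    and supp: "measure_supp \<nu> \<subseteq> (\<lambda>z. r *\<^sub>R z) ` polydisc"
    and s: "\<And>j. s $ j \<in> {3 / 4..1}" and M: "1 / 2 ^ M \<le> 1 - r" and card: "CARD('d) \<le> 3"
begin

sublocale L: lattice "D j" for j
  by unfold_locales (rule D)

sublocale finite_measure \<nu>
  using \<nu> by (simp add: finite_borel_measure_on_polydisc_def)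

definition T :: "'d \<Rightarrow> complex set set"
  where "T j = (\<Union>m\<in>{..M}. D j m)"

definition wt :: "'d \<Rightarrow> complex set \<Rightarrow> real"
  where "wt j I = 2 powr (real (generation (D j) I) * (1 - s $ j))"

lemma T_D: "I \<in> T j \<Longrightarrow> \<exists>m\<le>M. I \<in> D j m"
  by (auto simp: T_def)

lemma arcs_chain:
  assumes "I \<in> D j m" "J \<in> D j m'" "K \<in> D j k" "K \<subseteq> I" "K \<subseteq> J"
  shows "I \<subseteq> J \<or> J \<subseteq> I"
proof -
  obtain u where "u \<in> K" using L.nonempty[OF assms(3)] by blast
  then have u: "u \<in> I" "u \<in> J" using assms by auto
  show ?thesis
  proof (cases "m \<le> m'")
    case True
    then show ?thesis using L.nested[OF assms(1,2) True u] by simp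
  next
    case False
    then show ?thesis using L.nested[OF assms(2,1) _ u(2,1)] by simp
  qed
qed

sublocale multi_tree T wt
proof
  show "finite (T j)" for j unfolding T_def by (intro finite_UN_I L.finite_D) auto
  show "0 < wt j x" for j x by (simp add: wt_def)
  show "y \<le> z \<or> z \<le> y" if xyz: "x \<in> T j" "y \<in> T j" "z \<in> T j" "x \<le> y" "x \<le> z" for x y z j
  proof -
    obtain m m' k where *: "x \<in> D j m" "y \<in> D j m'" "z \<in> D j k"
      using T_D[OF xyz(1)] T_D[OF xyz(2)] T_D[OF xyz(3)] by blast
    show ?thesis by (rule arcs_chain[OF *(2,3,1) xyz(4,5)])
  qed
qed

lemma rect_weight_eq: "rect_weight D s R = W R"
  by (simp add: rect_weight_def W_def wt_def)

lemma P_subset_rectangles: "P \<subseteq> dyadic_rectangles D"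
  by (auto simp: P_def dyadic_rectangles_def T_def)

lemma space_\<nu>: "space \<nu> = polydisc"
  by (rule space_polydisc_measure[OF \<nu>])

lemma AE_r: "AE z in \<nu>. \<forall>j. norm (z $ j) < r"
  by (rule AE_in_smaller_polydisc[OF \<nu> r(1) supp])

lemma measurable_\<nu>:
  assumes "f \<in> measurable borel N"
  shows "f \<in> measurable \<nu> N"
proof -
  have "sets \<nu> = sets (restrict_space borel polydisc)"
    using \<nu> by (simp add: finite_borel_measure_on_polydisc_def)
  then have "measurable \<nu> N = measurable (restrict_space borel polydisc) N"
    by (rule measurable_cong_sets) simp
  then show ?thesis using measurable_restrict_space1[OF assms, of polydisc] by simp
qed

lemma measurable_monomial [measurable]: "monomial n \<in> borel_measurable \<nu>"
  unfolding monomial_def[abs_def]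
  by (intro measurable_\<nu> borel_measurable_continuous_onI continuous_intros)

lemma pred_tent [measurable]:
  assumes "I \<in> D j m"
  shows "Measurable.pred \<nu> (\<lambda>z. z $ j \<in> tent (D j) I)"
proof -
  note [measurable] = L.tent_borel[OF assms]
  have "(\<lambda>z::complex ^ 'd. z $ j) \<in> borel_measurable borel"
    by (intro borel_measurable_continuous_onI continuous_intros)
  then have [measurable]: "(\<lambda>z. z $ j) \<in> borel_measurable \<nu>" by (rule measurable_\<nu>)
  show ?thesis by measurable
qed

lemma rect_tent_subset: "R \<in> dyadic_rectangles D \<Longrightarrow> rect_tent D R \<subseteq> polydisc"
proof
  fix z assume R: "R \<in> dyadic_rectangles D" and z: "z \<in> rect_tent D R"
  have "norm (z $ j) < 1" for j
  proof -
    obtain m where "R j \<in> D j m" using R by (auto simp: dyadic_rectangles_def)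
    then show ?thesis using L.tent_subset_ball[of "R j" j m] z by (auto simp: rect_tent_def box_prod_def)
  qed
  then show "z \<in> polydisc" by (simp add: polydisc_def)
qed

lemma rect_tent_sets [measurable]:
  assumes R: "R \<in> dyadic_rectangles D"
  shows "rect_tent D R \<in> sets \<nu>"
proof -
  have [measurable]: "Measurable.pred \<nu> (\<lambda>z. z $ j \<in> tent (D j) (R j))" for j
  proof -
    obtain m where "R j \<in> D j m" using R by (auto simp: dyadic_rectangles_def)
    then show ?thesis by (rule pred_tent)
  qed
  have "rect_tent D R = {z \<in> space \<nu>. \<forall>j\<in>UNIV. z $ j \<in> tent (D j) (R j)}"
    using rect_tent_subset[OF R] by (auto simp: rect_tent_def box_prod_def space_\<nu>)
  also have "\<dots> \<in> sets \<nu>" by measurable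
  finally show ?thesis .
qed

lemma rect_tent_sets_P: "R \<in> P \<Longrightarrow> rect_tent D R \<in> sets \<nu>"
  using P_subset_rectangles by (blast intro: rect_tent_sets)

lemma rect_tent_mono:
  assumes "R \<in> dyadic_rectangles D" "Q \<in> dyadic_rectangles D" "R \<le> Q"
  shows "rect_tent D R \<subseteq> rect_tent D Q"
proof -
  have "tent (D j) (R j) \<subseteq> tent (D j) (Q j)" for j
  proof -
    obtain m m' where "R j \<in> D j m" "Q j \<in> D j m'" using assms unfolding dyadic_rectangles_def by blast
    then show ?thesis using L.tent_mono assms(3) by (auto simp: le_fun_def)
  qed
  then show ?thesis by (auto simp: rect_tent_def box_prod_def)
qed

lemma rect_tent_null:
  assumes R: "R \<in> dyadic_rectangles D" "R \<notin> P"
  shows "emeasure \<nu> (rect_tent D R) = 0"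
proof -
  obtain j where j: "R j \<notin> T j" using R(2) by (auto simp: P_def)
  obtain m where m: "R j \<in> D j m" using R(1) by (auto simp: dyadic_rectangles_def)
  then have "M < m" using j by (auto simp: T_def not_le[symmetric])
  then have "(1::real) / 2 ^ m \<le> 1 / 2 ^ M" by (intro divide_left_mono power_increasing) auto
  then have "1 / 2 ^ m \<le> 1 - r" using M by linarith
  then have "z \<notin> rect_tent D R" if "\<forall>j. norm (z $ j) < r" for z
    using L.mem_tent_iff[OF m, of "z $ j"] that[rule_format, of j] \<open>M < m\<close>
    by (auto simp: rect_tent_def box_prod_def)
  then have "AE z in \<nu>. z \<notin> rect_tent D R" using AE_r by auto
  then show ?thesis using AE_iff_null_sets[OF rect_tent_sets[OF R(1)]] by blast
qed

text \<open>The cell of \<open>R\<close> consists of the points for which \<open>R\<close> is the least node whose tent contains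
  them.\<close>

definition cell :: "('d \<Rightarrow> complex set) \<Rightarrow> (complex ^ 'd) set"
  where "cell R = {z \<in> space \<nu>. \<forall>j. \<forall>I\<in>T j. z $ j \<in> tent (D j) I \<longleftrightarrow> R j \<subseteq> I}"

lemma cell_sets [measurable]: "cell R \<in> sets \<nu>"
proof -
  have [measurable]: "Measurable.pred \<nu> (\<lambda>z. z $ j \<in> tent (D j) I)" if "I \<in> T j" for I j
    using T_D[OF that] pred_tent by blast
  have "cell R = {z \<in> space \<nu>. \<forall>j\<in>UNIV. \<forall>I\<in>T j. z $ j \<in> tent (D j) I \<longleftrightarrow> R j \<subseteq> I}"
    by (auto simp: cell_def)
  also have "\<dots> \<in> sets \<nu>"
    by (intro predE pred_intros_finite finite_T finite_UNIV pred_intros_logic)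
       (use \<open>\<And>j I. I \<in> T j \<Longrightarrow> Measurable.pred \<nu> (\<lambda>z. z $ j \<in> tent (D j) I)\<close> in auto)
  finally show ?thesis .
qed

lemma cell_tent_iff: "z \<in> cell R \<Longrightarrow> Q \<in> P \<Longrightarrow> z \<in> rect_tent D Q \<longleftrightarrow> R \<le> Q"
  by (auto simp: cell_def P_def rect_tent_def box_prod_def le_fun_def)

text \<open>In each coordinate the arcs whose tents contain the point form a finite chain, nonempty
  because of the full circle. A minimal element of it is therefore least, and its larger arcs have
  tents containing the point by \<open>L.tent_mono\<close>.\<close>

lemma cell_exists:
  assumes z: "z \<in> space \<nu>"
  shows "\<exists>R\<in>P. z \<in> cell R"
proof -
  have "\<exists>K\<in>T j. \<forall>I\<in>T j. z $ j \<in> tent (D j) I \<longleftrightarrow> K \<subseteq> I" for j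
  proof -
    let ?A = "{I \<in> T j. z $ j \<in> tent (D j) I}"
    have "sphere 0 1 \<in> ?A"
      using z by (auto simp: T_def L.D_0 tent_def space_\<nu> polydisc_def intro!: bexI[of _ 0])
    then obtain K where K: "K \<in> ?A" "\<And>I. I \<in> ?A \<Longrightarrow> I \<subseteq> K \<Longrightarrow> I = K"
      using finite_has_minimal[of ?A] by auto
    have "z $ j \<in> tent (D j) I \<longleftrightarrow> K \<subseteq> I" if I: "I \<in> T j" for I
    proof -
      obtain m m' where m: "K \<in> D j m" "I \<in> D j m'" using T_D[of K j] T_D[OF I] K(1) by blast
      show ?thesis
      proof
        assume zI: "z $ j \<in> tent (D j) I"
        then have "K \<subseteq> I \<or> I \<subseteq> K" using L.tents_chain[OF m] K(1) by blast
        then show "K \<subseteq> I" using K(2)[of I] I zI by blast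
      next
        assume "K \<subseteq> I"
        then show "z $ j \<in> tent (D j) I" using L.tent_mono[OF m(2,1)] K(1) by blast
      qed
    qed
    then show ?thesis using K(1) by blast
  qed
  then obtain R where R: "\<And>j. R j \<in> T j" "\<And>j. \<forall>I\<in>T j. z $ j \<in> tent (D j) I \<longleftrightarrow> R j \<subseteq> I"
    by metis
  then show ?thesis using z by (intro bexI[of _ R]) (auto simp: cell_def P_def)
qed

lemma cell_unique:
  assumes "z \<in> cell R" "z \<in> cell R'" "R \<in> P" "R' \<in> P"
  shows "R = R'"
proof (rule order_antisym)
  show "R \<le> R'" using cell_tent_iff[OF assms(1,4)] cell_tent_iff[OF assms(2,4)] by simp
  show "R' \<le> R" using cell_tent_iff[OF assms(2,3)] cell_tent_iff[OF assms(1,3)] by simp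
qed

lemma sum_cell_indicators:
  assumes "z \<in> space \<nu>"
  shows "(\<Sum>R\<in>P. indicator (cell R) z * f R) = (f (THE R. R \<in> P \<and> z \<in> cell R) :: real)"
proof -
  obtain R where R: "R \<in> P" "z \<in> cell R" using cell_exists[OF assms] by blast
  then have the: "(THE R. R \<in> P \<and> z \<in> cell R) = R" using cell_unique by blast
  have "(\<Sum>R'\<in>P. indicator (cell R') z * f R') = (\<Sum>R'\<in>P. if R' = R then f R else 0)"
    using R cell_unique by (intro sum.cong) (auto simp: indicator_def)
  then show ?thesis using R(1) finite_P by (simp add: the)
qed

lemma integrable_bounded:
  fixes f :: "complex ^ 'd \<Rightarrow> 'b::{banach, second_countable_topology}"
  assumes "f \<in> borel_measurable \<nu>" "\<And>z. z \<in> space \<nu> \<Longrightarrow> norm (f z) \<le> B"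
  shows "integrable \<nu> f"
  using assms by (intro integrable_const_bound[of _ B]) auto

text \<open>The cells partition the polydisc, and the tent over Q is the union of the cells of the
  nodes below Q. This turns integrals over tents into the discrete dual Hardy transform.\<close>

lemma dual_Hardy_cells:
  fixes h :: "complex ^ 'd \<Rightarrow> real"
  assumes h [measurable]: "integrable \<nu> h" and Q: "Q \<in> P"
  shows "dual_Hardy (\<lambda>R. \<integral>z. indicator (cell R) z * h z \<partial>\<nu>) Q = (\<integral>z. indicator (rect_tent D Q) z * h z \<partial>\<nu>)"
proof -
  have int: "integrable \<nu> (\<lambda>z. indicator (cell R) z * h z)" for R
    using integrable_real_mult_indicator[OF cell_sets h] by (simp add: mult.commute)
  have "dual_Hardy (\<lambda>R. \<integral>z. indicator (cell R) z * h z \<partial>\<nu>) Q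
      = (\<integral>z. (\<Sum>R\<in>{R\<in>P. R \<le> Q}. indicator (cell R) z * h z) \<partial>\<nu>)"
    unfolding dual_Hardy_def by (rule Bochner_Integration.integral_sum[symmetric]) (rule int)
  also have "\<dots> = (\<integral>z. indicator (rect_tent D Q) z * h z \<partial>\<nu>)"
  proof (rule Bochner_Integration.integral_cong[OF refl])
    fix z assume z: "z \<in> space \<nu>"
    obtain R0 where R0: "R0 \<in> P" "z \<in> cell R0" using cell_exists[OF z] by blast
    have "(\<Sum>R\<in>{R\<in>P. R \<le> Q}. indicator (cell R) z * h z) = (\<Sum>R\<in>{R\<in>P. R \<le> Q}. if R = R0 then h z else 0)"
      using R0 cell_unique by (intro sum.cong) (auto simp: indicator_def)
    also have "\<dots> = (if R0 \<le> Q then h z else 0)" using R0 by simp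
    also have "\<dots> = indicator (rect_tent D Q) z * h z"
      using cell_tent_iff[OF R0(2) Q] by (auto simp: indicator_def)
    finally show "(\<Sum>R\<in>{R\<in>P. R \<le> Q}. indicator (cell R) z * h z) = indicator (rect_tent D Q) z * h z" .
  qed
  finally show ?thesis .
qed

lemma measure_eq_cells:
  assumes "Q \<in> P"
  shows "dual_Hardy (\<lambda>R. measure \<nu> (cell R)) Q = measure \<nu> (rect_tent D Q)"
  using dual_Hardy_cells[of "\<lambda>_. 1" Q] assms rect_tent_sets_P[OF assms]
  by (simp add: integrable_bounded[of _ 1])

text \<open>The discrete embedding is applied to the cell masses of \<nu>, the cell integrals of h
  and those of h^2. Cauchy-Schwarz on each cell supplies its hypothesis, and the last family adds up
  to the full integral.\<close>

lemma tent_embedding: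
  fixes h :: "complex ^ 'd \<Rightarrow> real"
  assumes h [measurable]: "h \<in> borel_measurable \<nu>" and bd: "\<And>z. z \<in> space \<nu> \<Longrightarrow> \<bar>h z\<bar> \<le> c" and B: "0 \<le> B"
    and box: "\<And>Q. Q \<in> P \<Longrightarrow> (\<Sum>R\<in>{R\<in>P. R \<le> Q}. W R * (measure \<nu> (rect_tent D R))\<^sup>2) \<le> B * measure \<nu> (rect_tent D Q)"
  shows "(\<Sum>R\<in>P. W R * (\<integral>z. indicator (rect_tent D R) z * h z \<partial>\<nu>)\<^sup>2)
    \<le> (4 * 2304 ^ 8 * B) * (\<integral>z. (h z)\<^sup>2 \<partial>\<nu>)"
proof -
  define \<kappa> where "\<kappa> R = (\<integral>z. indicator (cell R) z * h z \<partial>\<nu>)" for R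
  define e where "e R = (\<integral>z. indicator (cell R) z * (h z)\<^sup>2 \<partial>\<nu>)" for R
  have inth: "integrable \<nu> h" using bd by (intro integrable_bounded) auto
  have inth2: "integrable \<nu> (\<lambda>z. (h z)\<^sup>2)"
  proof (rule integrable_bounded)
    show "norm ((h z)\<^sup>2) \<le> c\<^sup>2" if "z \<in> space \<nu>" for z
      using power_mono[OF bd[OF that], of 2] by simp
  qed measurable
  have int2: "integrable \<nu> (\<lambda>z. indicator (cell R) z * (h z)\<^sup>2)" for R
    using integrable_real_mult_indicator[OF cell_sets inth2] by (simp add: mult.commute)
  have int1: "integrable \<nu> (\<lambda>z. indicator (cell R) z * h z)" for R
    using integrable_real_mult_indicator[OF cell_sets inth] by (simp add: mult.commute)
  have "(\<Sum>R\<in>P. W R * (dual_Hardy \<kappa> R)\<^sup>2) \<le> (4 * 2304 ^ 8 * B) * (\<Sum>R\<in>P. e R)"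
  proof (rule box_imp_dual_embedding[OF card, where \<mu> = "\<lambda>R. measure \<nu> (cell R)"])
    show "(\<Sum>R\<in>{R\<in>P. R \<le> Q}. W R * (dual_Hardy (\<lambda>R. measure \<nu> (cell R)) R)\<^sup>2)
        \<le> B * dual_Hardy (\<lambda>R. measure \<nu> (cell R)) Q" if "Q \<in> P" for Q
    proof -
      have "(\<Sum>R\<in>{R\<in>P. R \<le> Q}. W R * (dual_Hardy (\<lambda>R. measure \<nu> (cell R)) R)\<^sup>2)
          = (\<Sum>R\<in>{R\<in>P. R \<le> Q}. W R * (measure \<nu> (rect_tent D R))\<^sup>2)"
        by (rule sum.cong) (auto simp: measure_eq_cells)
      then show ?thesis using box[OF that] that by (simp add: measure_eq_cells)
    qed
    show "(\<kappa> R)\<^sup>2 \<le> measure \<nu> (cell R) * e R" for R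
    proof -
      define i :: "complex ^ 'd \<Rightarrow> real" where "i = indicator (cell R)"
      have i: "(i z)\<^sup>2 = i z" "i z * (i z * h z) = i z * h z" "(i z * h z)\<^sup>2 = i z * (h z)\<^sup>2" for z
        by (auto simp: i_def indicator_def)
      have "integrable \<nu> i" unfolding i_def by (intro integrable_bounded[of _ 1]) auto
      then have "(\<integral>z. i z * (i z * h z) \<partial>\<nu>)\<^sup>2 \<le> (\<integral>z. (i z)\<^sup>2 \<partial>\<nu>) * (\<integral>z. (i z * h z)\<^sup>2 \<partial>\<nu>)"
        using int1[of R] int2[of R] by (intro integral_square_le) (simp_all add: i i_def[symmetric])
      moreover have "(\<integral>z. i z \<partial>\<nu>) = measure \<nu> (cell R)"
        unfolding i_def using sets.sets_into_space[OF cell_sets] by (simp add: Int_absorb2)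
      ultimately show ?thesis by (simp only: i \<kappa>_def e_def i_def[symmetric])
    qed
  qed (use B in \<open>auto simp: e_def\<close>)
  moreover have "dual_Hardy \<kappa> R = (\<integral>z. indicator (rect_tent D R) z * h z \<partial>\<nu>)" if "R \<in> P" for R
    unfolding \<kappa>_def by (rule dual_Hardy_cells[OF inth that])
  moreover have "(\<Sum>R\<in>P. e R) = (\<integral>z. (h z)\<^sup>2 \<partial>\<nu>)"
  proof -
    have "(\<Sum>R\<in>P. e R) = (\<integral>z. (\<Sum>R\<in>P. indicator (cell R) z * (h z)\<^sup>2) \<partial>\<nu>)"
      unfolding e_def by (rule Bochner_Integration.integral_sum[symmetric]) (rule int2)
    also have "\<dots> = (\<integral>z. (h z)\<^sup>2 \<partial>\<nu>)"
      by (rule Bochner_Integration.integral_cong[OF refl]) (rule sum_cell_indicators)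
    finally show ?thesis .
  qed
  ultimately show ?thesis by (simp cong: sum.cong)
qed

end

subsection \<open>The product kernel\<close>

text \<open>Choosing one admissible constant for each \<beta> makes it a function of \<beta> alone,
  so that the final constant can be fixed before the measure, the radius and the lattices.\<close>

definition kernel_const :: "real \<Rightarrow> real"
  where "kernel_const \<beta> = (SOME C. C \<ge> 1 \<and> (\<forall>n. kernel_coeff \<beta> n \<le> C * (real n + 1) powr (- (1 - \<beta>))
        \<and> (real n + 1) powr (- (1 - \<beta>)) \<le> C * kernel_coeff \<beta> n)
      \<and> (\<forall>x. norm x < 1 \<longrightarrow> scale_sum \<beta> 9 (norm (1 - x)) \<le> C * norm (kernel_fun \<beta> x)
        \<and> norm (kernel_fun \<beta> x) \<le> C * scale_sum \<beta> 1 (norm (1 - x))))"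

lemma kernel_const:
  assumes "0 \<le> \<beta>" "\<beta> \<le> 1 / 4"
  shows "1 \<le> kernel_const \<beta>"
    "kernel_coeff \<beta> n \<le> kernel_const \<beta> * (real n + 1) powr (- (1 - \<beta>))"
    "(real n + 1) powr (- (1 - \<beta>)) \<le> kernel_const \<beta> * kernel_coeff \<beta> n"
    "norm x < 1 \<Longrightarrow> scale_sum \<beta> 9 (norm (1 - x)) \<le> kernel_const \<beta> * norm (kernel_fun \<beta> x)"
    "norm x < 1 \<Longrightarrow> norm (kernel_fun \<beta> x) \<le> kernel_const \<beta> * scale_sum \<beta> 1 (norm (1 - x))"
  using someI_ex[OF kernel_estimates[OF assms], folded kernel_const_def] by blast+

lemma kernel_coeff_summable:
  assumes "0 \<le> \<rho>" "\<rho> < 1"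
  shows "summable (\<lambda>k. kernel_coeff \<beta> k * \<rho> ^ k)"
proof -
  have "summable (\<lambda>k. of_real (kernel_coeff \<beta> k) * (of_real \<rho> :: complex) ^ k)"
    using kernel_sums[of "of_real \<rho>" \<beta>] assms by (auto simp: sums_iff)
  then have "summable (\<lambda>k. complex_of_real (kernel_coeff \<beta> k * \<rho> ^ k))" by simp
  then show ?thesis by (simp only: summable_complex_of_real)
qed

lemma kernel_truncation:
  assumes \<rho>: "0 \<le> \<rho>" "\<rho> < 1" and \<beta>: "0 \<le> \<beta>" and x: "norm x \<le> \<rho>"
  defines "P \<equiv> \<lambda>L. \<Sum>k<L. of_real (kernel_coeff \<beta> k) * x ^ k"
  shows "norm (P L) \<le> (\<Sum>k. kernel_coeff \<beta> k * \<rho> ^ k)"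
    "norm (kernel_fun \<beta> x) \<le> (\<Sum>k. kernel_coeff \<beta> k * \<rho> ^ k)"
    "norm (P L - kernel_fun \<beta> x) \<le> (\<Sum>k. kernel_coeff \<beta> (k + L) * \<rho> ^ (k + L))"
proof -
  let ?f = "\<lambda>k. of_real (kernel_coeff \<beta> k) * x ^ k"
  let ?g = "\<lambda>k. kernel_coeff \<beta> k * \<rho> ^ k"
  have c0: "0 \<le> kernel_coeff \<beta> k" for k using kernel_coeff_pos[OF \<beta>, of k] by simp
  have fg: "norm (?f k) \<le> ?g k" for k
    using x c0 by (simp add: norm_mult norm_power mult_left_mono power_mono)
  have g: "summable ?g" using \<rho> by (rule kernel_coeff_summable)
  have f: "?f sums kernel_fun \<beta> x" using kernel_sums x \<rho> by simp
  have "norm (P L) \<le> (\<Sum>k<L. ?g k)" unfolding P_def by (rule sum_norm_le) (rule fg)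
  also have "\<dots> \<le> suminf ?g" using g c0 \<rho> by (intro sum_le_suminf) auto
  finally show "norm (P L) \<le> suminf ?g" .
  show "norm (kernel_fun \<beta> x) \<le> suminf ?g"
    using norm_suminf_le[OF fg g] f by (simp add: sums_iff)
  have "kernel_fun \<beta> x - P L = (\<Sum>k. ?f (k + L))"
    using suminf_minus_initial_segment[of ?f L] f by (simp add: P_def sums_iff)
  then have "norm (P L - kernel_fun \<beta> x) = norm (\<Sum>k. ?f (k + L))" by (subst norm_minus_commute) simp
  also have "\<dots> \<le> (\<Sum>k. ?g (k + L))"
    using fg g by (intro norm_suminf_le summable_ignore_initial_segment) auto
  finally show "norm (P L - kernel_fun \<beta> x) \<le> (\<Sum>k. ?g (k + L))" .
qed

text \<open>Division by H reduces to factors of norm at most 1, where the difference of products is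
  at most the sum of the differences; the leftover 1 / H is at most 1.\<close>

lemma norm_prod_diff_le:
  fixes a b :: "'d::finite \<Rightarrow> complex"
  assumes "1 \<le> H" "\<And>j. norm (a j) \<le> H" "\<And>j. norm (b j) \<le> H"
  shows "norm ((\<Prod>j\<in>UNIV. a j) - (\<Prod>j\<in>UNIV. b j)) \<le> H ^ CARD('d) * (\<Sum>j\<in>UNIV. norm (a j - b j))"
proof -
  have H: "0 < H" using assms(1) by simp
  have e: "(\<Prod>j\<in>UNIV. f j) = of_real H ^ CARD('d) * (\<Prod>j\<in>UNIV. f j / of_real H)" for f :: "'d \<Rightarrow> complex"
    using H by (simp add: prod_dividef)
  have "norm ((\<Prod>j\<in>UNIV. a j) - (\<Prod>j\<in>UNIV. b j))
      = H ^ CARD('d) * norm ((\<Prod>j\<in>UNIV. a j / of_real H) - (\<Prod>j\<in>UNIV. b j / of_real H))"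
    unfolding e[of a] e[of b] right_diff_distrib[symmetric] norm_mult using H by (simp add: norm_power)
  also have "\<dots> \<le> H ^ CARD('d) * (\<Sum>j\<in>UNIV. norm (a j / of_real H - b j / of_real H))"
    using assms H by (intro mult_left_mono norm_prod_diff) (auto simp: norm_divide)
  also have "\<dots> \<le> H ^ CARD('d) * (\<Sum>j\<in>UNIV. norm (a j - b j))"
  proof (intro mult_left_mono sum_mono)
    fix j
    have "norm (a j / of_real H - b j / of_real H) = norm (a j - b j) / H"
      using H by (simp add: diff_divide_distrib[symmetric] norm_divide)
    also have "\<dots> \<le> norm (a j - b j) / 1" using assms(1) by (intro divide_left_mono) auto
    finally show "norm (a j / of_real H - b j / of_real H) \<le> norm (a j - b j)" by simp
  qed (use H in auto)
  finally show ?thesis .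
qed

definition kernel_bound :: "real ^ 'd::finite \<Rightarrow> real"
  where "kernel_bound s = (\<Prod>j\<in>UNIV. kernel_const (1 - s $ j))"

definition product_coeff :: "real ^ 'd::finite \<Rightarrow> ('d \<Rightarrow> nat) \<Rightarrow> real"
  where "product_coeff s n = (\<Prod>j\<in>UNIV. kernel_coeff (1 - s $ j) (n j))"

definition product_kernel :: "real ^ 'd::finite \<Rightarrow> complex ^ 'd \<Rightarrow> complex ^ 'd \<Rightarrow> complex"
  where "product_kernel s z v = (\<Prod>j\<in>UNIV. kernel_fun (1 - s $ j) (z $ j * cnj (v $ j)))"

text \<open>With polynomial truncations every interchange of sum and integral is finite. The full
  kernel enters only through uniform closeness on the polydisc of radius r, which carries
  \<nu>.\<close>

definition truncated_kernel :: "real ^ 'd::finite \<Rightarrow> nat \<Rightarrow> complex ^ 'd \<Rightarrow> complex ^ 'd \<Rightarrow> complex"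
  where "truncated_kernel s L z v =
    (\<Sum>n\<in>index_box L. of_real (product_coeff s n) * (monomial n z * cnj (monomial n v)))"

lemma truncated_kernel_eq:
  "truncated_kernel s L z v
    = (\<Prod>j\<in>UNIV. \<Sum>k<L. of_real (kernel_coeff (1 - s $ j) k) * (z $ j * cnj (v $ j)) ^ k)"
proof -
  have "of_real (product_coeff s n) * (monomial n z * cnj (monomial n v))
      = (\<Prod>j\<in>UNIV. of_real (kernel_coeff (1 - s $ j) (n j)) * (z $ j * cnj (v $ j)) ^ n j)" for n
    by (simp add: product_coeff_def monomial_def prod.distrib power_mult_distrib)
  then show ?thesis
    unfolding truncated_kernel_def index_box_def by (subst prod_sum_PiE) auto
qed

lemma truncated_kernel_uniform:
  fixes s :: "real ^ 'd::finite"
  assumes r: "0 \<le> r" "r < 1" and s: "\<And>j. s $ j \<le> 1" and e: "0 < e"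
  shows "\<exists>L0. \<forall>L\<ge>L0. \<forall>z v. (\<forall>j. norm (z $ j) < r) \<longrightarrow> (\<forall>j. norm (v $ j) < r) \<longrightarrow>
    norm (truncated_kernel s L z v - product_kernel s z v) \<le> e"
proof -
  define h where "h j = (\<Sum>k. kernel_coeff (1 - s $ j) k * r ^ k)" for j
  define tail where "tail j L = (\<Sum>k. kernel_coeff (1 - s $ j) (k + L) * r ^ (k + L))" for j L
  define H where "H = 1 + (\<Sum>j\<in>UNIV. h j)"
  have c0: "0 \<le> kernel_coeff (1 - s $ j) k" for j k using kernel_coeff_pos[of "1 - s $ j" k] s by (simp add: less_imp_le)
  have h0: "0 \<le> h j" for j unfolding h_def
    using c0 r by (intro suminf_nonneg kernel_coeff_summable) auto
  have hH: "h j \<le> H" for j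
    using member_le_sum[of j UNIV h] h0 by (simp add: H_def)
  have H1: "1 \<le> H" using h0 by (simp add: H_def sum_nonneg)
  define \<delta> where "\<delta> = e / (H ^ CARD('d) * real CARD('d))"
  have \<delta>: "0 < \<delta>" using e H1 by (simp add: \<delta>_def)
  have "\<exists>N. \<forall>n\<ge>N. norm (tail j n) < \<delta>" for j
    unfolding tail_def using \<delta> r by (intro suminf_exist_split kernel_coeff_summable) auto
  then obtain N where N: "\<And>j n. N j \<le> n \<Longrightarrow> norm (tail j n) < \<delta>" by metis
  show ?thesis
  proof (intro exI[of _ "\<Sum>j\<in>UNIV. N j"] allI impI)
    fix L and z v :: "complex ^ 'd" assume L: "(\<Sum>j\<in>UNIV. N j) \<le> L" and z: "\<forall>j. norm (z $ j) < r" and v: "\<forall>j. norm (v $ j) < r"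
    have x: "norm (z $ j * cnj (v $ j)) \<le> r" for j
    proof -
      have "norm (z $ j) * norm (v $ j) \<le> r * 1"
        using z v r by (intro mult_mono) (auto intro: less_imp_le less_trans)
      then show ?thesis by (simp add: norm_mult)
    qed
    have NL: "N j \<le> L" for j using L member_le_sum[of j UNIV N] by simp
    have "norm (truncated_kernel s L z v - product_kernel s z v)
      \<le> H ^ CARD('d) * (\<Sum>j\<in>UNIV. norm ((\<Sum>k<L. of_real (kernel_coeff (1 - s $ j) k) * (z $ j * cnj (v $ j)) ^ k)
          - kernel_fun (1 - s $ j) (z $ j * cnj (v $ j))))"
      unfolding truncated_kernel_eq product_kernel_def
    proof (rule norm_prod_diff_le[OF H1])
      show "norm (\<Sum>k<L. of_real (kernel_coeff (1 - s $ j) k) * (z $ j * cnj (v $ j)) ^ k) \<le> H" for j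
        using kernel_truncation(1)[OF r _ x[of j], of "1 - s $ j" L] s hH[of j] unfolding h_def by (meson diff_ge_0_iff_ge order_trans)
      show "norm (kernel_fun (1 - s $ j) (z $ j * cnj (v $ j))) \<le> H" for j
        using kernel_truncation(2)[OF r _ x[of j], of "1 - s $ j"] s hH[of j] unfolding h_def by (meson diff_ge_0_iff_ge order_trans)
    qed
    also have "\<dots> \<le> H ^ CARD('d) * (\<Sum>j\<in>(UNIV :: 'd set). \<delta>)"
    proof (intro mult_left_mono sum_mono)
      fix j
      have "norm ((\<Sum>k<L. of_real (kernel_coeff (1 - s $ j) k) * (z $ j * cnj (v $ j)) ^ k)
          - kernel_fun (1 - s $ j) (z $ j * cnj (v $ j))) \<le> tail j L"
        unfolding tail_def using kernel_truncation(3)[OF r _ x[of j], of "1 - s $ j" L] s by simp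
      also have "\<dots> \<le> \<delta>" using N[OF NL[of j]] by simp
      finally show "norm ((\<Sum>k<L. of_real (kernel_coeff (1 - s $ j) k) * (z $ j * cnj (v $ j)) ^ k)
          - kernel_fun (1 - s $ j) (z $ j * cnj (v $ j))) \<le> \<delta>" .
    qed (use H1 in auto)
    also have "\<dots> = e" using H1 by (simp add: \<delta>_def)
    finally show "norm (truncated_kernel s L z v - product_kernel s z v) \<le> e" .
  qed
qed

section \<open>Comparison of the product kernel with sums over rectangles\<close>

context carleson
begin

lemma \<beta>_bounds: "0 \<le> 1 - s $ j" "1 - s $ j \<le> 1 / 4"
  using s[of j] by auto

lemma kernel_bound_ge_1: "1 \<le> kernel_bound s"
  unfolding kernel_bound_def by (rule prod_ge_1) (rule kernel_const(1)[OF \<beta>_bounds])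

lemma product_coeff_pos: "0 < product_coeff s n"
  unfolding product_coeff_def by (intro prod_pos) (auto intro: kernel_coeff_pos \<beta>_bounds)

lemma product_coeff_upper:
  "product_coeff s n * (\<Prod>j\<in>UNIV. (real (n j) + 1) powr (s $ j)) \<le> kernel_bound s"
proof -
  have "kernel_coeff (1 - s $ j) (n j) * (real (n j) + 1) powr (s $ j) \<le> kernel_const (1 - s $ j)" for j
  proof -
    have "kernel_coeff (1 - s $ j) (n j) * (real (n j) + 1) powr (s $ j)
        \<le> (kernel_const (1 - s $ j) * (real (n j) + 1) powr (- (s $ j))) * (real (n j) + 1) powr (s $ j)"
      using kernel_const(2)[OF \<beta>_bounds[of j], of "n j"] by (intro mult_right_mono) auto
    also have "\<dots> = kernel_const (1 - s $ j)" by (simp flip: powr_add)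
    finally show ?thesis .
  qed
  then show ?thesis
    unfolding product_coeff_def kernel_bound_def prod.distrib[symmetric]
    using kernel_coeff_pos \<beta>_bounds by (intro prod_mono) (auto intro: mult_nonneg_nonneg less_imp_le)
qed

lemma product_coeff_lower:
  "1 / product_coeff s n \<le> kernel_bound s * (\<Prod>j\<in>UNIV. (real (n j) + 1) powr (s $ j))"
proof -
  have "1 / kernel_coeff (1 - s $ j) (n j) \<le> kernel_const (1 - s $ j) * (real (n j) + 1) powr (s $ j)" for j
  proof -
    have c: "0 < kernel_coeff (1 - s $ j) (n j)" by (intro kernel_coeff_pos \<beta>_bounds)
    have "1 = (real (n j) + 1) powr (- (s $ j)) * (real (n j) + 1) powr (s $ j)"
      by (simp flip: powr_add)
    also have "\<dots> \<le> (kernel_const (1 - s $ j) * kernel_coeff (1 - s $ j) (n j)) * (real (n j) + 1) powr (s $ j)"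
      using kernel_const(3)[OF \<beta>_bounds[of j], of "n j"] by (intro mult_right_mono) auto
    finally show ?thesis using c by (simp add: field_simps)
  qed
  then have "(\<Prod>j\<in>UNIV. 1 / kernel_coeff (1 - s $ j) (n j))
      \<le> (\<Prod>j\<in>UNIV. kernel_const (1 - s $ j) * (real (n j) + 1) powr (s $ j))"
    using kernel_coeff_pos \<beta>_bounds by (intro prod_mono) (auto intro: less_imp_le)
  then show ?thesis
    by (simp add: product_coeff_def kernel_bound_def prod.distrib prod_dividef)
qed

text \<open>At most one arc of each generation has a tent containing z, and closeness of the two
  points of a common tent restricts the generations to the scales with threshold 9. So the sum
  injects into the scale sum.\<close>

lemma common_tents_sum_le:
  assumes z: "norm z < 1" and v: "norm v < 1"
  shows "(\<Sum>I\<in>T j. wt j I * (indicator (tent (D j) I) z * indicator (tent (D j) I) v))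
    \<le> scale_sum (1 - s $ j) 9 (norm (1 - z * cnj v))"
proof -
  let ?A = "{I \<in> T j. z \<in> tent (D j) I \<and> v \<in> tent (D j) I}"
  let ?S = "{m::nat. m = 0 \<or> 2 ^ m * norm (1 - z * cnj v) \<le> 9}"
  let ?g = "generation (D j)"
  have "(\<Sum>I\<in>T j. wt j I * (indicator (tent (D j) I) z * indicator (tent (D j) I) v)) = (\<Sum>I\<in>?A. wt j I)"
    by (rule sum.mono_neutral_cong_right) (use finite_T in \<open>auto simp: indicator_def\<close>)
  also have "\<dots> = (\<Sum>m\<in>?g ` ?A. 2 powr (real m * (1 - s $ j)))"
  proof -
    have "inj_on ?g ?A"
    proof (rule inj_onI)
      fix I J assume IJ: "I \<in> ?A" "J \<in> ?A" and g: "?g I = ?g J"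
      obtain m m' where m: "I \<in> D j m" "J \<in> D j m'" using IJ by (auto simp: T_def)
      then have "m = m'" using g by (simp add: L.generation_eq)
      then show "I = J" using L.tents_same_generation[of I j m J z] m IJ by simp
    qed
    then show ?thesis by (simp add: sum.reindex wt_def)
  qed
  also have "\<dots> \<le> scale_sum (1 - s $ j) 9 (norm (1 - z * cnj v))"
    unfolding scale_sum_def
  proof (rule sum_mono2)
    show "finite ?S" using finite_scales[OF norm_mult_cnj_less[OF z v], of 9] by simp
    show "?g ` ?A \<subseteq> ?S"
    proof
      fix m assume "m \<in> ?g ` ?A"
      then obtain I where I: "I \<in> ?A" "m = ?g I" by blast
      obtain m' where m': "I \<in> D j m'" using I by (auto simp: T_def)
      then have "m = m'" using I by (simp add: L.generation_eq)
      then have "norm (1 - z * cnj v) \<le> 9 / 2 ^ m" using L.common_tent_close[OF m'] I by simp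
      then show "m \<in> ?S" by (simp add: field_simps)
    qed
  qed auto
  finally show ?thesis .
qed

lemma P_eq_PiE: "P = PiE UNIV T"
  by (auto simp: P_def)

lemma indicator_rect_tent:
  "(indicator (rect_tent D R) z :: real) = (\<Prod>j\<in>UNIV. indicator (tent (D j) (R j)) (z $ j))"
proof (cases "z \<in> rect_tent D R")
  case True
  then show ?thesis by (simp add: rect_tent_def box_prod_def)
next
  case False
  then obtain j where "z $ j \<notin> tent (D j) (R j)" by (auto simp: rect_tent_def box_prod_def)
  then have "(\<Prod>j\<in>UNIV. indicator (tent (D j) (R j)) (z $ j) :: real) = 0" by (intro prod_zero bexI[of _ j]) auto
  then show ?thesis using False by simp
qed

text \<open>The arguments of at most three factors add up to at most 3 pi / 8, so Re K >= cos (3 pi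
  / 8) * |K|. Since weights and indicators are products, the sum over rectangles factors into
  one-variable sums, each bounded by \<open>common_tents_sum_le\<close>.\<close>

lemma Re_product_kernel_ge:
  assumes z: "z \<in> polydisc" and v: "v \<in> polydisc"
  shows "cos (3 * pi / 8) / kernel_bound s
      * (\<Sum>R\<in>P. W R * (indicator (rect_tent D R) z * indicator (rect_tent D R) v))
    \<le> Re (product_kernel s z v)"
proof -
  define x where "x j = z $ j * cnj (v $ j)" for j
  have x: "norm (x j) < 1" for j
    using z v by (auto simp: x_def polydisc_def intro: norm_mult_cnj_less)
  define N where "N = (\<Prod>j\<in>UNIV. norm (kernel_fun (1 - s $ j) (x j)))"
  have "\<exists>\<theta>. \<forall>j. \<bar>\<theta> j\<bar> \<le> pi / 8 \<and>
      kernel_fun (1 - s $ j) (x j) = of_real (norm (kernel_fun (1 - s $ j) (x j))) * cis (\<theta> j)"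
    using kernel_sector[OF x \<beta>_bounds] by (intro choice allI)
  then obtain \<theta> where \<theta>: "\<And>j. \<bar>\<theta> j\<bar> \<le> pi / 8"
    "\<And>j. kernel_fun (1 - s $ j) (x j) = of_real (norm (kernel_fun (1 - s $ j) (x j))) * cis (\<theta> j)" by blast
  define \<Theta> where "\<Theta> = (\<Sum>j\<in>UNIV. \<theta> j)"
  have cis_sum: "(\<Prod>j\<in>A. cis (\<theta> j)) = cis (\<Sum>j\<in>A. \<theta> j)" if "finite A" for A
    using that by induction (auto simp: cis_mult)
  have "product_kernel s z v = (\<Prod>j\<in>UNIV. of_real (norm (kernel_fun (1 - s $ j) (x j))) * cis (\<theta> j))"
    unfolding product_kernel_def x_def[symmetric] by (intro prod.cong refl \<theta>(2))
  also have "\<dots> = of_real N * cis \<Theta>"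
    by (simp add: prod.distrib N_def cis_sum \<Theta>_def)
  finally have Re: "Re (product_kernel s z v) = N * cos \<Theta>" by simp
  have "\<bar>\<Theta>\<bar> \<le> (\<Sum>j\<in>(UNIV::'d set). pi / 8)"
    unfolding \<Theta>_def by (rule order_trans[OF sum_abs]) (intro sum_mono \<theta>(1))
  also have "\<dots> = real CARD('d) * (pi / 8)" by simp
  also have "\<dots> \<le> 3 * (pi / 8)" using card by (intro mult_right_mono) auto
  finally have "\<bar>\<Theta>\<bar> \<le> 3 * pi / 8" by simp
  then have "cos (3 * pi / 8) \<le> cos \<bar>\<Theta>\<bar>" by (intro cos_monotone_0_pi_le) auto
  then have cos: "cos (3 * pi / 8) \<le> cos \<Theta>" by simp
  have N0: "0 \<le> N" by (auto simp: N_def intro: prod_nonneg)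
  have "(\<Sum>R\<in>P. W R * (indicator (rect_tent D R) z * indicator (rect_tent D R) v))
      = (\<Prod>j\<in>UNIV. \<Sum>I\<in>T j. wt j I * (indicator (tent (D j) I) (z $ j) * indicator (tent (D j) I) (v $ j)))"
    unfolding P_eq_PiE W_def indicator_rect_tent prod.distrib[symmetric]
    by (rule prod_sum_PiE[symmetric]) (auto simp: finite_T)
  also have "\<dots> \<le> (\<Prod>j\<in>UNIV. kernel_const (1 - s $ j) * norm (kernel_fun (1 - s $ j) (x j)))"
  proof (intro prod_mono conjI)
    fix j
    show "0 \<le> (\<Sum>I\<in>T j. wt j I * (indicator (tent (D j) I) (z $ j) * indicator (tent (D j) I) (v $ j)))"
      by (intro sum_nonneg) (auto simp: wt_def)
    have "norm (z $ j) < 1" "norm (v $ j) < 1" using z v by (auto simp: polydisc_def)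
    from common_tents_sum_le[OF this, of j] kernel_const(4)[OF \<beta>_bounds[of j] x[of j]]
    show "(\<Sum>I\<in>T j. wt j I * (indicator (tent (D j) I) (z $ j) * indicator (tent (D j) I) (v $ j)))
      \<le> kernel_const (1 - s $ j) * norm (kernel_fun (1 - s $ j) (x j))"
      unfolding x_def by linarith
  qed
  also have "\<dots> = kernel_bound s * N" by (simp add: kernel_bound_def N_def prod.distrib)
  finally have "(\<Sum>R\<in>P. W R * (indicator (rect_tent D R) z * indicator (rect_tent D R) v)) / kernel_bound s \<le> N"
    using kernel_bound_ge_1 by (simp add: field_simps)
  then have "cos (3 * pi / 8) * ((\<Sum>R\<in>P. W R * (indicator (rect_tent D R) z * indicator (rect_tent D R) v)) / kernel_bound s)
      \<le> cos \<Theta> * N"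
    using cos N0 by (intro mult_mono) (auto intro!: cos_ge_zero order_trans[OF _ cos] divide_nonneg_nonneg sum_nonneg
        simp: W_nonneg order_trans[OF _ kernel_bound_ge_1])
  then show ?thesis by (simp add: Re mult.commute)
qed

definition adj :: "('d \<Rightarrow> complex set) \<Rightarrow> ('d \<Rightarrow> complex set) \<Rightarrow> bool"
  where "adj R R' \<longleftrightarrow> (\<forall>j. \<exists>m. lattice.adjacent (D j) m (R j) (R' j))"

lemma adj_sym: "adj R R' \<longleftrightarrow> adj R' R"
  unfolding adj_def using L.adjacent_sym by metis

lemma adj_W: "adj R R' \<Longrightarrow> W R = W R'"
proof -
  assume a: "adj R R'"
  have "generation (D j) (R j) = generation (D j) (R' j)" for j
  proof -
    obtain m where "lattice.adjacent (D j) m (R j) (R' j)" using a by (auto simp: adj_def)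
    then have "R j \<in> D j m" "R' j \<in> D j m" by (auto simp: L.adjacent_def)
    then show ?thesis by (simp add: L.generation_eq)
  qed
  then show ?thesis by (simp add: W_def wt_def)
qed

lemma card_adj: "card {R'\<in>P. adj R R'} \<le> 6 ^ CARD('d)"
proof -
  let ?N = "\<lambda>j. {J. \<exists>m. lattice.adjacent (D j) m (R j) J}"
  have N: "finite (?N j) \<and> card (?N j) \<le> 6" for j
  proof (cases "\<exists>m. R j \<in> D j m")
    case True
    then obtain m where m: "R j \<in> D j m" by blast
    have "?N j = {J. lattice.adjacent (D j) m (R j) J}"
      using L.generation_unique[OF m] by (auto simp: L.adjacent_def)
    moreover have "finite {J. lattice.adjacent (D j) m (R j) J}"
      by (rule finite_subset[OF _ L.finite_D[of j m]]) (auto simp: L.adjacent_def)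
    ultimately show ?thesis using L.card_adjacent[of j m "R j"] by simp
  next
    case False
    then have "?N j = {}" by (auto simp: L.adjacent_def)
    then show ?thesis by simp
  qed
  have "{R'\<in>P. adj R R'} \<subseteq> PiE UNIV ?N" by (auto simp: adj_def)
  then have "card {R'\<in>P. adj R R'} \<le> card (PiE UNIV ?N)"
    using N by (intro card_mono finite_PiE) auto
  also have "\<dots> = (\<Prod>j\<in>UNIV. card (?N j))" by (rule card_PiE) simp
  also have "\<dots> \<le> (\<Prod>j\<in>(UNIV::'d set). 6)" using N by (intro prod_mono) auto
  finally show ?thesis by simp
qed

text \<open>Every scale m supplies a pair of adjacent arcs of generation m with z and v in their
  tents. Different scales give different pairs because the generation of an arc is unique.\<close>

lemma adjacent_tents_sum_ge:
  assumes z: "norm z < r" and v: "norm v < r"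
  shows "scale_sum (1 - s $ j) 1 (norm (1 - z * cnj v))
    \<le> (\<Sum>I\<in>T j. \<Sum>J\<in>T j. of_bool (\<exists>m. lattice.adjacent (D j) m I J) * wt j I *
          (indicator (tent (D j) I) z * indicator (tent (D j) J) v))" (is "_ \<le> (\<Sum>I\<in>_. \<Sum>J\<in>_. ?F I J)")
proof -
  let ?S = "{m::nat. m = 0 \<or> 2 ^ m * norm (1 - z * cnj v) \<le> 1}"
  have z1: "norm z < 1" and v1: "norm v < 1" using z v r by auto
  have ex: "\<forall>m\<in>?S. \<exists>p. lattice.adjacent (D j) m (fst p) (snd p) \<and> z \<in> tent (D j) (fst p) \<and> v \<in> tent (D j) (snd p)"
    using L.close_points_adjacent[OF z1 v1] by fastforce
  obtain p where "\<forall>m\<in>?S. lattice.adjacent (D j) m (fst (p m)) (snd (p m))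
      \<and> z \<in> tent (D j) (fst (p m)) \<and> v \<in> tent (D j) (snd (p m))"
    using bchoice[OF ex] by (elim exE)
  note p = bspec[OF this]
  have pD: "fst (p m) \<in> D j m" "snd (p m) \<in> D j m" if "m \<in> ?S" for m
    using p[OF that] by (auto simp: L.adjacent_def)
  \<comment> \<open>No scale is lost by cutting the tree at M: |1 - z * cnj v| >= 1 - |z| > 1 - r >=
    1 / 2^M.\<close>
  have mM: "m \<le> M" if "m \<in> ?S" for m
  proof (rule ccontr)
    assume m: "\<not> m \<le> M"
    then have "2 ^ m * norm (1 - z * cnj v) \<le> 1" using that by auto
    then have "norm (1 - z * cnj v) \<le> 1 / 2 ^ m" by (simp add: field_simps)
    also have "\<dots> \<le> 1 / 2 ^ M" using m by (intro divide_left_mono power_increasing) auto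
    finally have "norm (1 - z * cnj v) \<le> 1 - r" using M by linarith
    moreover have "1 - norm (z * cnj v) \<le> norm (1 - z * cnj v)"
      using norm_triangle_ineq2[of 1 "z * cnj v"] by simp
    moreover have "norm (z * cnj v) \<le> norm z * 1"
      unfolding norm_mult using v1 by (intro mult_left_mono) auto
    ultimately show False using z by simp
  qed
  have inj: "inj_on p ?S"
  proof (rule inj_onI)
    fix m m' assume m: "m \<in> ?S" "m' \<in> ?S" "p m = p m'"
    have "fst (p m) \<in> D j m'" using pD(1)[OF m(2)] m(3) by simp
    then show "m = m'" using L.generation_unique[OF pD(1)[OF m(1)]] by blast
  qed
  have "scale_sum (1 - s $ j) 1 (norm (1 - z * cnj v)) = (\<Sum>m\<in>?S. ?F (fst (p m)) (snd (p m)))"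
    unfolding scale_sum_def
  proof (rule sum.cong[OF refl])
    fix m assume m: "m \<in> ?S"
    have "\<exists>m. lattice.adjacent (D j) m (fst (p m)) (snd (p m))" using p[OF m] by blast
    moreover have "\<exists>m'. lattice.adjacent (D j) m' (fst (p m)) (snd (p m))" using p[OF m] by blast
    ultimately show "2 powr (real m * (1 - s $ j)) = ?F (fst (p m)) (snd (p m))"
      using p[OF m] pD(1)[OF m] by (simp add: wt_def L.generation_eq)
  qed
  also have "\<dots> = (\<Sum>q\<in>p ` ?S. ?F (fst q) (snd q))" using inj by (simp add: sum.reindex)
  also have "\<dots> \<le> (\<Sum>q\<in>T j \<times> T j. ?F (fst q) (snd q))"
  proof (rule sum_mono2)
    show "p ` ?S \<subseteq> T j \<times> T j"
    proof
      fix q assume "q \<in> p ` ?S"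
      then obtain m where m: "m \<in> ?S" "q = p m" by blast
      have "fst q \<in> T j" "snd q \<in> T j"
        unfolding T_def m(2) using pD[OF m(1)] mM[OF m(1)] by blast+
      then show "q \<in> T j \<times> T j" by (simp add: mem_Times_iff)
    qed
    show "finite (T j \<times> T j)" using finite_T by simp
    show "0 \<le> ?F (fst q) (snd q)" for q by (simp add: wt_def)
  qed
  also have "\<dots> = (\<Sum>I\<in>T j. \<Sum>J\<in>T j. ?F I J)" by (simp add: sum.cartesian_product split_def)
  finally show ?thesis .
qed

lemma norm_product_kernel_le:
  assumes z: "\<And>j. norm (z $ j) < r" and v: "\<And>j. norm (v $ j) < r"
  shows "norm (product_kernel s z v) \<le> kernel_bound s *
    (\<Sum>R\<in>P. \<Sum>R'\<in>P. of_bool (adj R R') * W R * (indicator (rect_tent D R) z * indicator (rect_tent D R') v))"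
proof -
  define x where "x j = z $ j * cnj (v $ j)" for j
  have x: "norm (x j) < 1" for j
    using less_trans[OF z r(2)] less_trans[OF v r(2)] unfolding x_def by (intro norm_mult_cnj_less)
  let ?F = "\<lambda>j I J. of_bool (\<exists>m. lattice.adjacent (D j) m I J) * wt j I *
          (indicator (tent (D j) I) (z $ j) * indicator (tent (D j) J) (v $ j) :: real)"
  have "norm (product_kernel s z v) = (\<Prod>j\<in>UNIV. norm (kernel_fun (1 - s $ j) (x j)))"
    by (simp add: product_kernel_def x_def prod_norm)
  also have "\<dots> \<le> (\<Prod>j\<in>UNIV. kernel_const (1 - s $ j) * (\<Sum>I\<in>T j. \<Sum>J\<in>T j. ?F j I J))"
  proof (intro prod_mono conjI)
    fix j
    have "norm (kernel_fun (1 - s $ j) (x j)) \<le> kernel_const (1 - s $ j) * scale_sum (1 - s $ j) 1 (norm (1 - x j))"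
      by (rule kernel_const(5)[OF \<beta>_bounds x])
    also have "\<dots> \<le> kernel_const (1 - s $ j) * (\<Sum>I\<in>T j. \<Sum>J\<in>T j. ?F j I J)"
      unfolding x_def using kernel_const(1)[OF \<beta>_bounds[of j]]
      by (intro mult_left_mono adjacent_tents_sum_ge z v) auto
    finally show "norm (kernel_fun (1 - s $ j) (x j)) \<le> kernel_const (1 - s $ j) * (\<Sum>I\<in>T j. \<Sum>J\<in>T j. ?F j I J)" .
  qed auto
  also have "\<dots> = kernel_bound s * (\<Prod>j\<in>UNIV. \<Sum>I\<in>T j. \<Sum>J\<in>T j. ?F j I J)"
    by (simp add: kernel_bound_def prod.distrib)
  also have "(\<Prod>j\<in>UNIV. \<Sum>I\<in>T j. \<Sum>J\<in>T j. ?F j I J) = (\<Sum>R\<in>PiE UNIV T. \<Prod>j\<in>UNIV. \<Sum>J\<in>T j. ?F j (R j) J)"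
    by (rule prod_sum_PiE) (auto simp: finite_T)
  also have "\<dots> = (\<Sum>R\<in>PiE UNIV T. \<Sum>R'\<in>PiE UNIV T. \<Prod>j\<in>UNIV. ?F j (R j) (R' j))"
    by (intro sum.cong refl prod_sum_PiE) (auto simp: finite_T)
  also have "\<dots> = (\<Sum>R\<in>P. \<Sum>R'\<in>P. of_bool (adj R R') * W R * (indicator (rect_tent D R) z * indicator (rect_tent D R') v))"
  proof -
    have b: "(\<Prod>j\<in>UNIV. of_bool (Q j) :: real) = of_bool (\<forall>j. Q j)" for Q :: "'d \<Rightarrow> bool"
      by (cases "\<forall>j. Q j") auto
    show ?thesis
      by (simp only: P_eq_PiE W_def indicator_rect_tent prod.distrib b adj_def)
  qed
  finally show ?thesis .
qed

text \<open>Schur's test for a symmetric matrix with at most 6^d ones in each row. The weights may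
  be exchanged because adjacent rectangles have sides of equal generation.\<close>

lemma adj_sum_le:
  "(\<Sum>R\<in>P. \<Sum>R'\<in>P. of_bool (adj R R') * W R * (x R * x R')) \<le> 6 ^ CARD('d) * (\<Sum>R\<in>P. W R * (x R)\<^sup>2)"
proof -
  let ?b = "\<lambda>R R'. of_bool (adj R R') :: real"
  have row: "(\<Sum>R\<in>P. \<Sum>R'\<in>P. ?b R R' * (W R * (x R)\<^sup>2)) \<le> 6 ^ CARD('d) * (\<Sum>R\<in>P. W R * (x R)\<^sup>2)"
    unfolding sum_distrib_left
  proof (rule sum_mono)
    fix R assume R: "R \<in> P"
    have "(\<Sum>R'\<in>P. ?b R R') = real (card {R'\<in>P. adj R R'})"
      using finite_P by (simp add: sum.If_cases of_bool_def Int_def)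
    also have "\<dots> \<le> real (6 ^ CARD('d))" using card_adj[of R] by (simp only: of_nat_le_iff)
    also have "\<dots> = 6 ^ CARD('d)" by simp
    finally have "(\<Sum>R'\<in>P. ?b R R') * (W R * (x R)\<^sup>2) \<le> 6 ^ CARD('d) * (W R * (x R)\<^sup>2)"
      using R by (intro mult_right_mono) (auto simp: W_nonneg)
    then show "(\<Sum>R'\<in>P. ?b R R' * (W R * (x R)\<^sup>2)) \<le> 6 ^ CARD('d) * (W R * (x R)\<^sup>2)"
      by (simp only: sum_distrib_right)
  qed
  have "(\<Sum>R\<in>P. \<Sum>R'\<in>P. ?b R R' * W R * (x R * x R'))
      \<le> (\<Sum>R\<in>P. \<Sum>R'\<in>P. (?b R R' * (W R * (x R)\<^sup>2)) / 2 + (?b R' R * (W R' * (x R')\<^sup>2)) / 2)"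
  proof (intro sum_mono)
    fix R R' assume R: "R \<in> P"
    show "?b R R' * W R * (x R * x R') \<le> (?b R R' * (W R * (x R)\<^sup>2)) / 2 + (?b R' R * (W R' * (x R')\<^sup>2)) / 2"
    proof (cases "adj R R'")
      case True
      have "x R * x R' \<le> ((x R)\<^sup>2 + (x R')\<^sup>2) / 2" using sum_squares_bound[of "x R" "x R'"] by simp
      then have "W R * (x R * x R') \<le> W R * (((x R)\<^sup>2 + (x R')\<^sup>2) / 2)"
        using R by (intro mult_left_mono) (auto simp: W_nonneg)
      then show ?thesis using True adj_sym adj_W[OF True] by (simp add: algebra_simps)
    next
      case False
      then show ?thesis using adj_sym by simp
    qed
  qed
  also have "\<dots> = (\<Sum>R\<in>P. \<Sum>R'\<in>P. ?b R R' * (W R * (x R)\<^sup>2)) / 2 + (\<Sum>R\<in>P. \<Sum>R'\<in>P. ?b R' R * (W R' * (x R')\<^sup>2)) / 2"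
    by (simp only: sum.distrib sum_divide_distrib)
  also have "(\<Sum>R\<in>P. \<Sum>R'\<in>P. ?b R' R * (W R' * (x R')\<^sup>2)) = (\<Sum>R\<in>P. \<Sum>R'\<in>P. ?b R R' * (W R * (x R)\<^sup>2))"
    by (rule sum.swap)
  finally show ?thesis using row by simp
qed

end

subsection \<open>Energies of measures\<close>

context carleson
begin

text \<open>A class closed under all operations below and contained in the integrable functions
  because \<nu> is finite; integrability thus becomes structural.\<close>

definition bdd_meas :: "(complex ^ 'd \<Rightarrow> 'b::{real_normed_algebra, second_countable_topology, banach}) \<Rightarrow> bool"
  where "bdd_meas f \<longleftrightarrow> f \<in> borel_measurable \<nu> \<and> (\<exists>B. \<forall>z\<in>space \<nu>. norm (f z) \<le> B)"

lemma bdd_meas_integrable: "bdd_meas f \<Longrightarrow> integrable \<nu> f"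
  unfolding bdd_meas_def using integrable_bounded by blast

lemma bdd_meas_const: "bdd_meas (\<lambda>_. c)"
  by (auto simp: bdd_meas_def)

lemma bdd_meas_mult:
  fixes f g :: "complex ^ 'd \<Rightarrow> 'b::{real_normed_algebra, second_countable_topology, banach}"
  assumes "bdd_meas f" "bdd_meas g"
  shows "bdd_meas (\<lambda>z. f z * g z)"
proof -
  obtain B C where BC: "\<And>z. z \<in> space \<nu> \<Longrightarrow> norm (f z) \<le> B" "\<And>z. z \<in> space \<nu> \<Longrightarrow> norm (g z) \<le> C"
    using assms unfolding bdd_meas_def by blast
  have "norm (f z * g z) \<le> B * C" if z: "z \<in> space \<nu>" for z
  proof -
    have "norm (f z * g z) \<le> norm (f z) * norm (g z)" by (rule norm_mult_ineq)
    also have "\<dots> \<le> B * C"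
      using BC[OF z] order_trans[OF norm_ge_zero BC(1)[OF z]] by (intro mult_mono) auto
    finally show ?thesis .
  qed
  moreover have "(\<lambda>z. f z * g z) \<in> borel_measurable \<nu>"
    using assms unfolding bdd_meas_def by (intro borel_measurable_times) auto
  ultimately show ?thesis unfolding bdd_meas_def by blast
qed

lemma bdd_meas_add:
  fixes f g :: "complex ^ 'd \<Rightarrow> 'b::{real_normed_algebra, second_countable_topology, banach}"
  assumes "bdd_meas f" "bdd_meas g"
  shows "bdd_meas (\<lambda>z. f z + g z)"
proof -
  obtain B C where BC: "\<And>z. z \<in> space \<nu> \<Longrightarrow> norm (f z) \<le> B" "\<And>z. z \<in> space \<nu> \<Longrightarrow> norm (g z) \<le> C"
    using assms unfolding bdd_meas_def by blast
  have "norm (f z + g z) \<le> B + C" if z: "z \<in> space \<nu>" for z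
    by (rule norm_triangle_mono[OF BC(1)[OF z] BC(2)[OF z]])
  moreover have "(\<lambda>z. f z + g z) \<in> borel_measurable \<nu>"
    using assms unfolding bdd_meas_def by (intro borel_measurable_add) auto
  ultimately show ?thesis unfolding bdd_meas_def by blast
qed

lemma bdd_meas_sum:
  fixes f :: "'k \<Rightarrow> complex ^ 'd \<Rightarrow> 'b::{real_normed_algebra, second_countable_topology, banach}"
  assumes "\<And>k. k \<in> K \<Longrightarrow> bdd_meas (f k)"
  shows "bdd_meas (\<lambda>z. \<Sum>k\<in>K. f k z)"
  using assms by (induction K rule: infinite_finite_induct) (auto intro: bdd_meas_const bdd_meas_add)

lemma bdd_meas_norm: "bdd_meas f \<Longrightarrow> bdd_meas (\<lambda>z. norm (f z))"
  by (auto simp: bdd_meas_def)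

lemma bdd_meas_cnj: "bdd_meas f \<Longrightarrow> bdd_meas (\<lambda>z. cnj (f z))"
  by (auto simp: bdd_meas_def intro: borel_measurable_continuous_on[of cnj] continuous_intros)

lemma bdd_meas_Re: "bdd_meas f \<Longrightarrow> bdd_meas (\<lambda>z. Re (f z))"
  unfolding bdd_meas_def by (auto intro!: borel_measurable_continuous_on[of Re] continuous_intros)
    (meson abs_Re_le_cmod order_trans)

lemma bdd_meas_of_real: "bdd_meas f \<Longrightarrow> bdd_meas (\<lambda>z. complex_of_real (f z))"
  by (auto simp: bdd_meas_def intro: borel_measurable_continuous_on[of of_real] continuous_intros)

lemma bdd_meas_indicator: "E \<in> sets \<nu> \<Longrightarrow> bdd_meas (indicator E :: _ \<Rightarrow> real)"
  by (auto simp: bdd_meas_def indicator_def intro!: exI[of _ 1])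

lemma norm_monomial_le_1: "z \<in> space \<nu> \<Longrightarrow> norm (monomial n z) \<le> 1"
proof -
  assume "z \<in> space \<nu>"
  then have z: "norm (z $ j) \<le> 1" for j by (simp add: space_\<nu> polydisc_def less_imp_le)
  have "norm (monomial n z) = (\<Prod>j\<in>UNIV. norm (z $ j) ^ n j)"
    by (simp add: monomial_def norm_power flip: prod_norm)
  also have "\<dots> \<le> 1" using z by (intro prod_le_1 conjI power_le_one) auto
  finally show ?thesis .
qed

lemma bdd_meas_monomial: "bdd_meas (monomial n)"
  unfolding bdd_meas_def using norm_monomial_le_1 measurable_monomial by blast

lemmas bdd_meas_intros = bdd_meas_const bdd_meas_mult bdd_meas_add bdd_meas_sum bdd_meas_norm bdd_meas_cnj bdd_meas_Re bdd_meas_of_real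
  bdd_meas_monomial bdd_meas_indicator rect_tent_sets_P

definition moment :: "(complex ^ 'd \<Rightarrow> complex) \<Rightarrow> ('d \<Rightarrow> nat) \<Rightarrow> complex"
  where "moment h n = (\<integral>z. monomial n z * cnj (h z) \<partial>\<nu>)"

text \<open>The quadratic form of the truncated kernel, as \<open>energy_eq\<close> shows. Written
  as a weighted sum of squares it is visibly nonnegative and increasing in L.\<close>

definition energy :: "(complex ^ 'd \<Rightarrow> complex) \<Rightarrow> nat \<Rightarrow> real"
  where "energy h L = (\<Sum>n\<in>index_box L. product_coeff s n * (norm (moment h n))\<^sup>2)"

lemma energy_nonneg: "0 \<le> energy h L"
  unfolding energy_def by (intro sum_nonneg mult_nonneg_nonneg) (auto simp: product_coeff_pos less_imp_le)

lemma energy_mono: "L \<le> L' \<Longrightarrow> energy h L \<le> energy h L'"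
proof -
  assume "L \<le> L'"
  then have "index_box L \<subseteq> (index_box L' :: ('d \<Rightarrow> nat) set)"
    unfolding subset_iff mem_index_box by (meson less_le_trans)
  then show ?thesis
    unfolding energy_def by (rule sum_mono2[rotated]) (auto simp: product_coeff_pos less_imp_le)
qed

lemma kernel_integral:
  assumes h: "bdd_meas h"
  shows "(\<integral>v. truncated_kernel s L z v * h v \<partial>\<nu>)
    = (\<Sum>n\<in>index_box L. of_real (product_coeff s n) * monomial n z * cnj (moment h n))"
proof -
  have "(\<integral>v. truncated_kernel s L z v * h v \<partial>\<nu>)
      = (\<integral>v. (\<Sum>n\<in>index_box L. of_real (product_coeff s n) * monomial n z * (cnj (monomial n v * cnj (h v)))) \<partial>\<nu>)"
    unfolding truncated_kernel_def sum_distrib_right by (simp add: mult_ac)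
  also have "\<dots> = (\<Sum>n\<in>index_box L. (\<integral>v. of_real (product_coeff s n) * monomial n z * (cnj (monomial n v * cnj (h v))) \<partial>\<nu>))"
    by (intro Bochner_Integration.integral_sum bdd_meas_integrable bdd_meas_intros h)
  also have "\<dots> = (\<Sum>n\<in>index_box L. of_real (product_coeff s n) * monomial n z * cnj (moment h n))"
    by (simp only: integral_mult_right_zero Bochner_Integration.integral_cnj moment_def)
  finally show ?thesis .
qed

lemma bdd_meas_kernel_integral: "bdd_meas h \<Longrightarrow> bdd_meas (\<lambda>z. \<integral>v. truncated_kernel s L z v * h v \<partial>\<nu>)"
  by (simp only: kernel_integral) (intro bdd_meas_intros)

lemma bdd_meas_kernel: "bdd_meas (truncated_kernel s L z)"
  unfolding truncated_kernel_def[abs_def] by (intro bdd_meas_intros)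

lemma energy_eq:
  assumes h: "bdd_meas h"
  shows "of_real (energy h L) = (\<integral>z. cnj (h z) * (\<integral>v. truncated_kernel s L z v * h v \<partial>\<nu>) \<partial>\<nu>)"
proof -
  have "(\<integral>z. cnj (h z) * (\<integral>v. truncated_kernel s L z v * h v \<partial>\<nu>) \<partial>\<nu>)
      = (\<integral>z. (\<Sum>n\<in>index_box L. (of_real (product_coeff s n) * cnj (moment h n)) * (monomial n z * cnj (h z))) \<partial>\<nu>)"
    unfolding kernel_integral[OF h] by (simp add: sum_distrib_left mult_ac)
  also have "\<dots> = (\<Sum>n\<in>index_box L. (\<integral>z. (of_real (product_coeff s n) * cnj (moment h n)) * (monomial n z * cnj (h z)) \<partial>\<nu>))"
    by (intro Bochner_Integration.integral_sum bdd_meas_integrable bdd_meas_intros h)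
  also have "\<dots> = (\<Sum>n\<in>index_box L. of_real (product_coeff s n) * cnj (moment h n) * moment h n)"
    by (simp only: integral_mult_right_zero moment_def)
  also have "\<dots> = (\<Sum>n\<in>index_box L. of_real (product_coeff s n * (norm (moment h n))\<^sup>2))"
  proof (rule sum.cong[OF refl])
    fix n
    have "of_real ((norm (moment h n))\<^sup>2) = cnj (moment h n) * moment h n"
      using complex_norm_square[of "moment h n"] by (simp add: mult.commute)
    then show "of_real (product_coeff s n) * cnj (moment h n) * moment h n = of_real (product_coeff s n * (norm (moment h n))\<^sup>2)"
      by (simp add: mult.assoc)
  qed
  finally show ?thesis by (simp add: energy_def)
qed

lemma kernel_close:
  assumes "0 < e"
  shows "\<exists>L0. \<forall>L\<ge>L0. \<forall>z v. (\<forall>j. norm (z $ j) < r) \<longrightarrow> (\<forall>j. norm (v $ j) < r) \<longrightarrow>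
    norm (truncated_kernel s L z v - product_kernel s z v) \<le> e"
proof (rule truncated_kernel_uniform)
  show "s $ j \<le> 1" for j using s[of j] by simp
qed (use r assms in auto)

text \<open>The kernel is dominated by its sum over adjacent rectangles. Integrating against |h| in
  both variables leaves a form in the tent integrals of |h|, to which \<open>adj_sum_le\<close> and
  then \<open>tent_embedding\<close> apply.\<close>

lemma energy_le:
  assumes h: "bdd_meas h" and B: "0 \<le> B"
    and box: "\<And>Q. Q \<in> P \<Longrightarrow> (\<Sum>R\<in>{R\<in>P. R \<le> Q}. W R * (measure \<nu> (rect_tent D R))\<^sup>2) \<le> B * measure \<nu> (rect_tent D Q)"
  shows "energy h L0 \<le> (kernel_bound s * 6 ^ CARD('d) * (4 * 2304 ^ 8 * B)) * (\<integral>z. (norm (h z))\<^sup>2 \<partial>\<nu>)"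
proof -
  let ?i = "\<lambda>R z. indicator (rect_tent D R) z :: real"
  define x where "x R = (\<integral>z. ?i R z * norm (h z) \<partial>\<nu>)" for R
  define x0 where "x0 = (\<integral>z. norm (h z) \<partial>\<nu>)"
  define S where "S = (\<Sum>R\<in>P. \<Sum>R'\<in>P. of_bool (adj R R') * W R * (x R * x R'))"
  have hn: "bdd_meas (\<lambda>z. norm (h z))" using h by (intro bdd_meas_intros)
  have "energy h L0 \<le> kernel_bound s * S + e * x0\<^sup>2" if e: "0 < e" for e
  proof -
    obtain L1 where L1: "\<And>L (z::complex ^ 'd) (v::complex ^ 'd). L1 \<le> L \<Longrightarrow> (\<forall>j. norm (z $ j) < r) \<Longrightarrow> (\<forall>j. norm (v $ j) < r) \<Longrightarrow>
        norm (truncated_kernel s L z v - product_kernel s z v) \<le> e"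
      using kernel_close[OF e] by blast
    \<comment> \<open>The truncation needed for closeness depends on e; since energies increase with
      L, the bound passes down to \<open>L0\<close>.\<close>
    define L where "L = max L0 L1"
    define G where "G z = kernel_bound s * (\<Sum>R\<in>P. \<Sum>R'\<in>P. of_bool (adj R R') * W R * x R' * ?i R z) + e * x0" for z
    have inner: "norm (\<integral>v. truncated_kernel s L z v * h v \<partial>\<nu>) \<le> G z" if z: "\<forall>j. norm (z $ j) < r" for z :: "complex ^ 'd"
    proof -
      let ?g = "\<lambda>v. kernel_bound s * (\<Sum>R\<in>P. \<Sum>R'\<in>P. (of_bool (adj R R') * W R * ?i R z) * (?i R' v * norm (h v))) + e * norm (h v)"
      have "norm (\<integral>v. truncated_kernel s L z v * h v \<partial>\<nu>) \<le> (\<integral>v. norm (truncated_kernel s L z v * h v) \<partial>\<nu>)"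
        by (rule integral_norm_bound)
      also have "\<dots> \<le> (\<integral>v. ?g v \<partial>\<nu>)"
      proof (rule integral_mono_AE)
        show "integrable \<nu> (\<lambda>v. norm (truncated_kernel s L z v * h v))"
          by (intro bdd_meas_integrable bdd_meas_intros bdd_meas_kernel h)
        show "integrable \<nu> ?g" by (intro bdd_meas_integrable bdd_meas_intros hn)
        show "AE v in \<nu>. norm (truncated_kernel s L z v * h v) \<le> ?g v"
          using AE_r
        proof (rule AE_mp, intro AE_I2 impI)
          fix v :: "complex ^ 'd" assume v: "\<forall>j. norm (v $ j) < r"
          have "norm (truncated_kernel s L z v) \<le> norm (product_kernel s z v) + e"
            using L1[of L z v] z v norm_triangle_sub[of "truncated_kernel s L z v" "product_kernel s z v"]
            by (simp add: L_def)
          also have "norm (product_kernel s z v) \<le> kernel_bound s * (\<Sum>R\<in>P. \<Sum>R'\<in>P. of_bool (adj R R') * W R * (?i R z * ?i R' v))"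
            using z v by (intro norm_product_kernel_le) auto
          finally have "norm (truncated_kernel s L z v) * norm (h v)
            \<le> (kernel_bound s * (\<Sum>R\<in>P. \<Sum>R'\<in>P. of_bool (adj R R') * W R * (?i R z * ?i R' v)) + e) * norm (h v)"
            by (intro mult_right_mono) auto
          also have "\<dots> = ?g v"
            by (simp only: distrib_right sum_distrib_right mult.assoc)
          finally show "norm (truncated_kernel s L z v * h v) \<le> ?g v" by (simp only: norm_mult)
        qed
      qed
      also have "\<dots> = kernel_bound s * (\<integral>v. (\<Sum>R\<in>P. \<Sum>R'\<in>P. (of_bool (adj R R') * W R * ?i R z) * (?i R' v * norm (h v))) \<partial>\<nu>) + e * x0"
        unfolding x0_def
        by (subst Bochner_Integration.integral_add) (simp_all add: bdd_meas_integrable bdd_meas_intros hn del: sum_distrib_left)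
      also have "(\<integral>v. (\<Sum>R\<in>P. \<Sum>R'\<in>P. (of_bool (adj R R') * W R * ?i R z) * (?i R' v * norm (h v))) \<partial>\<nu>)
          = (\<Sum>R\<in>P. \<Sum>R'\<in>P. \<integral>v. (of_bool (adj R R') * W R * ?i R z) * (?i R' v * norm (h v)) \<partial>\<nu>)"
        by (subst Bochner_Integration.integral_sum, intro bdd_meas_integrable bdd_meas_intros hn, assumption)
           (intro sum.cong refl Bochner_Integration.integral_sum bdd_meas_integrable bdd_meas_intros hn)
      also have "\<dots> = (\<Sum>R\<in>P. \<Sum>R'\<in>P. of_bool (adj R R') * W R * x R' * ?i R z)"
        unfolding x_def integral_mult_right_zero by (simp only: mult_ac)
      finally show ?thesis by (simp add: G_def)
    qed
    have bG: "bdd_meas G" unfolding G_def[abs_def] by (intro bdd_meas_intros)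
    have "energy h L0 \<le> energy h L" by (rule energy_mono) (simp add: L_def)
    also have "\<dots> = norm (complex_of_real (energy h L))" using energy_nonneg by simp
    also have "\<dots> \<le> (\<integral>z. norm (cnj (h z) * (\<integral>v. truncated_kernel s L z v * h v \<partial>\<nu>)) \<partial>\<nu>)"
      unfolding energy_eq[OF h] by (rule integral_norm_bound)
    also have "\<dots> \<le> (\<integral>z. norm (h z) * G z \<partial>\<nu>)"
    proof (rule integral_mono_AE)
      show "integrable \<nu> (\<lambda>z. norm (cnj (h z) * (\<integral>v. truncated_kernel s L z v * h v \<partial>\<nu>)))"
        by (intro bdd_meas_integrable bdd_meas_intros bdd_meas_kernel_integral h)
      show "integrable \<nu> (\<lambda>z. norm (h z) * G z)" by (intro bdd_meas_integrable bdd_meas_mult hn bG)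
      show "AE z in \<nu>. norm (cnj (h z) * (\<integral>v. truncated_kernel s L z v * h v \<partial>\<nu>)) \<le> norm (h z) * G z"
        using AE_r
      proof (rule AE_mp, intro AE_I2 impI)
        fix z :: "complex ^ 'd" assume "\<forall>j. norm (z $ j) < r"
        from inner[OF this]
        show "norm (cnj (h z) * (\<integral>v. truncated_kernel s L z v * h v \<partial>\<nu>)) \<le> norm (h z) * G z"
          unfolding norm_mult complex_mod_cnj by (intro mult_left_mono) auto
      qed
    qed
    also have "\<dots> = (\<integral>z. kernel_bound s * (\<Sum>R\<in>P. \<Sum>R'\<in>P. (of_bool (adj R R') * W R * x R') * (?i R z * norm (h z))) + (e * x0) * norm (h z) \<partial>\<nu>)"
      unfolding G_def by (simp add: distrib_left sum_distrib_left mult_ac)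
    also have "\<dots> = kernel_bound s * (\<integral>z. (\<Sum>R\<in>P. \<Sum>R'\<in>P. (of_bool (adj R R') * W R * x R') * (?i R z * norm (h z))) \<partial>\<nu>) + (e * x0) * x0"
      unfolding x0_def
      by (subst Bochner_Integration.integral_add) (simp_all add: bdd_meas_integrable bdd_meas_intros hn del: sum_distrib_left)
    also have "(\<integral>z. (\<Sum>R\<in>P. \<Sum>R'\<in>P. (of_bool (adj R R') * W R * x R') * (?i R z * norm (h z))) \<partial>\<nu>)
        = (\<Sum>R\<in>P. \<Sum>R'\<in>P. \<integral>z. (of_bool (adj R R') * W R * x R') * (?i R z * norm (h z)) \<partial>\<nu>)"
      by (subst Bochner_Integration.integral_sum, intro bdd_meas_integrable bdd_meas_intros hn, assumption)
         (intro sum.cong refl Bochner_Integration.integral_sum bdd_meas_integrable bdd_meas_intros hn)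
    also have "\<dots> = S"
      unfolding S_def integral_mult_right_zero x_def[symmetric] by (simp only: mult_ac)
    finally show ?thesis by (simp add: power2_eq_square mult.assoc)
  qed
  then have "energy h L0 \<le> kernel_bound s * S" by (rule le_of_le_add_eps) auto
  also have "\<dots> \<le> kernel_bound s * (6 ^ CARD('d) * ((4 * 2304 ^ 8 * B) * (\<integral>z. (norm (h z))\<^sup>2 \<partial>\<nu>)))"
  proof (rule mult_left_mono)
    obtain c where c: "\<And>z. z \<in> space \<nu> \<Longrightarrow> norm (h z) \<le> c" using h unfolding bdd_meas_def by blast
    have "(\<Sum>R\<in>P. W R * (x R)\<^sup>2) \<le> (4 * 2304 ^ 8 * B) * (\<integral>z. (norm (h z))\<^sup>2 \<partial>\<nu>)"
      unfolding x_def
      by (rule tent_embedding[of _ c]) (use hn c B box in \<open>auto simp: bdd_meas_def\<close>)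
    then have "6 ^ CARD('d) * (\<Sum>R\<in>P. W R * (x R)\<^sup>2) \<le> 6 ^ CARD('d) * ((4 * 2304 ^ 8 * B) * (\<integral>z. (norm (h z))\<^sup>2 \<partial>\<nu>))"
      by (intro mult_left_mono) auto
    with adj_sum_le[of x] show "S \<le> 6 ^ CARD('d) * ((4 * 2304 ^ 8 * B) * (\<integral>z. (norm (h z))\<^sup>2 \<partial>\<nu>))"
      unfolding S_def by linarith
  qed (use kernel_bound_ge_1 in simp)
  finally show ?thesis by (simp only: mult.assoc)
qed

text \<open>An indicator is nonnegative, so the lower bound on Re K may be integrated in both
  variables. The bound X is required for all L because the L that makes the error at most e depends
  on e.\<close>

lemma energy_indicator_ge:
  assumes E: "E \<in> sets \<nu>" and le: "\<And>L. energy (indicator E) L \<le> X"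
  shows "cos (3 * pi / 8) / kernel_bound s * (\<Sum>R\<in>P. W R * (measure \<nu> (rect_tent D R \<inter> E))\<^sup>2) \<le> X"
proof -
  let ?i = "\<lambda>R z. indicator (rect_tent D R) z :: real"
  let ?E = "\<lambda>z. indicator E z :: real"
  define c0 where "c0 = cos (3 * pi / 8) / kernel_bound s"
  define y where "y R = measure \<nu> (rect_tent D R \<inter> E)" for R
  have y: "(\<integral>z. ?i R z * ?E z \<partial>\<nu>) = y R" if "R \<in> P" for R
  proof -
    have "rect_tent D R \<inter> E \<in> sets \<nu>" using E rect_tent_sets_P[OF that] by blast
    then have "rect_tent D R \<inter> E \<inter> space \<nu> = rect_tent D R \<inter> E"
      using sets.sets_into_space by blast
    moreover have "(\<integral>z. ?i R z * ?E z \<partial>\<nu>) = (\<integral>z. indicator (rect_tent D R \<inter> E) z \<partial>\<nu>)"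
      by (simp only: indicator_inter_arith)
    ultimately show ?thesis by (simp add: y_def)
  qed
  have bE: "bdd_meas ?E" using E by (intro bdd_meas_intros)
  have h: "bdd_meas (indicator E :: _ \<Rightarrow> complex)"
    using bdd_meas_of_real[OF bE] by (simp add: of_real_indicator)
  have hE: "(indicator E z :: complex) = of_real (?E z)" for z by (simp add: indicator_def)
  have "c0 * (\<Sum>R\<in>P. W R * (y R)\<^sup>2) \<le> X + e * (measure \<nu> E)\<^sup>2" if e: "0 < e" for e
  proof -
    obtain L where L: "\<And>(z::complex ^ 'd) (v::complex ^ 'd). (\<forall>j. norm (z $ j) < r) \<Longrightarrow> (\<forall>j. norm (v $ j) < r) \<Longrightarrow>
        norm (truncated_kernel s L z v - product_kernel s z v) \<le> e"
      using kernel_close[OF e] by blast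
    have mE: "(\<integral>z. ?E z \<partial>\<nu>) = measure \<nu> E" using sets.sets_into_space[OF E] by (simp add: Int_absorb2)
    define G where "G z = (\<Sum>R\<in>P. (c0 * W R * y R) * ?i R z) - e * measure \<nu> E" for z
    have bG: "bdd_meas G"
    proof -
      have "bdd_meas (\<lambda>z. (\<Sum>R\<in>P. (c0 * W R * y R) * ?i R z) + - (e * measure \<nu> E))" by (intro bdd_meas_intros)
      then show ?thesis by (simp add: G_def[abs_def])
    qed
    have inner: "G z \<le> Re (\<integral>v. truncated_kernel s L z v * indicator E v \<partial>\<nu>)"
      if z: "\<forall>j. norm (z $ j) < r" for z :: "complex ^ 'd"
    proof -
      let ?g = "\<lambda>v. (\<Sum>R\<in>P. (c0 * W R * ?i R z) * (?i R v * ?E v)) + (- e) * ?E v"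
      have bg: "bdd_meas (\<lambda>v. \<Sum>R\<in>P. (c0 * W R * ?i R z) * (?i R v * ?E v))" by (intro bdd_meas_intros E)
      have zP: "z \<in> polydisc" using z r by (auto simp: polydisc_def intro: less_trans)
      have "(\<Sum>R\<in>P. (c0 * W R * ?i R z) * (\<integral>v. ?i R v * ?E v \<partial>\<nu>)) = (\<Sum>R\<in>P. (c0 * W R * y R) * ?i R z)"
        by (rule sum.cong[OF refl], subst y, assumption, simp only: mult_ac)
      then have "G z = (\<Sum>R\<in>P. (c0 * W R * ?i R z) * (\<integral>v. ?i R v * ?E v \<partial>\<nu>)) + (- e) * (\<integral>v. ?E v \<partial>\<nu>)"
        unfolding mE by (simp add: G_def)
      also have "\<dots> = (\<Sum>R\<in>P. (\<integral>v. (c0 * W R * ?i R z) * (?i R v * ?E v) \<partial>\<nu>)) + (\<integral>v. (- e) * ?E v \<partial>\<nu>)"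
        by (simp only: integral_mult_right_zero)
      also have "(\<Sum>R\<in>P. (\<integral>v. (c0 * W R * ?i R z) * (?i R v * ?E v) \<partial>\<nu>))
          = (\<integral>v. (\<Sum>R\<in>P. (c0 * W R * ?i R z) * (?i R v * ?E v)) \<partial>\<nu>)"
        by (intro Bochner_Integration.integral_sum[symmetric] bdd_meas_integrable bdd_meas_intros E)
      also have "\<dots> + (\<integral>v. (- e) * ?E v \<partial>\<nu>) = (\<integral>v. ?g v \<partial>\<nu>)"
        by (intro Bochner_Integration.integral_add[symmetric] bdd_meas_integrable bg bdd_meas_mult bdd_meas_const bE)
      also have "\<dots> \<le> (\<integral>v. Re (truncated_kernel s L z v * indicator E v) \<partial>\<nu>)"
      proof (rule integral_mono_AE)
        show "integrable \<nu> ?g" by (intro bdd_meas_integrable bdd_meas_add bg bdd_meas_mult bdd_meas_const bE)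
        show "integrable \<nu> (\<lambda>v. Re (truncated_kernel s L z v * indicator E v))"
          by (intro bdd_meas_integrable bdd_meas_Re bdd_meas_mult bdd_meas_kernel h)
        show "AE v in \<nu>. ?g v \<le> Re (truncated_kernel s L z v * indicator E v)"
          using AE_r
        proof (rule AE_mp, intro AE_I2 impI)
          fix v :: "complex ^ 'd" assume v: "v \<in> space \<nu>" "\<forall>j. norm (v $ j) < r"
          have "c0 * (\<Sum>R\<in>P. W R * (?i R z * ?i R v)) \<le> Re (product_kernel s z v)"
            unfolding c0_def using Re_product_kernel_ge[OF zP] v(1) space_\<nu> by simp
          also have "\<dots> \<le> Re (truncated_kernel s L z v) + e"
            using L[OF z v(2)] abs_Re_le_cmod[of "truncated_kernel s L z v - product_kernel s z v"] by simp
          finally have "(c0 * (\<Sum>R\<in>P. W R * (?i R z * ?i R v)) + (- e)) * ?E v \<le> Re (truncated_kernel s L z v) * ?E v"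
            by (intro mult_right_mono) auto
          moreover have "(c0 * (\<Sum>R\<in>P. W R * (?i R z * ?i R v)) + (- e)) * ?E v = ?g v"
            by (simp only: distrib_right sum_distrib_right sum_distrib_left mult.assoc)
          moreover have "Re (truncated_kernel s L z v * indicator E v) = Re (truncated_kernel s L z v) * ?E v"
            unfolding hE by simp
          ultimately show "?g v \<le> Re (truncated_kernel s L z v * indicator E v)" by simp
        qed
      qed
      also have "\<dots> = Re (\<integral>v. truncated_kernel s L z v * indicator E v \<partial>\<nu>)"
        by (intro integral_Re bdd_meas_integrable bdd_meas_mult bdd_meas_kernel h)
      finally show ?thesis .
    qed
    have "(\<Sum>R\<in>P. (c0 * W R * y R) * (\<integral>z. ?i R z * ?E z \<partial>\<nu>)) = c0 * (\<Sum>R\<in>P. W R * (y R)\<^sup>2)"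
      unfolding sum_distrib_left
      by (rule sum.cong[OF refl], subst y, assumption, simp only: power2_eq_square mult_ac)
    then have "c0 * (\<Sum>R\<in>P. W R * (y R)\<^sup>2) - e * (measure \<nu> E)\<^sup>2
        = (\<Sum>R\<in>P. (c0 * W R * y R) * (\<integral>z. ?i R z * ?E z \<partial>\<nu>)) + (- (e * measure \<nu> E)) * (\<integral>z. ?E z \<partial>\<nu>)"
      unfolding mE by (simp add: power2_eq_square)
    also have "\<dots> = (\<Sum>R\<in>P. (\<integral>z. (c0 * W R * y R) * (?i R z * ?E z) \<partial>\<nu>)) + (\<integral>z. (- (e * measure \<nu> E)) * ?E z \<partial>\<nu>)"
      by (simp only: integral_mult_right_zero)
    also have "(\<Sum>R\<in>P. (\<integral>z. (c0 * W R * y R) * (?i R z * ?E z) \<partial>\<nu>))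
        = (\<integral>z. (\<Sum>R\<in>P. (c0 * W R * y R) * (?i R z * ?E z)) \<partial>\<nu>)"
      by (intro Bochner_Integration.integral_sum[symmetric] bdd_meas_integrable bdd_meas_intros E)
    also have "\<dots> + (\<integral>z. (- (e * measure \<nu> E)) * ?E z \<partial>\<nu>)
        = (\<integral>z. (\<Sum>R\<in>P. (c0 * W R * y R) * (?i R z * ?E z)) + (- (e * measure \<nu> E)) * ?E z \<partial>\<nu>)"
      by (intro Bochner_Integration.integral_add[symmetric] bdd_meas_integrable bdd_meas_intros E)
    also have "\<dots> = (\<integral>z. ?E z * G z \<partial>\<nu>)"
      by (rule Bochner_Integration.integral_cong[OF refl])
         (simp add: G_def right_diff_distrib sum_distrib_left mult_ac)
    also have "\<dots> \<le> (\<integral>z. Re (cnj (indicator E z) * (\<integral>v. truncated_kernel s L z v * indicator E v \<partial>\<nu>)) \<partial>\<nu>)"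
    proof (rule integral_mono_AE)
      show "integrable \<nu> (\<lambda>z. ?E z * G z)" by (intro bdd_meas_integrable bdd_meas_mult bE bG)
      show "integrable \<nu> (\<lambda>z. Re (cnj (indicator E z) * (\<integral>v. truncated_kernel s L z v * indicator E v \<partial>\<nu>)))"
        by (intro bdd_meas_integrable bdd_meas_Re bdd_meas_mult bdd_meas_cnj bdd_meas_kernel_integral h)
      show "AE z in \<nu>. ?E z * G z \<le> Re (cnj (indicator E z) * (\<integral>v. truncated_kernel s L z v * indicator E v \<partial>\<nu>))"
        using AE_r
      proof (rule AE_mp, intro AE_I2 impI)
        fix z :: "complex ^ 'd" assume "\<forall>j. norm (z $ j) < r"
        from mult_left_mono[OF inner[OF this], of "?E z"]
        show "?E z * G z \<le> Re (cnj (indicator E z) * (\<integral>v. truncated_kernel s L z v * indicator E v \<partial>\<nu>))"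
          unfolding hE[of z] by simp
      qed
    qed
    also have "\<dots> = Re (complex_of_real (energy (indicator E) L))"
      unfolding energy_eq[OF h]
      by (intro integral_Re bdd_meas_integrable bdd_meas_mult bdd_meas_cnj bdd_meas_kernel_integral h)
    also have "\<dots> \<le> X" using le[of L] by simp
    finally show ?thesis by simp
  qed
  then have "c0 * (\<Sum>R\<in>P. W R * (y R)\<^sup>2) \<le> X" by (rule le_of_le_add_eps) auto
  then show ?thesis by (simp add: c0_def y_def)
qed

end

subsection \<open>The two inequalities\<close>

context carleson
begin

lemma box_of_testing:
  assumes B: "0 \<le> B"
    and test: "\<And>Q. Q \<in> dyadic_rectangles D \<Longrightarrow>
      (\<Sum>\<^sub>\<infinity>R\<in>{R \<in> dyadic_rectangles D. box_prod R \<subseteq> box_prod Q}.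
         ennreal (rect_weight D s R) * (emeasure \<nu> (rect_tent D R))\<^sup>2) \<le> ennreal B * emeasure \<nu> (rect_tent D Q)"
    and Q: "Q \<in> P"
  shows "(\<Sum>R\<in>{R\<in>P. R \<le> Q}. W R * (measure \<nu> (rect_tent D R))\<^sup>2) \<le> B * measure \<nu> (rect_tent D Q)"
proof -
  let ?f = "\<lambda>R. ennreal (rect_weight D s R) * (emeasure \<nu> (rect_tent D R))\<^sup>2"
  have f: "?f R = ennreal (W R * (measure \<nu> (rect_tent D R))\<^sup>2)" if "R \<in> P" for R
    using W_nonneg[OF that] by (simp add: rect_weight_eq emeasure_eq_measure ennreal_mult ennreal_power)
  have "box_prod R \<subseteq> box_prod Q" if "R \<le> Q" for R
    using that by (auto simp: box_prod_def le_fun_def)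
  then have sub: "{R\<in>P. R \<le> Q} \<subseteq> {R \<in> dyadic_rectangles D. box_prod R \<subseteq> box_prod Q}"
    using P_subset_rectangles by blast
  have "ennreal (\<Sum>R\<in>{R\<in>P. R \<le> Q}. W R * (measure \<nu> (rect_tent D R))\<^sup>2) = (\<Sum>R\<in>{R\<in>P. R \<le> Q}. ?f R)"
    by (subst sum_ennreal[symmetric]) (auto simp: f W_nonneg intro!: sum.cong)
  also have "\<dots> = infsum ?f {R\<in>P. R \<le> Q}" by simp
  also have "\<dots> \<le> infsum ?f {R \<in> dyadic_rectangles D. box_prod R \<subseteq> box_prod Q}"
    using sub by (intro infsum_mono_neutral nonneg_summable_on_complete) auto
  also have "\<dots> \<le> ennreal B * emeasure \<nu> (rect_tent D Q)"
    using test Q P_subset_rectangles by blast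
  also have "\<dots> = ennreal (B * measure \<nu> (rect_tent D Q))"
    using B by (simp add: emeasure_eq_measure ennreal_mult)
  finally show ?thesis using B by (subst (asm) ennreal_le_iff) auto
qed

text \<open>One \<open>kernel_bound s\<close> comes from dominating the kernel by adjacent tents,
  the other from comparing the norm weights with reciprocal kernel coefficients; 6 ^ 3 bounds the
  number of adjacent rectangles, and the rest is the discrete constant.\<close>

definition embedding_bound :: real
  where "embedding_bound = (kernel_bound s)\<^sup>2 * (6 ^ 3 * (4 * 2304 ^ 8))"

text \<open>Duality: the integral of |p|^2 pairs the coefficients of p with the moments of p itself.
  Cauchy-Schwarz with the kernel coefficients as weights gives the energy of p, which is at most a
  multiple of the same integral, and this is absorbed.\<close>

lemma polynomial_embedding:
  fixes a :: "('d \<Rightarrow> nat) \<Rightarrow> complex" and L :: nat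
  assumes B: "0 \<le> B"
    and box: "\<And>Q. Q \<in> P \<Longrightarrow> (\<Sum>R\<in>{R\<in>P. R \<le> Q}. W R * (measure \<nu> (rect_tent D R))\<^sup>2) \<le> B * measure \<nu> (rect_tent D Q)"
  defines "p \<equiv> \<lambda>z. \<Sum>n\<in>index_box L. a n * monomial n z"
  shows "(\<integral>z. (norm (p z))\<^sup>2 \<partial>\<nu>)
    \<le> embedding_bound * B * (\<Sum>n\<in>index_box L. (norm (a n))\<^sup>2 * (\<Prod>j\<in>UNIV. (real (n j) + 1) powr (s $ j)))"
proof -
  define I where "I = (\<integral>z. (norm (p z))\<^sup>2 \<partial>\<nu>)"
  define Y where "Y = (\<Sum>n\<in>index_box L. (norm (a n))\<^sup>2 * (1 / product_coeff s n))"
  define C where "C = kernel_bound s * 6 ^ CARD('d) * (4 * 2304 ^ 8 * B)"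
  define Z where "Z = (\<Sum>n\<in>index_box L. (norm (a n))\<^sup>2 * (\<Prod>j\<in>UNIV. (real (n j) + 1) powr (s $ j)))"
  have kb: "1 \<le> kernel_bound s" by (rule kernel_bound_ge_1)
  have p: "bdd_meas p" unfolding p_def by (intro bdd_meas_intros)
  have I0: "0 \<le> I" by (simp add: I_def)
  have Y0: "0 \<le> Y" unfolding Y_def by (intro sum_nonneg) (simp add: product_coeff_pos less_imp_le)
  have C0: "0 \<le> C" using kb B by (simp add: C_def)
  have c: "sqrt (product_coeff s n) > 0" for n using product_coeff_pos by simp
  have "complex_of_real I = (\<integral>z. p z * cnj (p z) \<partial>\<nu>)"
    unfolding I_def complex_norm_square[symmetric] by (rule integral_complex_of_real[symmetric])
  also have "\<dots> = (\<integral>z. (\<Sum>n\<in>index_box L. a n * (monomial n z * cnj (p z))) \<partial>\<nu>)"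
    unfolding p_def[abs_def] sum_distrib_right mult.assoc ..
  also have "\<dots> = (\<Sum>n\<in>index_box L. (\<integral>z. a n * (monomial n z * cnj (p z)) \<partial>\<nu>))"
    by (intro Bochner_Integration.integral_sum bdd_meas_integrable bdd_meas_intros p)
  also have "\<dots> = (\<Sum>n\<in>index_box L. a n * moment p n)"
    unfolding moment_def by (simp only: integral_mult_right_zero)
  finally have "I \<le> norm (\<Sum>n\<in>index_box L. a n * moment p n)"
    using I0 by (metis norm_of_real abs_of_nonneg order_refl)
  also have "\<dots> \<le> (\<Sum>n\<in>index_box L. norm (a n) * norm (moment p n))"
    by (rule sum_norm_le) (simp add: norm_mult)
  also have "\<dots> = (\<Sum>n\<in>index_box L. (norm (a n) / sqrt (product_coeff s n)) * (sqrt (product_coeff s n) * norm (moment p n)))"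
    using c by (intro sum.cong refl) (simp add: less_imp_neq[THEN not_sym])
  also have "\<dots> \<le> sqrt (\<Sum>n\<in>index_box L. (norm (a n) / sqrt (product_coeff s n))\<^sup>2)
      * sqrt (\<Sum>n\<in>index_box L. (sqrt (product_coeff s n) * norm (moment p n))\<^sup>2)"
    by (rule sum_mult_le_sqrt)
  also have "\<dots> = sqrt Y * sqrt (energy p L)"
    using product_coeff_pos by (simp add: Y_def energy_def power_divide power_mult_distrib less_imp_le)
  also have "\<dots> \<le> sqrt Y * sqrt (C * I)"
    unfolding I_def C_def using Y0
    by (intro mult_left_mono real_sqrt_le_mono energy_le[OF p B box]) auto
  finally have "I \<le> sqrt C * (sqrt Y * sqrt I)" by (simp add: real_sqrt_mult mult_ac)
  from le_square_of_le_sqrt_mult[OF this I0 Y0] C0 have "I \<le> C * Y" by simp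
  also have "Y \<le> kernel_bound s * Z"
    unfolding Y_def Z_def sum_distrib_left
  proof (rule sum_mono)
    fix n
    from mult_left_mono[OF product_coeff_lower[of n], of "(norm (a n))\<^sup>2"]
    show "(norm (a n))\<^sup>2 * (1 / product_coeff s n)
      \<le> kernel_bound s * ((norm (a n))\<^sup>2 * (\<Prod>j\<in>UNIV. (real (n j) + 1) powr (s $ j)))"
      by (simp add: mult_ac)
  qed
  finally have 1: "I \<le> C * (kernel_bound s * Z)" using C0 by (simp add: mult_left_mono)
  have Z0: "0 \<le> Z" unfolding Z_def by (intro sum_nonneg mult_nonneg_nonneg prod_nonneg) auto
  have "(6::real) ^ CARD('d) \<le> 6 ^ 3" using card by (intro power_increasing) auto
  then have "(kernel_bound s)\<^sup>2 * (4 * 2304 ^ 8 * B) * Z * 6 ^ CARD('d) \<le> (kernel_bound s)\<^sup>2 * (4 * 2304 ^ 8 * B) * Z * 6 ^ 3"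
    using kb B Z0 by (intro mult_left_mono) auto
  also have "(kernel_bound s)\<^sup>2 * (4 * 2304 ^ 8 * B) * Z * 6 ^ CARD('d) = C * (kernel_bound s * Z)"
    by (simp add: C_def power2_eq_square mult_ac)
  also have "(kernel_bound s)\<^sup>2 * (4 * 2304 ^ 8 * B) * Z * 6 ^ 3 = embedding_bound * B * Z"
    by (simp add: embedding_bound_def)
  finally show ?thesis using 1 unfolding I_def Z_def by linarith
qed

text \<open>Fatou's lemma along the cubical partial sums of the Taylor series, whose norms are at
  most that of f.\<close>

lemma embedding_of_testing:
  assumes B: "0 \<le> B"
    and test: "\<And>Q. Q \<in> dyadic_rectangles D \<Longrightarrow>
      (\<Sum>\<^sub>\<infinity>R\<in>{R \<in> dyadic_rectangles D. box_prod R \<subseteq> box_prod Q}.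
         ennreal (rect_weight D s R) * (emeasure \<nu> (rect_tent D R))\<^sup>2) \<le> ennreal B * emeasure \<nu> (rect_tent D Q)"
    and f: "f \<in> H_space s"
  shows "(\<integral>\<^sup>+z. ennreal ((norm (f z))\<^sup>2) \<partial>\<nu>) \<le> ennreal (embedding_bound * B) * ennreal (H_norm_sq s f)"
proof -
  define p where "p L z = (\<Sum>n\<in>index_box L. taylor_coeff f n * monomial n z)" for L z
  have bp: "bdd_meas (p L)" for L unfolding p_def[abs_def] by (intro bdd_meas_intros)
  have eb: "0 \<le> embedding_bound * B" using B by (simp add: embedding_bound_def)
  have H0: "0 \<le> H_norm_sq s f" unfolding H_norm_sq_def by (intro infsum_nonneg H_term_nonneg)
  have le: "(\<integral>\<^sup>+z. ennreal ((norm (p L z))\<^sup>2) \<partial>\<nu>) \<le> ennreal (embedding_bound * B * H_norm_sq s f)" for L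
  proof -
    have "bdd_meas (\<lambda>z. (norm (p L z))\<^sup>2)" unfolding power2_eq_square by (intro bdd_meas_intros bp)
    then have "(\<integral>\<^sup>+z. ennreal ((norm (p L z))\<^sup>2) \<partial>\<nu>) = ennreal (\<integral>z. (norm (p L z))\<^sup>2 \<partial>\<nu>)"
      by (intro nn_integral_eq_integral bdd_meas_integrable) auto
    also have "\<dots> \<le> ennreal (embedding_bound * B * H_norm_sq s f)"
    proof (rule ennreal_leI)
      have "(\<integral>z. (norm (p L z))\<^sup>2 \<partial>\<nu>)
        \<le> embedding_bound * B * (\<Sum>n\<in>index_box L. (norm (taylor_coeff f n))\<^sup>2 * (\<Prod>j\<in>UNIV. (real (n j) + 1) powr (s $ j)))"
        unfolding p_def by (rule polynomial_embedding[OF B box_of_testing[OF B test]])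
      also have "\<dots> \<le> embedding_bound * B * H_norm_sq s f"
        using sum_H_term_le[OF f, of "index_box L"] eb unfolding H_term_def by (intro mult_left_mono) auto
      finally show "(\<integral>z. (norm (p L z))\<^sup>2 \<partial>\<nu>) \<le> embedding_bound * B * H_norm_sq s f" .
    qed
    finally show ?thesis .
  qed
  have "(\<integral>\<^sup>+z. ennreal ((norm (f z))\<^sup>2) \<partial>\<nu>) = (\<integral>\<^sup>+z. liminf (\<lambda>L. ennreal ((norm (p L z))\<^sup>2)) \<partial>\<nu>)"
  proof (rule nn_integral_cong)
    fix z assume "z \<in> space \<nu>"
    then have "(\<lambda>L. p L z) \<longlonglongrightarrow> f z"
      unfolding p_def using f space_\<nu> by (intro taylor_partial_sums_tendsto) auto
    then have "(\<lambda>L. ennreal ((norm (p L z))\<^sup>2)) \<longlonglongrightarrow> ennreal ((norm (f z))\<^sup>2)"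
      by (intro tendsto_ennrealI tendsto_intros)
    then show "ennreal ((norm (f z))\<^sup>2) = liminf (\<lambda>L. ennreal ((norm (p L z))\<^sup>2))"
      by (intro lim_imp_Liminf[symmetric]) auto
  qed
  also have "\<dots> \<le> liminf (\<lambda>L. \<integral>\<^sup>+z. ennreal ((norm (p L z))\<^sup>2) \<partial>\<nu>)"
  proof (rule nn_integral_liminf)
    fix L
    have [measurable]: "p L \<in> borel_measurable \<nu>" using bp[of L] by (simp add: bdd_meas_def)
    show "(\<lambda>z. ennreal ((norm (p L z))\<^sup>2)) \<in> borel_measurable \<nu>" by measurable
  qed
  also have "\<dots> \<le> liminf (\<lambda>L::nat. ennreal (embedding_bound * B * H_norm_sq s f))"
    by (intro Liminf_mono always_eventually allI le)
  also have "\<dots> = ennreal (embedding_bound * B * H_norm_sq s f)" by (simp add: Liminf_const)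
  also have "\<dots> = ennreal (embedding_bound * B) * ennreal (H_norm_sq s f)"
    using eb H0 by (rule ennreal_mult)
  finally show ?thesis .
qed

text \<open>The embedding is tested on f, the truncated kernel integrated over E. Its squared norm
  is at most \<open>kernel_bound s\<close> times the energy X, and its integral over E is X.
  Cauchy-Schwarz then bounds X^2 by a multiple of X.\<close>

lemma energy_indicator_le:
  assumes C: "0 \<le> C"
    and emb: "\<And>f. f \<in> H_space s \<Longrightarrow> (\<integral>\<^sup>+z. ennreal ((norm (f z))\<^sup>2) \<partial>\<nu>) \<le> ennreal C * ennreal (H_norm_sq s f)"
    and E: "E \<in> sets \<nu>"
  shows "energy (indicator E) L \<le> C * kernel_bound s * measure \<nu> E"
proof -
  let ?E = "\<lambda>z. indicator E z :: real"
  let ?h = "indicator E :: complex ^ 'd \<Rightarrow> complex"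
  have hE: "?h z = of_real (?E z)" for z by (simp add: indicator_def)
  have bE: "bdd_meas ?E" using E by (intro bdd_meas_intros)
  have h: "bdd_meas ?h" using bdd_meas_of_real[OF bE] by (simp add: of_real_indicator)
  define X where "X = energy ?h L"
  have X0: "0 \<le> X" unfolding X_def by (rule energy_nonneg)
  define b where "b n = of_real (product_coeff s n) * cnj (moment ?h n)" for n
  define f where "f z = (\<Sum>n\<in>index_box L. b n * monomial n z)" for z
  have bf: "bdd_meas f" unfolding f_def[abs_def] by (intro bdd_meas_intros)
  have norm_f: "H_norm_sq s f \<le> kernel_bound s * X"
  proof -
    have "H_norm_sq s f = (\<Sum>n\<in>index_box L. (norm (b n))\<^sup>2 * (\<Prod>j\<in>UNIV. (real (n j) + 1) powr (s $ j)))"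
      unfolding f_def[abs_def] by (rule polynomial_in_H_space(2)) simp
    also have "\<dots> \<le> (\<Sum>n\<in>index_box L. kernel_bound s * (product_coeff s n * (norm (moment ?h n))\<^sup>2))"
    proof (rule sum_mono)
      fix n
      have "(product_coeff s n * (norm (moment ?h n))\<^sup>2) * (product_coeff s n * (\<Prod>j\<in>UNIV. (real (n j) + 1) powr (s $ j)))
          \<le> (product_coeff s n * (norm (moment ?h n))\<^sup>2) * kernel_bound s"
        using product_coeff_pos[of n] by (intro mult_left_mono product_coeff_upper) auto
      moreover have "norm (b n) = product_coeff s n * norm (moment ?h n)"
        using product_coeff_pos[of n] by (simp add: b_def norm_mult)
      ultimately show "(norm (b n))\<^sup>2 * (\<Prod>j\<in>UNIV. (real (n j) + 1) powr (s $ j))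
          \<le> kernel_bound s * (product_coeff s n * (norm (moment ?h n))\<^sup>2)"
        by (simp add: power2_eq_square mult_ac)
    qed
    finally show ?thesis by (simp add: X_def energy_def sum_distrib_left)
  qed
  have f2: "(\<integral>z. (norm (f z))\<^sup>2 \<partial>\<nu>) \<le> C * (kernel_bound s * X)"
  proof -
    have "bdd_meas (\<lambda>z. (norm (f z))\<^sup>2)" unfolding power2_eq_square by (intro bdd_meas_intros bf)
    then have "ennreal (\<integral>z. (norm (f z))\<^sup>2 \<partial>\<nu>) = (\<integral>\<^sup>+z. ennreal ((norm (f z))\<^sup>2) \<partial>\<nu>)"
      by (intro nn_integral_eq_integral[symmetric] bdd_meas_integrable) auto
    also have "\<dots> \<le> ennreal C * ennreal (H_norm_sq s f)"
      by (rule emb) (simp add: f_def[abs_def] polynomial_in_H_space(1))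
    also have "\<dots> \<le> ennreal C * ennreal (kernel_bound s * X)"
      using norm_f by (intro mult_left_mono ennreal_leI) auto
    also have "\<dots> = ennreal (C * (kernel_bound s * X))"
      using C X0 kernel_bound_ge_1 by (intro ennreal_mult[symmetric]) auto
    finally show ?thesis
      using C X0 kernel_bound_ge_1 by (subst (asm) ennreal_le_iff) auto
  qed
  have "complex_of_real X = (\<integral>z. cnj (?h z) * f z \<partial>\<nu>)"
    unfolding X_def energy_eq[OF h] kernel_integral[OF h] f_def b_def by (simp only: mult_ac)
  then have "X = norm (\<integral>z. cnj (?h z) * f z \<partial>\<nu>)" using X0 by (metis norm_of_real abs_of_nonneg)
  also have "\<dots> \<le> (\<integral>z. norm (cnj (?h z) * f z) \<partial>\<nu>)" by (rule integral_norm_bound)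
  also have "\<dots> = (\<integral>z. ?E z * norm (f z) \<partial>\<nu>)"
    by (simp add: norm_mult hE)
  finally have "X \<le> (\<integral>z. ?E z * norm (f z) \<partial>\<nu>)" .
  then have "X\<^sup>2 \<le> (\<integral>z. ?E z * norm (f z) \<partial>\<nu>)\<^sup>2" using X0 by (rule power_mono)
  also have "\<dots> \<le> (\<integral>z. (?E z)\<^sup>2 \<partial>\<nu>) * (\<integral>z. (norm (f z))\<^sup>2 \<partial>\<nu>)"
    unfolding power2_eq_square[of "indicator _ _"] power2_eq_square[of "norm _"]
    using integral_square_le[where f = ?E and g = "\<lambda>z. norm (f z)"] bE bf
    by (simp add: power2_eq_square bdd_meas_integrable bdd_meas_intros)
  also have "(\<integral>z. (?E z)\<^sup>2 \<partial>\<nu>) = measure \<nu> E"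
  proof -
    have "(?E z)\<^sup>2 = ?E z" for z by (simp add: indicator_def)
    then show ?thesis using sets.sets_into_space[OF E] by (simp add: Int_absorb2)
  qed
  also have "measure \<nu> E * (\<integral>z. (norm (f z))\<^sup>2 \<partial>\<nu>) \<le> measure \<nu> E * (C * (kernel_bound s * X))"
    by (intro mult_left_mono f2) auto
  finally have "X * X \<le> (C * kernel_bound s * measure \<nu> E) * X" by (simp add: power2_eq_square mult_ac)
  then show ?thesis
    using X0 C kernel_bound_ge_1 unfolding X_def[symmetric]
    by (cases "X = 0") (auto simp: mult_le_cancel_right)
qed

text \<open>The cosine and one \<open>kernel_bound s\<close> come from the lower bound on Re K, the
  other \<open>kernel_bound s\<close> from the norm of the test function in
  \<open>energy_indicator_le\<close>.\<close>

definition testing_bound :: real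
  where "testing_bound = (kernel_bound s)\<^sup>2 / cos (3 * pi / 8)"

lemma cos_pos: "0 < cos (3 * pi / 8)"
  by (rule cos_gt_zero_pi) auto

text \<open>The two energy bounds are combined for E the tent over Q. A rectangle R inside Q has its
  tent inside E, so intersecting with E changes nothing; the other rectangles contribute nonnegative
  terms, and those outside the finite tree have null tents.\<close>

lemma testing_of_embedding:
  assumes C: "0 \<le> C"
    and emb: "\<And>f. f \<in> H_space s \<Longrightarrow> (\<integral>\<^sup>+z. ennreal ((norm (f z))\<^sup>2) \<partial>\<nu>) \<le> ennreal C * ennreal (H_norm_sq s f)"
    and Q: "Q \<in> dyadic_rectangles D"
  shows "(\<Sum>\<^sub>\<infinity>R\<in>{R \<in> dyadic_rectangles D. box_prod R \<subseteq> box_prod Q}.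
         ennreal (rect_weight D s R) * (emeasure \<nu> (rect_tent D R))\<^sup>2)
    \<le> ennreal (testing_bound * C) * emeasure \<nu> (rect_tent D Q)"
proof -
  let ?f = "\<lambda>R. ennreal (rect_weight D s R) * (emeasure \<nu> (rect_tent D R))\<^sup>2"
  let ?E = "rect_tent D Q"
  let ?S = "{R \<in> P. box_prod R \<subseteq> box_prod Q}"
  have E: "?E \<in> sets \<nu>" by (rule rect_tent_sets[OF Q])
  have kb: "1 \<le> kernel_bound s" by (rule kernel_bound_ge_1)
  have "R \<le> Q" if R: "R \<in> P" and sub: "box_prod R \<subseteq> box_prod Q" for R
    unfolding le_fun_def
  proof (intro allI subsetI)
    fix j u assume u: "u \<in> R j"
    \<comment> \<open>All sides are nonempty, so a point of one side extends to a point of the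
      rectangle; this yields the inclusion of the sides.\<close>
    have "\<exists>p. p \<in> R i" for i
      using R L.nonempty by (fastforce simp: P_def T_def)
    then obtain p where p: "\<And>i. p i \<in> R i" by metis
    have "(\<chi> i. if i = j then u else p i) \<in> box_prod R" using u p by (simp add: box_prod_def)
    then have "(\<chi> i. if i = j then u else p i) \<in> box_prod Q" using sub by blast
    then have "(\<chi> i. if i = j then u else p i) $ j \<in> Q j" unfolding box_prod_def by blast
    then show "u \<in> Q j" by simp
  qed
  then have inter: "rect_tent D R \<inter> ?E = rect_tent D R" if "R \<in> ?S" for R
    using rect_tent_mono[of R Q] Q that P_subset_rectangles by blast
  have "infsum ?f {R \<in> dyadic_rectangles D. box_prod R \<subseteq> box_prod Q} = infsum ?f ?S"
    by (rule infsum_cong_neutral) (use P_subset_rectangles rect_tent_null in auto)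
  also have "\<dots> = (\<Sum>R\<in>?S. ?f R)" by simp
  also have "\<dots> = (\<Sum>R\<in>?S. ennreal (W R * (measure \<nu> (rect_tent D R \<inter> ?E))\<^sup>2))"
    by (rule sum.cong[OF refl])
       (simp add: inter rect_weight_eq emeasure_eq_measure ennreal_mult ennreal_power W_nonneg)
  also have "\<dots> = ennreal (\<Sum>R\<in>?S. W R * (measure \<nu> (rect_tent D R \<inter> ?E))\<^sup>2)"
    by (rule sum_ennreal) (simp add: W_nonneg)
  also have "\<dots> \<le> ennreal (testing_bound * C * measure \<nu> ?E)"
  proof (rule ennreal_leI)
    have "(\<Sum>R\<in>?S. W R * (measure \<nu> (rect_tent D R \<inter> ?E))\<^sup>2) \<le> (\<Sum>R\<in>P. W R * (measure \<nu> (rect_tent D R \<inter> ?E))\<^sup>2)"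
      by (rule sum_mono2) (auto simp: W_nonneg finite_P)
    moreover have "cos (3 * pi / 8) / kernel_bound s * (\<Sum>R\<in>P. W R * (measure \<nu> (rect_tent D R \<inter> ?E))\<^sup>2)
        \<le> C * kernel_bound s * measure \<nu> ?E"
      by (rule energy_indicator_ge[OF E energy_indicator_le[OF C emb E]])
    then have "(\<Sum>R\<in>P. W R * (measure \<nu> (rect_tent D R \<inter> ?E))\<^sup>2) \<le> testing_bound * C * measure \<nu> ?E"
      using cos_pos kb by (simp add: testing_bound_def field_simps power2_eq_square)
    ultimately show "(\<Sum>R\<in>?S. W R * (measure \<nu> (rect_tent D R \<inter> ?E))\<^sup>2) \<le> testing_bound * C * measure \<nu> ?E"
      by linarith
  qed
  also have "\<dots> = ennreal (testing_bound * C) * emeasure \<nu> ?E"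
    unfolding emeasure_eq_measure using C cos_pos
    by (intro ennreal_mult) (auto simp: testing_bound_def intro!: mult_nonneg_nonneg)
  finally show ?thesis .
qed

text \<open>The constant is divided over to the left, so that the infimum on the right can be
  treated one admissible B at a time; for B = top there is nothing to show.\<close>

lemma embedding_const_le: "embedding_const s \<nu> \<le> ennreal embedding_bound * testing_const D s \<nu>"
proof -
  have eb: "0 < embedding_bound" using kernel_bound_ge_1 by (simp add: embedding_bound_def)
  have "embedding_const s \<nu> / ennreal embedding_bound \<le> testing_const D s \<nu>"
    unfolding testing_const_def
  proof (rule Inf_greatest)
    fix B assume B: "B \<in> {B. \<forall>Q\<in>dyadic_rectangles D.
      (\<Sum>\<^sub>\<infinity>R\<in>{R \<in> dyadic_rectangles D. box_prod R \<subseteq> box_prod Q}.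
         ennreal (rect_weight D s R) * (emeasure \<nu> (rect_tent D R))\<^sup>2) \<le> B * emeasure \<nu> (rect_tent D Q)}"
    show "embedding_const s \<nu> / ennreal embedding_bound \<le> B"
    proof (cases B)
      case (real b)
      have "embedding_const s \<nu> \<le> ennreal (embedding_bound * b)"
        unfolding embedding_const_def
        by (rule Inf_lower) (use embedding_of_testing[of b] real B in auto)
      also have "\<dots> = ennreal embedding_bound * B" using real eb by (simp add: ennreal_mult)
      finally have "embedding_const s \<nu> / ennreal embedding_bound \<le> (ennreal embedding_bound * B) / ennreal embedding_bound"
        by (rule divide_right_mono_ennreal)
      also have "\<dots> = B" using eb by (simp add: ennreal_mult_divide_eq mult.commute)
      finally show ?thesis .
    qed simp
  qed
  then have "ennreal embedding_bound * (embedding_const s \<nu> / ennreal embedding_bound) \<le> ennreal embedding_bound * testing_const D s \<nu>"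
    by (rule mult_left_mono) simp
  moreover have "ennreal embedding_bound * (embedding_const s \<nu> / ennreal embedding_bound) = embedding_const s \<nu>"
    using eb by (simp add: ennreal_times_divide mult.commute ennreal_mult_divide_eq)
  ultimately show ?thesis by simp
qed

lemma testing_const_le:
  assumes "C \<in> {C. \<forall>f\<in>H_space s. (\<integral>\<^sup>+z. ennreal ((norm (f z))\<^sup>2) \<partial>\<nu>) \<le> C * ennreal (H_norm_sq s f)}"
  shows "testing_const D s \<nu> \<le> ennreal testing_bound * C"
proof (cases C)
  case (real c)
  have "testing_const D s \<nu> \<le> ennreal (testing_bound * c)"
    unfolding testing_const_def
    by (rule Inf_lower) (use testing_of_embedding[of c] real assms in auto)
  also have "\<dots> = ennreal testing_bound * C"
    unfolding real(2) using real(1) cos_pos by (intro ennreal_mult) (auto simp: testing_bound_def)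
  finally show ?thesis .
next
  case top
  have "0 < testing_bound" using cos_pos kernel_bound_ge_1 by (simp add: testing_bound_def)
  then show ?thesis using top by (simp add: ennreal_mult_top)
qed

end

theorem mainTheorem2:
  assumes "CARD('d::finite) \<in> {2, 3}"
  shows "\<exists>\<epsilon>::real. 0 < \<epsilon> \<and> \<epsilon> < 1 \<and>
    (\<forall>s::real ^ 'd. (\<forall>j. s $ j \<in> {1 - \<epsilon>..1}) \<longrightarrow>
      (\<exists>A::real. A \<ge> 1 \<and>
        (\<forall>D :: 'd \<Rightarrow> nat \<Rightarrow> complex set set. (\<forall>j. dyadic_lattice (D j)) \<longrightarrow>
          (\<forall>(r::real) (\<nu> :: (complex ^ 'd) measure).
            0 < r \<and> r < 1 \<and> finite_borel_measure_on_polydisc \<nu> \<and>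
            measure_supp \<nu> \<subseteq> (\<lambda>z. r *\<^sub>R z) ` polydisc \<longrightarrow>
              ennreal (inverse A) * testing_const D s \<nu> \<le> embedding_const s \<nu> \<and>
              embedding_const s \<nu> \<le> ennreal A * testing_const D s \<nu>))))"
proof (rule exI[of _ "1 / 4"], intro conjI allI impI)
  fix s :: "real ^ 'd" assume s: "\<forall>j. s $ j \<in> {1 - 1 / 4..1}"
  \<comment> \<open>The constants are written out because the locale also fixes D, r, \<nu> and M,
    while A must be chosen before these. Only s enters, through \<open>kernel_bound\<close>.\<close>
  define a b where "a = (kernel_bound s)\<^sup>2 / cos (3 * pi / 8)" and "b = (kernel_bound s)\<^sup>2 * (6 ^ 3 * (4 * 2304 ^ 8))"
  define A where "A = max 1 (max a b)"
  show "\<exists>A::real. A \<ge> 1 \<and>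
        (\<forall>D :: 'd \<Rightarrow> nat \<Rightarrow> complex set set. (\<forall>j. dyadic_lattice (D j)) \<longrightarrow>
          (\<forall>(r::real) (\<nu> :: (complex ^ 'd) measure).
            0 < r \<and> r < 1 \<and> finite_borel_measure_on_polydisc \<nu> \<and>
            measure_supp \<nu> \<subseteq> (\<lambda>z. r *\<^sub>R z) ` polydisc \<longrightarrow>
              ennreal (inverse A) * testing_const D s \<nu> \<le> embedding_const s \<nu> \<and>
              embedding_const s \<nu> \<le> ennreal A * testing_const D s \<nu>))"
  proof (intro exI[of _ A] conjI allI impI)
    show A1: "1 \<le> A" by (simp add: A_def)
    fix D :: "'d \<Rightarrow> nat \<Rightarrow> complex set set" and r :: real and \<nu> :: "(complex ^ 'd) measure"
    assume D: "\<forall>j. dyadic_lattice (D j)"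
      and *: "0 < r \<and> r < 1 \<and> finite_borel_measure_on_polydisc \<nu> \<and> measure_supp \<nu> \<subseteq> (\<lambda>z. r *\<^sub>R z) ` polydisc"
    obtain M where M: "(1 / 2) ^ M < 1 - r" using real_arch_pow_inv[of "1 - r" "1 / 2"] * by auto
    interpret carleson D s r \<nu> M
    proof
      show "dyadic_lattice (D j)" for j using D by blast
      show "s $ j \<in> {3 / 4..1}" for j using s by simp
      show "1 / 2 ^ M \<le> 1 - r" using M by (simp add: power_one_over)
      show "CARD('d) \<le> 3" using assms by auto
    qed (use * in auto)
    have ab: "testing_bound = a" "embedding_bound = b"
      by (simp_all add: testing_bound_def embedding_bound_def a_def b_def)
    show "ennreal (inverse A) * testing_const D s \<nu> \<le> embedding_const s \<nu>"
      unfolding embedding_const_def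
    proof (rule Inf_greatest)
      fix C assume "C \<in> {C. \<forall>f\<in>H_space s. (\<integral>\<^sup>+z. ennreal ((norm (f z))\<^sup>2) \<partial>\<nu>) \<le> C * ennreal (H_norm_sq s f)}"
      from testing_const_le[OF this] have "testing_const D s \<nu> \<le> ennreal a * C" by (simp only: ab)
      also have "\<dots> \<le> ennreal A * C" by (intro mult_right_mono ennreal_leI) (auto simp: A_def)
      finally have "ennreal (inverse A) * testing_const D s \<nu> \<le> ennreal (inverse A) * (ennreal A * C)"
        by (rule mult_left_mono) simp
      also have "\<dots> = ennreal (inverse A * A) * C" using A1 by (subst ennreal_mult) (auto simp: mult.assoc)
      also have "\<dots> = C" using A1 by simp
      finally show "ennreal (inverse A) * testing_const D s \<nu> \<le> C" .
    qed
    have "embedding_const s \<nu> \<le> ennreal b * testing_const D s \<nu>"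
      using embedding_const_le by (simp only: ab)
    also have "\<dots> \<le> ennreal A * testing_const D s \<nu>"
      by (intro mult_right_mono ennreal_leI) (auto simp: A_def)
    finally show "embedding_const s \<nu> \<le> ennreal A * testing_const D s \<nu>" .
  qed
qed auto

end
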